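(* Let $N\ge 3$. For every smooth compact set $\Omega\subset\mathbb{R}^N$ and every smooth function $\varphi:\mathbb{R}^N\to\mathbb{R}$, there exists a unique minimizer $\mu$ of the problem \[ \mathcal{F}(\Omega)=\min\{F(\mu)\ :\ \mu \text{ admissible for } \Omega\},\qquad F(\mu)=I_2(\mu)+\int_\Omega \varphi\,d\mu . \]
   Context: A smooth compact set is the closure of a bounded open subset of $\mathbb{R}^N$ whose boundary is a smooth ($C^\infty$) hypersurface (the open set lying locally on one side of it). For a signed Borel measure $\mu$ on $\mathbb{R}^N$, \[ I_2(\mu):=\int_{\mathbb{R}^N\times\mathbb{R}^N}\frac{d\mu(x)\,d\mu(y)}{|x-y|^{N-2}} . \] A measure $\mu$ is admissible for $\Omega$ if it is a finite signed Borel measure supported on $\Omega$ with $\mu(\Omega)=0$ and $I_2(|\mu|)<+\infty$, where $|\mu|$ is the total variation measure (so that $I_2(\mu)$ is a well-defined real number). *)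

theory Defs
  imports "HOL-Analysis.Analysis"
begin

text \<open>Smoothness on an open set: iterated directional derivatives of all orders exist
  and are continuous.\<close>

primrec Ck_on :: "'a::euclidean_space set \<Rightarrow> nat \<Rightarrow> ('a \<Rightarrow> real) \<Rightarrow> bool" where
  "Ck_on S 0 f \<longleftrightarrow> continuous_on S f"
| "Ck_on S (Suc k) f \<longleftrightarrow>
     (\<forall>x\<in>S. f differentiable (at x)) \<and> (\<forall>v. Ck_on S k (\<lambda>x. frechet_derivative f (at x) v))"

definition smooth_on :: "'a::euclidean_space set \<Rightarrow> ('a \<Rightarrow> real) \<Rightarrow> bool" where
  "smooth_on S f \<longleftrightarrow> (\<forall>k. Ck_on S k f)"

text \<open>Near each of its points a smooth hypersurface is the zero set of a smooth function \<open>g\<close>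
  without critical points; that \<open>U\<close> lies locally on one side of its boundary means that \<open>g\<close> can
  be chosen such that \<open>U\<close> is locally the set where \<open>g\<close> is negative.\<close>

definition hypersurface_equation ::
  "'a::euclidean_space set \<Rightarrow> 'a set \<Rightarrow> ('a \<Rightarrow> real) \<Rightarrow> bool" where
  "hypersurface_equation S V g \<longleftrightarrow>
     open V \<and> smooth_on V g \<and> (\<forall>x\<in>V. \<exists>v. frechet_derivative g (at x) v \<noteq> 0) \<and>
     S \<inter> V = {x \<in> V. g x = 0}"

definition smooth_compact :: "'a::euclidean_space set \<Rightarrow> bool" where
  "smooth_compact \<Omega> \<longleftrightarrow>
     (\<exists>U. open U \<and> bounded U \<and> \<Omega> = closure U \<and>
       (\<forall>p\<in>frontier U. \<exists>V g. p \<in> V \<and> hypersurface_equation (frontier U) V g \<and>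
          U \<inter> V = {x \<in> V. g x < 0}))"

text \<open>A finite signed Borel measure is a countably additive real-valued function on the Borel sets.
  The value \<open>0\<close> on all other sets is a convention that makes equality of
  signed measures coincide with equality of set functions.\<close>

definition signed_borel_measure :: "('a::topological_space set \<Rightarrow> real) \<Rightarrow> bool" where
  "signed_borel_measure \<mu> \<longleftrightarrow>
     (\<forall>A :: nat \<Rightarrow> 'a set. range A \<subseteq> sets borel \<longrightarrow> disjoint_family A \<longrightarrow>
        (\<lambda>i. \<mu> (A i)) sums \<mu> (\<Union>i. A i)) \<and>
     (\<forall>A. A \<notin> sets borel \<longrightarrow> \<mu> A = 0)"

text \<open>The Jordan decomposition. The positive part of \<open>\<mu>\<close> is the upper variation
  \<open>A \<mapsto> sup {\<mu> B | B \<subseteq> A}\<close>; the negative part is the upper variation of \<open>- \<mu>\<close>. The coercion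
  \<open>ennreal\<close> truncates negative values at \<open>0 = \<mu> {}\<close>, so it does not affect the supremum.\<close>

definition upper_variation :: "('a set \<Rightarrow> real) \<Rightarrow> 'a::topological_space set \<Rightarrow> ennreal" where
  "upper_variation \<mu> A = (SUP B\<in>{B \<in> sets borel. B \<subseteq> A}. ennreal (\<mu> B))"

definition pos_part :: "('a::topological_space set \<Rightarrow> real) \<Rightarrow> 'a measure" where
  "pos_part \<mu> = measure_of UNIV (sets borel) (upper_variation \<mu>)"

definition neg_part :: "('a::topological_space set \<Rightarrow> real) \<Rightarrow> 'a measure" where
  "neg_part \<mu> = pos_part (\<lambda>A. - \<mu> A)"

definition total_variation :: "('a::topological_space set \<Rightarrow> real) \<Rightarrow> 'a measure" where
  "total_variation \<mu> = measure_of UNIV (sets borel)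
     (\<lambda>A. emeasure (pos_part \<mu>) A + emeasure (neg_part \<mu>) A)"

text \<open>The set functions handed to \<open>measure_of\<close> are indeed measures.\<close>

lemma signed_borel_measure_empty:
  assumes "signed_borel_measure \<mu>" shows "\<mu> {} = 0"
proof -
  have "(\<lambda>i::nat. \<mu> {}) sums \<mu> (\<Union>i::nat. {})"
    using assms[unfolded signed_borel_measure_def, THEN conjunct1, rule_format, of "\<lambda>_. {}"]
    by (simp add: disjoint_family_on_def)
  then have "summable (\<lambda>i::nat. \<mu> {})" by (rule sums_summable)
  then show ?thesis by (simp add: summable_const_iff)
qed

lemma signed_borel_measure_Un:
  assumes m: "signed_borel_measure \<mu>" and "A \<in> sets borel" "B \<in> sets borel" "A \<inter> B = {}"
  shows "\<mu> (A \<union> B) = \<mu> A + \<mu> B"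
proof -
  have "range (binaryset A B) \<subseteq> sets borel" "disjoint_family (binaryset A B)"
    using assms(2-4) by (auto simp: range_binaryset_eq disjoint_family_on_def binaryset_def)
  with m have "(\<lambda>i. \<mu> (binaryset A B i)) sums \<mu> (\<Union>i. binaryset A B i)"
    unfolding signed_borel_measure_def by blast
  moreover have "(\<lambda>i. \<mu> (binaryset A B i)) sums (\<mu> A + \<mu> B)"
    by (rule binaryset_sums) (simp add: signed_borel_measure_empty[OF m])
  ultimately show ?thesis by (simp add: UN_binaryset_eq sums_iff)
qed

lemma signed_borel_measure_uminus:
  assumes "signed_borel_measure \<mu>" shows "signed_borel_measure (\<lambda>A. - \<mu> A)"
  using assms unfolding signed_borel_measure_def by (auto intro: sums_minus)

lemma upper_variation_ge:
  "B \<in> sets borel \<Longrightarrow> B \<subseteq> A \<Longrightarrow> ennreal (\<mu> B) \<le> upper_variation \<mu> A"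
  unfolding upper_variation_def by (auto intro: SUP_upper)

lemma upper_variation_mono: "A \<subseteq> B \<Longrightarrow> upper_variation \<mu> A \<le> upper_variation \<mu> B"
  unfolding upper_variation_def by (intro SUP_subset_mono) auto

lemma upper_variation_superadditive:
  assumes m: "signed_borel_measure \<mu>" and d: "A \<inter> B = {}"
  shows "upper_variation \<mu> A + upper_variation \<mu> B \<le> upper_variation \<mu> (A \<union> B)"
proof -
  let ?I = "\<lambda>A. {B \<in> sets borel. B \<subseteq> A}"
  have 1: "ennreal (\<mu> S) + ennreal (\<mu> T) \<le> upper_variation \<mu> (A \<union> B)"
    if S: "S \<in> ?I A" and T: "T \<in> ?I B" for S T
  proof (cases "\<mu> S \<ge> 0 \<and> \<mu> T \<ge> 0")
    case True
    then have "ennreal (\<mu> S) + ennreal (\<mu> T) = ennreal (\<mu> (S \<union> T))"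
      using S T d by (subst signed_borel_measure_Un[OF m]) (auto simp: ennreal_plus)
    also have "\<dots> \<le> upper_variation \<mu> (A \<union> B)"
      using S T by (intro upper_variation_ge) auto
    finally show ?thesis .
  next
    case False
    have "ennreal (\<mu> S) \<le> upper_variation \<mu> (A \<union> B)" "ennreal (\<mu> T) \<le> upper_variation \<mu> (A \<union> B)"
      using S T by (auto intro!: upper_variation_ge)
    with False show ?thesis by (auto simp: ennreal_neg)
  qed
  have ne: "?I A \<noteq> {}" "?I B \<noteq> {}" by auto
  have "upper_variation \<mu> A + upper_variation \<mu> B
      = (SUP S\<in>?I A. ennreal (\<mu> S) + upper_variation \<mu> B)"
    unfolding upper_variation_def[of \<mu> A] by (rule ennreal_SUP_add_left[symmetric, OF ne(1)])
  also have "\<dots> \<le> upper_variation \<mu> (A \<union> B)"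
  proof (rule SUP_least)
    fix S assume S: "S \<in> ?I A"
    have "ennreal (\<mu> S) + upper_variation \<mu> B = (SUP T\<in>?I B. ennreal (\<mu> S) + ennreal (\<mu> T))"
      unfolding upper_variation_def[of \<mu> B] by (rule ennreal_SUP_add_right[OF ne(2)])
    also have "\<dots> \<le> upper_variation \<mu> (A \<union> B)" by (rule SUP_least) (rule 1[OF S])
    finally show "ennreal (\<mu> S) + upper_variation \<mu> B \<le> upper_variation \<mu> (A \<union> B)" .
  qed
  finally show ?thesis .
qed

lemma countably_additive_upper_variation:
  fixes \<mu> :: "'a::topological_space set \<Rightarrow> real"
  assumes m: "signed_borel_measure \<mu>"
  shows "countably_additive (sets borel) (upper_variation \<mu>)"
  unfolding countably_additive_def
proof (intro allI impI antisym)
  fix A :: "nat \<Rightarrow> 'a set"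
  assume A: "range A \<subseteq> sets borel" "disjoint_family A"
  have "(\<Sum>i<n. upper_variation \<mu> (A i)) \<le> upper_variation \<mu> (\<Union>i<n. A i)" for n
  proof (induction n)
    case (Suc n)
    have *: "(\<Union>i<n. A i) \<inter> A n = {}" using disjoint_family_onD[OF A(2), of _ n] by fast
    have "(\<Sum>i<Suc n. upper_variation \<mu> (A i)) = (\<Sum>i<n. upper_variation \<mu> (A i)) + upper_variation \<mu> (A n)"
      by simp
    also have "\<dots> \<le> upper_variation \<mu> (\<Union>i<n. A i) + upper_variation \<mu> (A n)"
      by (rule add_right_mono[OF Suc])
    also have "\<dots> \<le> upper_variation \<mu> ((\<Union>i<n. A i) \<union> A n)"
      by (rule upper_variation_superadditive[OF m *])
    also have "(\<Union>i<n. A i) \<union> A n = (\<Union>i<Suc n. A i)"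
      by (auto simp: lessThan_Suc)
    finally show ?case .
  qed simp
  then have "(\<Sum>i<n. upper_variation \<mu> (A i)) \<le> upper_variation \<mu> (\<Union>i. A i)" for n
    by (rule order_trans) (rule upper_variation_mono, auto)
  then show "(\<Sum>i. upper_variation \<mu> (A i)) \<le> upper_variation \<mu> (\<Union>i. A i)"
    by (intro suminf_le_const) auto
  show "upper_variation \<mu> (\<Union>i. A i) \<le> (\<Sum>i. upper_variation \<mu> (A i))"
    unfolding upper_variation_def[of \<mu> "\<Union>i. A i"]
  proof (rule SUP_least)
    fix B assume B: "B \<in> {B \<in> sets borel. B \<subseteq> (\<Union>i. A i)}"
    have "range (\<lambda>i. B \<inter> A i) \<subseteq> sets borel" using A(1) B by auto
    moreover have "disjoint_family (\<lambda>i. B \<inter> A i)"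
      by (rule disjoint_family_on_bisimulation[OF A(2)]) auto
    ultimately have "(\<lambda>i. \<mu> (B \<inter> A i)) sums \<mu> (\<Union>i. B \<inter> A i)"
      using m unfolding signed_borel_measure_def by blast
    moreover have "(\<Union>i. B \<inter> A i) = B" using B by auto
    ultimately have "(\<lambda>n. \<Sum>i<n. \<mu> (B \<inter> A i)) \<longlonglongrightarrow> \<mu> B" by (simp add: sums_def)
    then have lim: "(\<lambda>n. ennreal (\<Sum>i<n. \<mu> (B \<inter> A i))) \<longlonglongrightarrow> ennreal (\<mu> B)"
      by (rule tendsto_ennrealI)
    have "ennreal (\<Sum>i<n. \<mu> (B \<inter> A i)) \<le> (\<Sum>i. upper_variation \<mu> (A i))" for n
    proof -
      have "ennreal (\<Sum>i<n. \<mu> (B \<inter> A i)) \<le> ennreal (\<Sum>i<n. max 0 (\<mu> (B \<inter> A i)))"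
        by (intro ennreal_leI sum_mono) auto
      also have "\<dots> = (\<Sum>i<n. ennreal (max 0 (\<mu> (B \<inter> A i))))" by (subst sum_ennreal) auto
      also have "\<dots> \<le> (\<Sum>i<n. upper_variation \<mu> (A i))"
        using A B by (intro sum_mono) (auto simp: max_def ennreal_neg intro!: upper_variation_ge)
      also have "\<dots> \<le> (\<Sum>i. upper_variation \<mu> (A i))" by (rule sum_le_suminf) auto
      finally show ?thesis .
    qed
    with lim show "ennreal (\<mu> B) \<le> (\<Sum>i. upper_variation \<mu> (A i))"
      by (intro LIMSEQ_le_const2[OF lim]) auto
  qed
qed

lemma sets_pos_part [simp]: "sets (pos_part \<mu>) = sets borel"
  and sets_neg_part [simp]: "sets (neg_part \<mu>) = sets borel"
  and sets_total_variation [simp]: "sets (total_variation \<mu>) = sets borel"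
  and space_pos_part [simp]: "space (pos_part \<mu>) = UNIV"
  and space_neg_part [simp]: "space (neg_part \<mu>) = UNIV"
  and space_total_variation [simp]: "space (total_variation \<mu>) = UNIV"
proof -
  have *: "sigma_sets UNIV (sets borel) = sets (borel :: 'a measure)"
    using sets.sigma_sets_eq[of "borel :: 'a measure"] by simp
  show "sets (pos_part \<mu>) = sets borel" "sets (neg_part \<mu>) = sets borel"
    "sets (total_variation \<mu>) = sets borel" "space (pos_part \<mu>) = UNIV"
    "space (neg_part \<mu>) = UNIV" "space (total_variation \<mu>) = UNIV"
    by (simp_all add: pos_part_def neg_part_def total_variation_def sets_measure_of_conv
        space_measure_of_conv *)
qed

lemma emeasure_pos_part:
  fixes \<mu> :: "'a::topological_space set \<Rightarrow> real"
  assumes m: "signed_borel_measure \<mu>" and A: "A \<in> sets borel"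
  shows "emeasure (pos_part \<mu>) A = upper_variation \<mu> A"
proof (rule emeasure_measure_of[OF pos_part_def])
  show "positive (sets (pos_part \<mu>)) (upper_variation \<mu>)"
  proof -
    have "{B \<in> sets borel. B \<subseteq> {}} = {{} :: 'a set}" by auto
    then show ?thesis
      by (simp add: positive_def upper_variation_def signed_borel_measure_empty[OF m] del: subset_empty)
  qed
  show "countably_additive (sets (pos_part \<mu>)) (upper_variation \<mu>)"
    using countably_additive_upper_variation[OF m] by simp
qed (use A in auto)

lemma emeasure_neg_part:
  assumes "signed_borel_measure \<mu>" and "A \<in> sets borel"
  shows "emeasure (neg_part \<mu>) A = upper_variation (\<lambda>A. - \<mu> A) A"
  unfolding neg_part_def by (rule emeasure_pos_part[OF signed_borel_measure_uminus[OF assms(1)] assms(2)])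

lemma emeasure_total_variation:
  assumes A: "A \<in> sets borel"
  shows "emeasure (total_variation \<mu>) A = emeasure (pos_part \<mu>) A + emeasure (neg_part \<mu>) A"
proof (rule emeasure_measure_of[OF total_variation_def])
  show "countably_additive (sets (total_variation \<mu>))
      (\<lambda>A. emeasure (pos_part \<mu>) A + emeasure (neg_part \<mu>) A)"
    unfolding countably_additive_def
    by (auto simp: suminf_add[symmetric] suminf_emeasure)
qed (use A in \<open>auto simp: positive_def\<close>)

definition signed_set_integral ::
  "('a::topological_space set \<Rightarrow> real) \<Rightarrow> 'a set \<Rightarrow> ('a \<Rightarrow> real) \<Rightarrow> real" where
  "signed_set_integral \<mu> A f = (LINT x:A|pos_part \<mu>. f x) - (LINT x:A|neg_part \<mu>. f x)"

text \<open>The kernel takes values in \<^typ>\<open>ennreal\<close> so that it is infinite on the diagonal and atoms have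
  infinite energy; with real division its diagonal value would be \<open>0\<close>.\<close>

definition kernel :: "'a::euclidean_space \<Rightarrow> 'a \<Rightarrow> ennreal" where
  "kernel x y = 1 / ennreal (norm (x - y) ^ (DIM('a) - 2))"

lemma kernel_diagonal: "DIM('a) \<ge> 3 \<Longrightarrow> kernel x (x :: 'a::euclidean_space) = \<infinity>"
  by (simp add: kernel_def divide_ennreal_def power_0_left)

definition mutual_energy :: "'a::euclidean_space measure \<Rightarrow> 'a measure \<Rightarrow> ennreal" where
  "mutual_energy M M' = (\<integral>\<^sup>+ (x, y). kernel x y \<partial>(M \<Otimes>\<^sub>M M'))"

definition admissible :: "'a::euclidean_space set \<Rightarrow> ('a set \<Rightarrow> real) \<Rightarrow> bool" where
  "admissible \<Omega> \<mu> \<longleftrightarrow>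
     signed_borel_measure \<mu> \<and> emeasure (total_variation \<mu>) (- \<Omega>) = 0 \<and> \<mu> \<Omega> = 0 \<and>
     mutual_energy (total_variation \<mu>) (total_variation \<mu>) < \<infinity>"

text \<open>The integral of the kernel against the signed product measure \<open>\<mu> \<otimes> \<mu>\<close>, expanded by
  bilinearity. If \<open>|\<mu>|\<close> has finite energy then all four terms are finite, so that
  \<^const>\<open>enn2real\<close> loses nothing.\<close>

definition I2 :: "('a::euclidean_space set \<Rightarrow> real) \<Rightarrow> real" where
  "I2 \<mu> = enn2real (mutual_energy (pos_part \<mu>) (pos_part \<mu>))
        - enn2real (mutual_energy (pos_part \<mu>) (neg_part \<mu>))
        - enn2real (mutual_energy (neg_part \<mu>) (pos_part \<mu>))
        + enn2real (mutual_energy (neg_part \<mu>) (neg_part \<mu>))"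

definition F :: "('a::euclidean_space \<Rightarrow> real) \<Rightarrow> 'a set \<Rightarrow> ('a set \<Rightarrow> real) \<Rightarrow> real" where
  "F \<phi> \<Omega> \<mu> = I2 \<mu> + signed_set_integral \<mu> \<Omega> \<phi>"

end

theory Submission
  imports Defs "HOL-Probability.Probability"
begin

text \<open>The kernel is a superposition of products of Gaussians, so that the energy is the square of an
  \<open>L\<^sup>2\<close> norm of Gaussian transforms; it is therefore positive definite and lower semicontinuous. By convexity it
  suffices to find an admissible \<open>\<mu>\<close> whose potential is \<open>(c - \<phi>) / 2\<close> quasi-everywhere on \<open>\<Omega>\<close>, since then
  \<open>F \<phi> \<Omega> \<nu> = F \<phi> \<Omega> \<mu> + I2 (\<nu> - \<mu>)\<close> for all admissible \<open>\<nu>\<close>. On \<open>\<Omega>\<close> one writes \<open>\<phi>\<close> as a difference of two globally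
  superharmonic functions vanishing at infinity. Each of these agrees quasi-everywhere on \<open>\<Omega>\<close> with the potential of
  a positive measure on \<open>\<Omega>\<close>, namely of the minimizer \<open>M\<close> of the energy of \<open>M\<close> minus twice the integral of the function
  over \<open>M\<close>: weak compactness of positive measures yields the minimizer, and the domination principle
  shows that its potential does not exceed the function.\<close>

section \<open>A Gaussian representation of the kernel\<close>

text \<open>Minimizing over signed measures directly lacks compactness: a bound on the energy does
  not bound the total variation, so a minimizing sequence may converge in energy to something that
  is not a measure. For positive measures on a compact set the energy does bound the mass, because
  the kernel is bounded below there; hence the detour through two obstacle problems. Smoothness of
  \<open>\<phi>\<close> enters as a bound on its second differences, which a large multiple of a
  strictly superharmonic bubble outweighs. The Gaussian transform takes the place of the Fourier
  transform. It is nonnegative, so integrals are interchanged by Tonelli, and it tests a measure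
  against bounded continuous functions, so weak convergence gives pointwise convergence and Fatou
  gives semicontinuity. Superharmonicity is a statement about second differences along the axes,
  which passes to minima and makes sense for merely continuous functions. Capacity never appears:
  "quasi-everywhere" is rendered as "almost everywhere for every positive measure of finite energy
  on \<open>\<Omega>\<close>", or by the integrated identity for \<open>ip M N\<close>.\<close>

lemma nn_integral_power_exp:
  fixes a r :: real
  assumes "a > 0" "r > 0"
  shows "(\<integral>\<^sup>+t. ennreal (indicator {0..} t * t powr (a - 1) * exp (- (t * r))) \<partial>lborel)
    = ennreal (Gamma a * r powr - a)"
proof -
  have "(\<integral>\<^sup>+t. ennreal (indicator {0..} t * t powr (a - 1) * exp (- (t * r))) \<partial>lborel)
     = ennreal \<bar>1 / r\<bar> * (\<integral>\<^sup>+t. ennreal (indicator {0..} (0 + (1/r) * t) * (0 + (1/r) * t) powr (a - 1)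
          * exp (- ((0 + (1/r) * t) * r))) \<partial>lborel)"
    using assms by (intro nn_integral_real_affine) auto
  also have "\<dots> = ennreal \<bar>1 / r\<bar> * (\<integral>\<^sup>+t. ennreal (r powr (1 - a)) *
      ennreal (indicator {0..} t * t powr (a - 1) / exp t) \<partial>lborel)"
  proof -
    have "ennreal (indicator {0..} (0 + (1/r) * t) * (0 + (1/r) * t) powr (a - 1) * exp (- ((0 + (1/r) * t) * r)))
       = ennreal (r powr (1 - a)) * ennreal (indicator {0..} t * t powr (a - 1) / exp t)" for t
    proof -
      have "(1/r * t) powr (a - 1) = r powr (1 - a) * t powr (a - 1)" if "t \<ge> 0"
        using assms that by (simp add: powr_mult powr_divide powr_diff field_simps)
      then show ?thesis
        using assms by (auto simp: ennreal_mult'[symmetric] indicator_def exp_minus field_simps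
            zero_le_divide_iff)
    qed
    then show ?thesis by simp
  qed
  also have "\<dots> = ennreal (1 / r) * (ennreal (r powr (1 - a)) * ennreal (Gamma a))"
    using assms by (simp add: nn_integral_cmult Gamma_conv_nn_integral_real)
  also have "\<dots> = ennreal (Gamma a * r powr - a)"
  proof -
    have "1 / r * (r powr (1 - a) * Gamma a) = Gamma a * r powr - a"
      using assms by (simp add: powr_diff powr_minus field_simps)
    then show ?thesis using assms Gamma_real_pos[of a] by (simp add: ennreal_mult'[symmetric] less_imp_le)
  qed
  finally show ?thesis .
qed

text \<open>The damped integrals are lower bounds equal to \<open>Gamma a * r powr - a\<close>,
  which is unbounded as \<open>r\<close> tends to 0. This case yields the infinite value of the
  kernel on the diagonal.\<close>

lemma nn_integral_power_top:
  fixes a :: real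
  assumes "a > 0"
  shows "(\<integral>\<^sup>+t. ennreal (indicator {0..} t * t powr (a - 1)) \<partial>lborel) = \<infinity>"
proof (rule ccontr)
  assume "(\<integral>\<^sup>+t. ennreal (indicator {0..} t * t powr (a - 1)) \<partial>lborel) \<noteq> \<infinity>"
  then obtain b where b: "b \<ge> 0" "(\<integral>\<^sup>+t. ennreal (indicator {0..} t * t powr (a - 1)) \<partial>lborel) = ennreal b"
    by (cases "\<integral>\<^sup>+t. ennreal (indicator {0..} t * t powr (a - 1)) \<partial>lborel") auto
  have *: "Gamma a * r powr - a \<le> b" if "r > 0" for r
  proof -
    have "ennreal (Gamma a * r powr - a) \<le> ennreal b"
      unfolding nn_integral_power_exp[OF assms that, symmetric] b(2)[symmetric]
      using that by (intro nn_integral_mono ennreal_leI) (auto simp: indicator_def intro!: mult_left_le)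
    then show ?thesis using b by simp
  qed
  have g: "Gamma a > 0" "Gamma a \<noteq> 0" using Gamma_real_pos[OF assms] by linarith+
  \<comment> \<open>Solves \<open>Gamma a * r powr - a = b + 1\<close>.\<close>
  define r where "r = ((b + 1) / Gamma a) powr (- 1 / a)"
  have "Gamma a * r powr - a = b + 1"
    using g b assms by (simp add: r_def powr_powr)
  moreover have "r > 0" using g b by (simp add: r_def)
  ultimately show False using *[of r] by simp
qed

definition gauss_mass :: "'a::euclidean_space itself \<Rightarrow> real \<Rightarrow> ennreal" where
  "gauss_mass _ t = (\<integral>\<^sup>+z. ennreal (exp (- 4 * \<bar>t\<bar> * (norm (z::'a))\<^sup>2)) \<partial>lborel)"

lemma nn_integral_exp_square_finite:
  assumes "t > (0::real)"
  shows "(\<integral>\<^sup>+x. ennreal (exp (- t * x\<^sup>2)) \<partial>lborel) < \<infinity>"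
proof -
  define \<sigma> where "\<sigma> = sqrt (1 / (2 * t))"
  have s: "\<sigma> > 0" "2 * \<sigma>\<^sup>2 = 1 / t" using assms by (auto simp: \<sigma>_def)
  have "integrable lborel (normal_density 0 \<sigma>)"
    using integrable_normal_moment[OF s(1), of 0 0] by simp
  then have "integrable lborel (\<lambda>x. sqrt (2 * pi * \<sigma>\<^sup>2) * normal_density 0 \<sigma> x)"
    by (rule integrable_mult_right)
  also have "(\<lambda>x. sqrt (2 * pi * \<sigma>\<^sup>2) * normal_density 0 \<sigma> x) = (\<lambda>x. exp (- t * x\<^sup>2))"
    using s by (auto simp: normal_density_def fun_eq_iff)
  finally show ?thesis
    by (subst (asm) integrable_iff_bounded) auto
qed

lemma gauss_mass_finite:
  assumes "t > 0" shows "gauss_mass TYPE('a::euclidean_space) t < \<infinity>"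
proof -
  have "gauss_mass TYPE('a) t = (\<integral>\<^sup>+z. ennreal (\<Prod>b\<in>Basis. exp (- (4 * t) * ((z::'a) \<bullet> b)\<^sup>2)) \<partial>lborel)"
  proof -
    have "(norm z)\<^sup>2 = (\<Sum>b\<in>Basis. (z \<bullet> b)\<^sup>2)" for z :: 'a
      unfolding power2_norm_eq_inner by (subst euclidean_inner) (simp add: power2_eq_square)
    then show ?thesis
      using assms by (simp add: gauss_mass_def exp_sum sum_distrib_left sum_negf flip: exp_sum)
  qed
  also have "\<dots> = (\<integral>\<^sup>+z. (\<Prod>b\<in>Basis. ennreal (exp (- (4 * t) * ((z::'a) \<bullet> b)\<^sup>2))) \<partial>lborel)"
    by (simp add: prod_ennreal)
  also have "\<dots> = (\<Prod>b\<in>(Basis::'a set). \<integral>\<^sup>+x. ennreal (exp (- (4 * t) * x\<^sup>2)) \<partial>lborel)"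
    by (rule nn_integral_lborel_prod) auto
  also have "\<dots> < \<infinity>"
    using nn_integral_exp_square_finite[of "4 * t"] assms
    by (simp add: ennreal_prod_eq_top less_top[symmetric] power_eq_top_ennreal)
  finally show ?thesis .
qed

lemma gauss_mass_pos: "gauss_mass TYPE('a::euclidean_space) t > 0"
proof -
  have "\<not> (AE z in lborel. ennreal (exp (- 4 * \<bar>t\<bar> * (norm (z::'a))\<^sup>2)) = 0)"
    by (auto simp: AE_iff_null ennreal_eq_0_iff not_le null_sets_def)
  then have "gauss_mass TYPE('a) t \<noteq> 0"
    unfolding gauss_mass_def by (subst nn_integral_0_iff_AE) auto
  then show ?thesis by (simp add: zero_less_iff_neq_zero)
qed

lemma measurable_gauss_mass [measurable]: "gauss_mass TYPE('a::euclidean_space) \<in> borel_measurable borel"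
  unfolding gauss_mass_def by measurable

text \<open>A Gaussian with inverse squared width \<open>fst q\<close> and centre
  \<open>snd q\<close>. The absolute value keeps it in [0, 1] for all parameters; negative widths
  later get weight 0.\<close>

definition gauss :: "real \<times> 'a::euclidean_space \<Rightarrow> 'a \<Rightarrow> real" where
  "gauss q x = exp (- 2 * \<bar>fst q\<bar> * (norm (x - snd q))\<^sup>2)"

lemma gauss_nonneg [simp]: "0 \<le> gauss q x"
  and gauss_le_1 [simp]: "gauss q x \<le> 1"
  by (auto simp: gauss_def)

lemma measurable_gauss:
  "(\<lambda>(q, x). gauss q x) \<in> borel_measurable (borel \<Otimes>\<^sub>M borel)"
proof -
  have "continuous_on UNIV (\<lambda>(q, x :: 'a). gauss q x)"
    unfolding gauss_def case_prod_beta by (intro continuous_intros)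
  then show ?thesis unfolding borel_prod by (rule borel_measurable_continuous_onI)
qed

lemma measurable_gauss' [measurable (raw)]:
  assumes "f \<in> M \<rightarrow>\<^sub>M borel" "g \<in> M \<rightarrow>\<^sub>M borel"
  shows "(\<lambda>x. gauss (f x) (g x)) \<in> borel_measurable M"
proof -
  have "(\<lambda>x. (f x, g x)) \<in> M \<rightarrow>\<^sub>M borel \<Otimes>\<^sub>M borel" using assms by measurable
  from measurable_compose[OF this measurable_gauss] show ?thesis by simp
qed

lemma measurable_pair_lborel_gauss [measurable]:
  "(\<lambda>q. gauss q x) \<in> borel_measurable (lborel \<Otimes>\<^sub>M lborel)"
proof -
  have "(\<lambda>q. q) \<in> (lborel \<Otimes>\<^sub>M lborel) \<rightarrow>\<^sub>M (borel :: (real \<times> 'a::euclidean_space) measure)"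
    by (rule measurable_ident_sets) (simp add: borel_prod[symmetric])
  then show ?thesis by measurable
qed

text \<open>By the parallelogram law about the midpoint \<open>m\<close> of \<open>x\<close> and
  \<open>y\<close>, the product of the two Gaussians splits into a factor in \<open>x - y\<close>
  and a Gaussian in \<open>z - m\<close>; translation invariance removes \<open>m\<close>.\<close>

lemma gauss_product_integral:
  fixes x y :: "'a::euclidean_space"
  shows "(\<integral>\<^sup>+z. ennreal (gauss (t, z) x * gauss (t, z) y) \<partial>lborel)
    = ennreal (exp (- \<bar>t\<bar> * (norm (x - y))\<^sup>2)) * gauss_mass TYPE('a) t"
proof -
  define m where "m = (1/2) *\<^sub>R (x + y)"
  have *: "gauss (t, m + z) x * gauss (t, m + z) y = exp (- \<bar>t\<bar> * (norm (x - y))\<^sup>2) * exp (- 4 * \<bar>t\<bar> * (norm z)\<^sup>2)" for z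
  proof -
    have "2 * (norm (x - (m + z)))\<^sup>2 + 2 * (norm (y - (m + z)))\<^sup>2 = (norm (x - y))\<^sup>2 + 4 * (norm z)\<^sup>2"
      unfolding m_def power2_norm_eq_inner
      by (simp add: inner_simps algebra_simps inner_commute)
    then have "- 2 * \<bar>t\<bar> * (norm (x - (m + z)))\<^sup>2 + (- 2 * \<bar>t\<bar> * (norm (y - (m + z)))\<^sup>2)
       = - \<bar>t\<bar> * (norm (x - y))\<^sup>2 + (- 4 * \<bar>t\<bar> * (norm z)\<^sup>2)"
      by algebra
    then show ?thesis unfolding gauss_def by (simp add: exp_add[symmetric])
  qed
  have "(\<integral>\<^sup>+z. ennreal (gauss (t, z) x * gauss (t, z) y) \<partial>lborel)
     = (\<integral>\<^sup>+z. ennreal (gauss (t, z) x * gauss (t, z) y) \<partial>distr lborel borel ((+) m))"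
    by (simp add: lborel_distr_plus)
  also have "\<dots> = (\<integral>\<^sup>+z. ennreal (exp (- \<bar>t\<bar> * (norm (x - y))\<^sup>2)) * ennreal (exp (- 4 * \<bar>t\<bar> * (norm (z::'a))\<^sup>2)) \<partial>lborel)"
    by (subst nn_integral_distr) (simp_all add: * ennreal_mult)
  also have "\<dots> = ennreal (exp (- \<bar>t\<bar> * (norm (x - y))\<^sup>2)) * gauss_mass TYPE('a) t"
    unfolding gauss_mass_def by (rule nn_integral_cmult) simp
  finally show ?thesis .
qed

text \<open>Half of the exponent of the kernel, because Gaussians depend on the squared
  distance.\<close>

definition kexp :: "'a::euclidean_space itself \<Rightarrow> real" where
  "kexp _ = (real DIM('a) - 2) / 2"

text \<open>The weight of the Gamma integral for \<open>r powr - kexp\<close>, divided by the mass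
  that integration over the centres produces.\<close>

definition gauss_weight :: "'a::euclidean_space itself \<Rightarrow> real \<Rightarrow> ennreal" where
  "gauss_weight _ t = ennreal (indicator {0..} t * t powr (kexp TYPE('a) - 1) / Gamma (kexp TYPE('a)))
     / gauss_mass TYPE('a) t"

definition gauss_space :: "(real \<times> 'a::euclidean_space) measure" where
  "gauss_space = density (lborel \<Otimes>\<^sub>M lborel) (\<lambda>q. gauss_weight TYPE('a) (fst q))"

lemma sets_gauss_space [simp, measurable_cong]:
  "sets (gauss_space :: (real \<times> 'a::euclidean_space) measure) = sets borel"
  by (simp add: gauss_space_def borel_prod[symmetric])

lemma measurable_gauss_weight [measurable]: "gauss_weight TYPE('a::euclidean_space) \<in> borel_measurable borel"
  unfolding gauss_weight_def by measurable

lemma kernel_eq_powr: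
  assumes "DIM('a) \<ge> 3" "x \<noteq> (y::'a::euclidean_space)"
  shows "kernel x y = ennreal (((norm (x - y))\<^sup>2) powr - kexp TYPE('a))"
proof -
  have "((norm (x - y))\<^sup>2) powr kexp TYPE('a) = norm (x - y) ^ (DIM('a) - 2)"
  proof -
    have "(norm (x - y))\<^sup>2 = norm (x - y) powr 2"
      using assms(2) by (simp add: powr_numeral)
    then have "((norm (x - y))\<^sup>2) powr kexp TYPE('a) = norm (x - y) powr (2 * kexp TYPE('a))"
      by (simp only: powr_powr)
    also have "2 * kexp TYPE('a) = real (DIM('a) - 2)"
      using assms by (simp add: kexp_def of_nat_diff field_simps)
    also have "norm (x - y) powr (real (DIM('a) - 2)) = norm (x - y) ^ (DIM('a) - 2)"
      using assms by (subst powr_realpow) auto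
    finally show ?thesis .
  qed
  moreover have "norm (x - y) ^ (DIM('a) - 2) > 0" using assms by simp
  ultimately show ?thesis
    unfolding kernel_def by (simp add: powr_minus divide_ennreal[symmetric] inverse_eq_divide
        flip: ennreal_1)
qed

text \<open>Integrating out the centre leaves \<open>exp (- t * r)\<close> with \<open>r\<close> the
  squared distance, and the Gamma integral over \<open>t\<close> turns this into
  \<open>r powr - kexp\<close>. On the diagonal the integral diverges, in agreement with the
  infinite kernel.\<close>

lemma kernel_gauss:
  fixes x y :: "'a::euclidean_space"
  assumes "DIM('a) \<ge> 3"
  shows "kernel x y = (\<integral>\<^sup>+q. ennreal (gauss q x * gauss q y) \<partial>gauss_space)"
proof -
  define a where "a = kexp TYPE('a)"
  have a: "a > 0" using assms by (simp add: a_def kexp_def)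
  have "(\<integral>\<^sup>+q. ennreal (gauss q x * gauss q y) \<partial>gauss_space)
    = (\<integral>\<^sup>+q. gauss_weight TYPE('a) (fst q) * ennreal (gauss q x * gauss q y) \<partial>(lborel \<Otimes>\<^sub>M lborel))"
    unfolding gauss_space_def by (subst nn_integral_density) auto
  also have "\<dots> = (\<integral>\<^sup>+t. \<integral>\<^sup>+z. gauss_weight TYPE('a) t * ennreal (gauss (t, z) x * gauss (t, z) y) \<partial>lborel \<partial>lborel)"
    by (subst lborel.nn_integral_fst[symmetric]) auto
  also have "\<dots> = (\<integral>\<^sup>+t. gauss_weight TYPE('a) t * (ennreal (exp (- \<bar>t\<bar> * (norm (x - y))\<^sup>2)) * gauss_mass TYPE('a) t) \<partial>lborel)"
    by (subst nn_integral_cmult) (auto simp: gauss_product_integral)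
  also have "\<dots> = (\<integral>\<^sup>+t. ennreal (1 / Gamma a) * ennreal (indicator {0..} t * t powr (a - 1) * exp (- (t * (norm (x - y))\<^sup>2))) \<partial>lborel)"
  proof (rule nn_integral_cong)
    fix t :: real
    have "gauss_weight TYPE('a) t * (c * gauss_mass TYPE('a) t)
       = ennreal (indicator {0..} t * t powr (kexp TYPE('a) - 1) / Gamma (kexp TYPE('a))) * c" for c
    \<comment> \<open>Cancellation needs \<open>gauss_mass\<close> to be finite and nonzero, as it
      is for \<open>t > 0\<close>. At \<open>t = 0\<close> it is infinite, but
      \<open>0 powr _\<close> is 0, and for \<open>t < 0\<close> the indicator vanishes, so both
      sides are 0.\<close>
    proof (cases "t > 0")
      case True
      have "w / G * (c * G) = w * c" if "G \<noteq> 0" "G \<noteq> top" for w G :: ennreal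
      proof -
        have "w / G * (c * G) = c * (w * G / G)"
          by (simp add: ennreal_times_divide mult_ac)
        also have "w * G / G = w" using that by (rule ennreal_mult_divide_eq)
        finally show ?thesis by (simp add: mult.commute)
      qed
      then show ?thesis
        using gauss_mass_finite[OF True, where 'a='a] gauss_mass_pos[of t, where 'a='a]
        unfolding gauss_weight_def by auto
    qed (auto simp: gauss_weight_def indicator_def)
    then show "gauss_weight TYPE('a) t * (ennreal (exp (- \<bar>t\<bar> * (norm (x - y))\<^sup>2)) * gauss_mass TYPE('a) t)
       = ennreal (1 / Gamma a) * ennreal (indicator {0..} t * t powr (a - 1) * exp (- (t * (norm (x - y))\<^sup>2)))"
      using a by (auto simp: a_def indicator_def ennreal_mult'[symmetric] ennreal_mult''[symmetric] less_imp_le)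
  qed
  also have "\<dots> = ennreal (1 / Gamma a) * (\<integral>\<^sup>+t. ennreal (indicator {0..} t * t powr (a - 1) * exp (- (t * (norm (x - y))\<^sup>2))) \<partial>lborel)"
    by (rule nn_integral_cmult) measurable
  also have "\<dots> = kernel x y"
  proof (cases "x = y")
    case True
    have "Gamma a \<noteq> 0" using Gamma_real_pos[OF a] by linarith
    with True show ?thesis using a nn_integral_power_top[OF a] kernel_diagonal[OF assms, of y]
      by (simp add: ennreal_mult_top)
  next
    case False
    have g: "Gamma a > 0" using a by simp
    show ?thesis
      using False g by (subst nn_integral_power_exp[OF a])
        (auto simp: kernel_eq_powr[OF assms False] a_def[symmetric] ennreal_mult'[symmetric])
  qed
  finally show ?thesis ..
qed


lemma gauss_weight_finite: "gauss_weight TYPE('a::euclidean_space) t \<noteq> \<infinity>"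
  using gauss_mass_pos[of t, where 'a='a]
  by (auto simp: gauss_weight_def ennreal_divide_eq_top_iff)

text \<open>Lets statements that hold a.e. in \<open>gauss_space\<close> be read as a.e. statements
  for Lebesgue measure on \<open>t > 0\<close>.\<close>

lemma gauss_weight_pos:
  assumes "DIM('a) \<ge> 3" "t > 0" shows "gauss_weight TYPE('a::euclidean_space) t > 0"
  using gauss_mass_finite[OF assms(2), where 'a='a] assms
  by (auto simp: gauss_weight_def ennreal_zero_less_divide kexp_def)

lemma sigma_finite_gauss_space:
  "sigma_finite_measure (gauss_space :: (real \<times> 'a::euclidean_space) measure)"
proof -
  have "sigma_finite_measure ((lborel :: real measure) \<Otimes>\<^sub>M (lborel :: 'a measure))"
    unfolding lborel_prod by (rule lborel.sigma_finite_measure_axioms)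
  then have "sigma_finite_measure (density (lborel \<Otimes>\<^sub>M (lborel :: 'a measure)) (\<lambda>q. gauss_weight TYPE('a) (fst q)))"
    using gauss_weight_finite[where 'a='a]
    by (subst sigma_finite_measure.sigma_finite_iff_density_finite) auto
  then show ?thesis by (simp add: gauss_space_def)
qed

section \<open>Energy as an integral of Gaussian transforms\<close>

definition finite_borel :: "'a::topological_space measure \<Rightarrow> bool" where
  "finite_borel M \<longleftrightarrow> sets M = sets borel \<and> finite_measure M"

lemma finite_borelD:
  assumes "finite_borel M"
  shows "sets M = sets borel" "finite_measure M" "space M = UNIV"
  using assms by (auto simp: finite_borel_def dest: sets_eq_imp_space_eq)

definition gauss_transform :: "'a::euclidean_space measure \<Rightarrow> real \<times> 'a \<Rightarrow> real" where
  "gauss_transform M q = (\<integral>x. gauss q x \<partial>M)"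

lemma integrable_bounded_continuous:
  fixes f :: "'a::euclidean_space \<Rightarrow> real"
  assumes M: "finite_borel M" and "continuous_on UNIV f" "\<And>x. \<bar>f x\<bar> \<le> B"
  shows "integrable M f"
proof -
  interpret finite_measure M using M by (rule finite_borelD)
  have [simp, measurable_cong]: "sets M = sets borel" using M by (rule finite_borelD)
  show ?thesis
    using assms by (intro integrable_const_bound[where B=B])
      (auto intro: borel_measurable_continuous_onI simp: measurable_cong_sets[of M borel])
qed

lemma integrable_gauss:
  assumes M: "finite_borel M"
  shows "integrable M (gauss q)"
proof -
  interpret finite_measure M using M by (rule finite_borelD)
  have [simp, measurable_cong]: "sets M = sets borel" using M by (rule finite_borelD)
  show ?thesis
    by (intro integrable_const_bound[where B=1]) auto
qed

lemma ennreal_gauss_transform: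
  assumes M: "finite_borel M"
  shows "ennreal (gauss_transform M q) = (\<integral>\<^sup>+x. ennreal (gauss q x) \<partial>M)"
  unfolding gauss_transform_def using integrable_gauss[OF M] by (subst nn_integral_eq_integral) auto

lemma gauss_transform_nonneg: "0 \<le> gauss_transform M q"
  unfolding gauss_transform_def by (intro integral_nonneg_AE) auto

lemma measurable_gauss_transform:
  assumes M: "finite_borel M"
  shows "gauss_transform M \<in> borel_measurable borel"
proof -
  interpret finite_measure M using M by (rule finite_borelD)
  have [simp, measurable_cong]: "sets M = sets borel" using M by (rule finite_borelD)
  show ?thesis
    unfolding gauss_transform_def[abs_def] by measurable
qed

lemma measurable_gauss_transform' [measurable (raw)]:
  assumes "finite_borel M" "f \<in> N \<rightarrow>\<^sub>M borel"
  shows "(\<lambda>x. gauss_transform M (f x)) \<in> borel_measurable N"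
  using measurable_compose[OF assms(2) measurable_gauss_transform[OF assms(1)]] .

lemma measurable_kernel' [measurable (raw)]:
  assumes [measurable]: "f \<in> M \<rightarrow>\<^sub>M borel" "g \<in> M \<rightarrow>\<^sub>M borel"
  shows "(\<lambda>x. kernel (f x) (g x)) \<in> borel_measurable M"
  unfolding kernel_def by measurable

definition pot :: "'a::euclidean_space measure \<Rightarrow> 'a \<Rightarrow> ennreal" where
  "pot M x = (\<integral>\<^sup>+y. kernel x y \<partial>M)"

lemma measurable_pot [measurable]:
  assumes M: "finite_borel M"
  shows "pot M \<in> borel_measurable borel"
proof -
  interpret finite_measure M using M by (rule finite_borelD)
  have [simp, measurable_cong]: "sets M = sets borel" using M by (rule finite_borelD)
  show ?thesis unfolding pot_def by measurable
qed

lemma mutual_energy_eq_pot: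
  assumes M: "finite_borel M" and M': "finite_borel M'"
  shows "mutual_energy M M' = (\<integral>\<^sup>+x. pot M' x \<partial>M)"
proof -
  interpret M': finite_measure M' using M' by (rule finite_borelD)
  have [simp, measurable_cong]: "sets M = sets borel" using M by (rule finite_borelD)
  have [simp, measurable_cong]: "sets M' = sets borel" using M' by (rule finite_borelD)
  show ?thesis unfolding mutual_energy_def pot_def
    by (subst M'.nn_integral_fst[symmetric]) auto
qed

text \<open>Insert the Gaussian representation and move the parameter integral outside, twice by
  Tonelli; nonnegativity makes this valid even when the energy is infinite.\<close>

lemma mutual_energy_eq_gauss:
  fixes M M' :: "'a::euclidean_space measure"
  assumes D: "DIM('a) \<ge> 3" and M: "finite_borel M" and M': "finite_borel M'"
  shows "mutual_energy M M' = (\<integral>\<^sup>+q. ennreal (gauss_transform M q * gauss_transform M' q) \<partial>gauss_space)"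
proof -
  interpret M: finite_measure M using M by (rule finite_borelD)
  interpret M': finite_measure M' using M' by (rule finite_borelD)
  interpret Q: sigma_finite_measure "gauss_space :: (real \<times> 'a) measure"
    by (rule sigma_finite_gauss_space)
  interpret P: pair_sigma_finite M' "gauss_space :: (real \<times> 'a) measure" ..
  interpret P2: pair_sigma_finite M "gauss_space :: (real \<times> 'a) measure" ..
  have [simp, measurable_cong]: "sets M = sets borel" using M by (rule finite_borelD)
  have [simp, measurable_cong]: "sets M' = sets borel" using M' by (rule finite_borelD)
  have "mutual_energy M M' = (\<integral>\<^sup>+x. \<integral>\<^sup>+y. \<integral>\<^sup>+q. ennreal (gauss q x * gauss q y) \<partial>gauss_space \<partial>M' \<partial>M)"
    unfolding mutual_energy_eq_pot[OF M M'] pot_def by (intro nn_integral_cong) (rule kernel_gauss[OF D])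
  also have "\<dots> = (\<integral>\<^sup>+x. \<integral>\<^sup>+q. \<integral>\<^sup>+y. ennreal (gauss q x * gauss q y) \<partial>M' \<partial>gauss_space \<partial>M)"
    by (subst P.Fubini') auto
  also have "\<dots> = (\<integral>\<^sup>+q. \<integral>\<^sup>+x. \<integral>\<^sup>+y. ennreal (gauss q x * gauss q y) \<partial>M' \<partial>M \<partial>gauss_space)"
    by (subst P2.Fubini') auto
  also have "\<dots> = (\<integral>\<^sup>+q. ennreal (gauss_transform M q * gauss_transform M' q) \<partial>gauss_space)"
    using gauss_transform_nonneg[of M] gauss_transform_nonneg[of M']
    by (intro nn_integral_cong) (simp add: ennreal_mult nn_integral_cmult nn_integral_multc
        ennreal_gauss_transform[OF M] ennreal_gauss_transform[OF M'])
  finally show ?thesis .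
qed

section \<open>Injectivity of the Gaussian transform\<close>

lemma finite_borel_eqI:
  fixes A B :: "'a::euclidean_space measure"
  assumes A: "finite_borel A" and B: "finite_borel B"
    and eq: "\<And>f :: 'a \<Rightarrow> real. continuous_on UNIV f \<Longrightarrow> (\<And>x. 0 \<le> f x) \<Longrightarrow> (\<And>x. f x \<le> 1)
      \<Longrightarrow> (\<integral>x. f x \<partial>A) = (\<integral>x. f x \<partial>B)"
  shows "A = B"
proof -
  have op: "emeasure A U = emeasure B U" if U: "open U" for U :: "'a set"
  proof -
    \<comment> \<open>Continuous functions converging to the indicator of \<open>U\<close>. The
      whole space is separate because \<open>infdist\<close> to the empty set is 0 by convention.
      Equality on open sets suffices, as they form an intersection-stable generator.\<close>
    define f where "f k x = (if U = UNIV then 1 else min 1 (real k * infdist x (- U)))" for k x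
    have cont: "continuous_on UNIV (f k)" for k
      unfolding f_def by (cases "U = UNIV") (auto intro!: continuous_intros)
    have b: "0 \<le> f k x" "f k x \<le> 1" for k x by (auto simp: f_def infdist_nonneg)
    have lim: "(\<lambda>k. f k x) \<longlonglongrightarrow> indicator U x" for x
    proof (cases "U = UNIV")
      case True then show ?thesis by (simp add: f_def)
    next
      case False
      show ?thesis
      proof (cases "x \<in> U")
        case True
        have pos: "infdist x (- U) > 0"
          using U True False by (intro infdist_pos_not_in_closed) auto
        obtain n where n: "real n * infdist x (- U) > 1"
          using reals_Archimedean3[OF pos, rule_format, of 1] by auto
        have "eventually (\<lambda>k. f k x = 1) sequentially"
        proof (rule eventually_sequentiallyI)
          fix k assume "n \<le> k"
          then have "real n * infdist x (- U) \<le> real k * infdist x (- U)"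
            using pos by (intro mult_right_mono) auto
          with n False show "f k x = 1" by (simp add: f_def)
        qed
        then show ?thesis using True by (simp add: tendsto_eventually)
      qed (use False in \<open>auto simp: f_def\<close>)
    qed
    have *: "(\<lambda>k. \<integral>x. f k x \<partial>M) \<longlonglongrightarrow> measure M U" if M: "finite_borel M" for M
    proof -
      interpret finite_measure M using M by (rule finite_borelD)
      have [simp, measurable_cong]: "sets M = sets borel" using M by (rule finite_borelD)
      note [measurable] = borel_measurable_continuous_onI[OF cont] borel_open[OF U]
      have "(\<lambda>k. \<integral>x. f k x \<partial>M) \<longlonglongrightarrow> (\<integral>x. indicator U x \<partial>M)"
        by (rule integral_dominated_convergence[where w="\<lambda>_. 1"]) (use b lim in auto)
      then show ?thesis using finite_borelD(3)[OF M] by simp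
    qed
    have "measure A U = measure B U"
      using LIMSEQ_unique[OF *[OF A] *[OF B, folded eq[OF cont b]]] .
    then show ?thesis
      using A B by (simp add: finite_borel_def finite_measure.emeasure_eq_measure)
  qed
  interpret B: finite_measure B using B by (rule finite_borelD)
  show ?thesis
  proof (rule measure_eqI_generator_eq[where E="Collect open" and \<Omega>=UNIV and A="\<lambda>_. UNIV"])
    show "Int_stable (Collect open :: 'a set set)" by (auto simp: Int_stable_def)
    show "sets A = sigma_sets UNIV (Collect open)" "sets B = sigma_sets UNIV (Collect open)"
      using finite_borelD(1)[OF A] finite_borelD(1)[OF B] by (simp_all add: borel_def)
  qed (use op B.emeasure_finite in auto)
qed

lemma lborel_ex_greater:
  assumes "AE t in lborel. P (t::real)"
  shows "\<exists>t>c. P t"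
proof (rule ccontr)
  assume "\<not> ?thesis"
  then have "AE t in lborel. t \<notin> {c<..<c+1}" using assms by (auto elim!: eventually_mono)
  then have "emeasure lborel {c<..<c+1} = 0"
    by (subst (asm) AE_iff_null_sets[symmetric]) auto
  then show False by simp
qed

text \<open>Gaussians of width \<open>1 / sqrt t\<close> are an approximate identity: integrating
  the transform against \<open>f\<close> over the centres gives, up to a factor depending on
  \<open>t\<close>, the integral of a blurred \<open>f\<close>, and \<open>t\<close> tending to
  infinity recovers the integral of \<open>f\<close> itself.\<close>

lemma gauss_transform_inject:
  fixes A B :: "'a::euclidean_space measure"
  assumes D: "DIM('a) \<ge> 3" and A: "finite_borel A" and B: "finite_borel B"
    and eq: "AE q in gauss_space. gauss_transform A q = gauss_transform B q"
  shows "A = B"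
proof (rule finite_borel_eqI[OF A B])
  fix f :: "'a \<Rightarrow> real"
  assume f: "continuous_on UNIV f" "\<And>x. 0 \<le> f x" "\<And>x. f x \<le> 1"
  have [measurable]: "f \<in> borel_measurable borel" by (rule borel_measurable_continuous_onI[OF f(1)])
  define e where "e u = exp (- 2 * (norm u)\<^sup>2)" for u :: 'a
  have [measurable]: "e \<in> borel_measurable borel" unfolding e_def by measurable
  have e0: "0 \<le> e u" for u by (simp add: e_def)
  have emass: "(\<integral>\<^sup>+u. ennreal (e u) \<partial>lborel) = gauss_mass TYPE('a) (1/2)"
    by (simp add: gauss_mass_def e_def)
  have eint: "integrable lborel e"
    using gauss_mass_finite[of "1/2", where 'a='a] e0 by (intro integrableI_nonneg) (auto simp: emass)
  \<comment> \<open>\<open>f\<close> blurred at scale \<open>c\<close> by the unnormalized Gaussian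
    \<open>e\<close>; the missing factor, the integral of \<open>e\<close>, is cancelled at the
    end.\<close>
  define h where "h c x = (\<integral>u. f (x + c *\<^sub>R u) * e u \<partial>lborel)" for c x
  have hint: "integrable lborel (\<lambda>u. f (x + c *\<^sub>R u) * e u)" for c x
    by (rule Bochner_Integration.integrable_bound[OF eint]) (use f e0 in \<open>auto simp: mult_left_le_one_le\<close>)
  have hle: "\<bar>h c x\<bar> \<le> (\<integral>u. e u \<partial>lborel)" for c x
  proof -
    have "0 \<le> h c x" unfolding h_def using f e0 by (intro integral_nonneg_AE) auto
    moreover have "h c x \<le> (\<integral>u. e u \<partial>lborel)"
      unfolding h_def using f e0 by (intro integral_mono[OF hint eint]) (auto simp: mult_left_le_one_le)
    ultimately show ?thesis by simp
  qed
  have hm [measurable]: "h c \<in> borel_measurable borel" for c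
    unfolding h_def by measurable
  have key: "ennreal (1 / (sqrt t) ^ DIM('a)) * (\<integral>\<^sup>+x. ennreal (h (1 / sqrt t) x) \<partial>M)
      = (\<integral>\<^sup>+z. ennreal (f z) * ennreal (gauss_transform M (t, z)) \<partial>lborel)"
    if M: "finite_borel M" and t: "t > 0" for M t
  proof -
    interpret M: finite_measure M using M by (rule finite_borelD)
    interpret P: pair_sigma_finite "lborel :: 'a measure" M ..
    have [simp, measurable_cong]: "sets M = sets borel" using M by (rule finite_borelD)
    have "(\<integral>\<^sup>+z. ennreal (f z) * ennreal (gauss_transform M (t, z)) \<partial>lborel)
       = (\<integral>\<^sup>+z. \<integral>\<^sup>+x. ennreal (f z) * ennreal (gauss (t, z) x) \<partial>M \<partial>lborel)"
      by (simp add: ennreal_gauss_transform[OF M] nn_integral_cmult)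
    also have "\<dots> = (\<integral>\<^sup>+x. \<integral>\<^sup>+z. ennreal (f z) * ennreal (gauss (t, z) x) \<partial>lborel \<partial>M)"
      by (subst P.Fubini') auto
    also have "\<dots> = (\<integral>\<^sup>+x. ennreal (1 / (sqrt t) ^ DIM('a)) * ennreal (h (1 / sqrt t) x) \<partial>M)"
    proof (rule nn_integral_cong)
      fix x
      have *: "gauss (t, x + (1 / sqrt t) *\<^sub>R u) x = e u" for u
        using t by (simp add: gauss_def e_def power_mult_distrib power_divide)
      have "(\<integral>\<^sup>+z. ennreal (f z) * ennreal (gauss (t, z) x) \<partial>lborel)
        = (\<integral>\<^sup>+z. ennreal (f z) * ennreal (gauss (t, z) x)
            \<partial>density (distr lborel borel (\<lambda>u. x + (1 / sqrt t) *\<^sub>R u)) (\<lambda>_. \<bar>1 / sqrt t\<bar> ^ DIM('a)))"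
        using t by (subst lborel_affine[symmetric]) auto
      also have "\<dots> = ennreal (\<bar>1 / sqrt t\<bar> ^ DIM('a)) * (\<integral>\<^sup>+u. ennreal (f (x + (1 / sqrt t) *\<^sub>R u) * e u) \<partial>lborel)"
        using f e0 by (simp add: nn_integral_density nn_integral_distr nn_integral_cmult * ennreal_mult)
      also have "(\<integral>\<^sup>+u. ennreal (f (x + (1 / sqrt t) *\<^sub>R u) * e u) \<partial>lborel) = ennreal (h (1 / sqrt t) x)"
        unfolding h_def using f e0 by (intro nn_integral_eq_integral hint) auto
      finally show "(\<integral>\<^sup>+z. ennreal (f z) * ennreal (gauss (t, z) x) \<partial>lborel)
        = ennreal (1 / (sqrt t) ^ DIM('a)) * ennreal (h (1 / sqrt t) x)"
        using t by (simp add: power_divide)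
    qed
    also have "\<dots> = ennreal (1 / (sqrt t) ^ DIM('a)) * (\<integral>\<^sup>+x. ennreal (h (1 / sqrt t) x) \<partial>M)"
      by (rule nn_integral_cmult) measurable
    finally show ?thesis ..
  qed
  have hM: "integrable M (h c)" "ennreal (\<integral>x. h c x \<partial>M) = (\<integral>\<^sup>+x. ennreal (h c x) \<partial>M)"
    if M: "finite_borel M" for M c
  proof -
    interpret M: finite_measure M using M by (rule finite_borelD)
    have [simp, measurable_cong]: "sets M = sets borel" using M by (rule finite_borelD)
    show 1: "integrable M (h c)" using hle by (intro M.integrable_const_bound) auto
    have "0 \<le> h c x" for x unfolding h_def using f e0 by (intro integral_nonneg_AE) auto
    then show "ennreal (\<integral>x. h c x \<partial>M) = (\<integral>\<^sup>+x. ennreal (h c x) \<partial>M)"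
      using 1 by (subst nn_integral_eq_integral) auto
  qed
  have "AE q in lborel \<Otimes>\<^sub>M lborel. fst q > 0 \<longrightarrow> gauss_transform A q = gauss_transform B q"
    using eq unfolding gauss_space_def
    by (subst (asm) AE_density) (auto elim!: eventually_mono dest: gauss_weight_pos[OF D])
  then have "AE t in lborel. AE z in lborel. t > 0 \<longrightarrow> gauss_transform A (t, z) = gauss_transform B (t, z)"
    using pair_sigma_finite.AE_pair[OF lborel_pair.pair_sigma_finite_axioms, of "\<lambda>q. fst q > 0 \<longrightarrow> gauss_transform A q = gauss_transform B q"] by simp
  \<comment> \<open>Equality is known only for almost every \<open>t\<close>, so the sequence
    tending to infinity has to be picked inside the full set.\<close>
  then have "\<exists>t>real n. AE z in lborel. t > 0 \<longrightarrow> gauss_transform A (t, z) = gauss_transform B (t, z)" for n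
    by (rule lborel_ex_greater)
  then obtain t where t: "\<And>n. t n > real n"
    "\<And>n. AE z in lborel. t n > 0 \<longrightarrow> gauss_transform A (t n, z) = gauss_transform B (t n, z)" by metis
  have tpos: "t n > 0" for n using t(1)[of n] by (meson le_less_trans of_nat_0_le_iff)
  have "(\<integral>x. h (1 / sqrt (t n)) x \<partial>A) = (\<integral>x. h (1 / sqrt (t n)) x \<partial>B)" for n
  proof -
    have "(\<integral>\<^sup>+z. ennreal (f z) * ennreal (gauss_transform A (t n, z)) \<partial>lborel)
        = (\<integral>\<^sup>+z. ennreal (f z) * ennreal (gauss_transform B (t n, z)) \<partial>lborel)"
      using t(2)[of n] tpos[of n] by (intro nn_integral_cong_AE) auto
    then have "ennreal (1 / (sqrt (t n)) ^ DIM('a)) * (\<integral>\<^sup>+x. ennreal (h (1 / sqrt (t n)) x) \<partial>A)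
      = ennreal (1 / (sqrt (t n)) ^ DIM('a)) * (\<integral>\<^sup>+x. ennreal (h (1 / sqrt (t n)) x) \<partial>B)"
      by (simp only: key[OF A tpos] key[OF B tpos])
    then have "ennreal (\<integral>x. h (1 / sqrt (t n)) x \<partial>A) = ennreal (\<integral>x. h (1 / sqrt (t n)) x \<partial>B)"
      unfolding hM(2)[OF A] hM(2)[OF B] using tpos[of n] by (subst (asm) ennreal_mult_cancel_left) auto
    moreover have "0 \<le> h (1 / sqrt (t n)) x" for x
      unfolding h_def using f e0 by (intro integral_nonneg_AE) auto
    ultimately show ?thesis by (subst (asm) ennreal_inj) (auto intro!: integral_nonneg_AE)
  qed
  moreover have lim: "(\<lambda>n. \<integral>x. h (1 / sqrt (t n)) x \<partial>M) \<longlonglongrightarrow> (\<integral>x. f x * (\<integral>u. e u \<partial>lborel) \<partial>M)"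
    if M: "finite_borel M" for M
  proof -
    interpret M: finite_measure M using M by (rule finite_borelD)
    have [simp, measurable_cong]: "sets M = sets borel" using M by (rule finite_borelD)
    have "filterlim t at_top sequentially"
      by (rule filterlim_at_top_mono[OF filterlim_real_sequentially]) (use t(1) in \<open>auto intro!: always_eventually less_imp_le\<close>)
    then have c0: "(\<lambda>n. 1 / sqrt (t n)) \<longlonglongrightarrow> 0"
      by (intro tendsto_divide_0[OF tendsto_const] filterlim_at_top_imp_at_infinity
          filterlim_compose[OF sqrt_at_top])
    show ?thesis
    proof (rule integral_dominated_convergence[where w="\<lambda>_. \<integral>u. e u \<partial>lborel"])
      show "AE x in M. (\<lambda>n. h (1 / sqrt (t n)) x) \<longlonglongrightarrow> f x * (\<integral>u. e u \<partial>lborel)"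
      proof (rule AE_I2)
        fix x
        have "(\<lambda>n. h (1 / sqrt (t n)) x) \<longlonglongrightarrow> (\<integral>u. f x * e u \<partial>lborel)"
          unfolding h_def
        proof (rule integral_dominated_convergence[where w=e, OF _ _ eint])
          show "AE u in lborel. (\<lambda>n. f (x + (1 / sqrt (t n)) *\<^sub>R u) * e u) \<longlonglongrightarrow> f x * e u"
          proof (rule AE_I2)
            fix u
            have "(\<lambda>n. x + (1 / sqrt (t n)) *\<^sub>R u) \<longlonglongrightarrow> x + 0 *\<^sub>R u"
              by (intro tendsto_intros c0)
            then have "(\<lambda>n. f (x + (1 / sqrt (t n)) *\<^sub>R u)) \<longlonglongrightarrow> f x"
              using f(1) by (intro continuous_on_tendsto_compose[OF f(1)]) auto
            then show "(\<lambda>n. f (x + (1 / sqrt (t n)) *\<^sub>R u) * e u) \<longlonglongrightarrow> f x * e u"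
              by (intro tendsto_intros)
          qed
        qed (use f e0 in \<open>auto simp: mult_left_le_one_le\<close>)
        then show "(\<lambda>n. h (1 / sqrt (t n)) x) \<longlonglongrightarrow> f x * (\<integral>u. e u \<partial>lborel)" by simp
      qed
    qed (use hle in auto)
  qed
  ultimately have "(\<integral>x. f x * (\<integral>u. e u \<partial>lborel) \<partial>A) = (\<integral>x. f x * (\<integral>u. e u \<partial>lborel) \<partial>B)"
    using LIMSEQ_unique[OF lim[OF A]] lim[OF B] by simp
  moreover have "(\<integral>u. e u \<partial>lborel) \<noteq> 0"
  proof -
    have "ennreal (\<integral>u. e u \<partial>lborel) = gauss_mass TYPE('a) (1/2)"
      unfolding emass[symmetric] using eint e0 by (subst nn_integral_eq_integral) auto
    then show ?thesis using gauss_mass_pos[of "1/2", where 'a='a] by auto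
  qed
  ultimately show "(\<integral>x. f x \<partial>A) = (\<integral>x. f x \<partial>B)" by simp
qed

section \<open>Weak compactness\<close>

text \<open>A Cantor-type coding of a compact set by reals, with a continuous decoding map, reduces weak
  compactness to Helly's theorem on the real line: \<open>x\<close> is mapped to the ternary expansion
  recording in which members of a countable base it lies.\<close>

lemma compact_real_coding:
  fixes \<Omega> :: "'a::euclidean_space set"
  assumes \<Omega>: "compact \<Omega>"
  obtains code :: "'a \<Rightarrow> real" and dec :: "real \<Rightarrow> 'a"
  where "code \<in> borel_measurable borel" "\<And>x. code x \<in> {0..1}"
    "continuous_on UNIV dec" "bounded (range dec)" "\<And>x. x \<in> \<Omega> \<Longrightarrow> dec (code x) = x"
proof -
  obtain \<B> :: "'a set set" where \<B>: "countable \<B>" "topological_basis \<B>"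
    using ex_countable_basis by blast
  have ne: "\<B> \<noteq> {}"
    using topological_basisE[OF \<B>(2) open_UNIV, of undefined] by blast
  define A where "A = from_nat_into \<B>"
  have Aopen: "open (A j)" for j
    using from_nat_into[OF ne, of j] topological_basis_open[OF \<B>(2)] by (simp add: A_def)
  define d where "d x j = 2 * indicator (A j) x * (1 / 3 :: real) ^ Suc j" for x j
  have geo: "(\<lambda>j. 2 * (1 / 3 :: real) ^ Suc (j + k)) sums ((1 / 3) ^ k)" for k
  proof -
    have "(\<lambda>j. (2 * (1/3) ^ Suc k) * (1 / 3 :: real) ^ j) sums ((2 * (1/3) ^ Suc k) * (1 / (1 - 1/3)))"
      by (intro sums_mult geometric_sums) auto
    then show ?thesis by (simp add: power_add mult_ac)
  qed
  have dle: "0 \<le> d x j" "d x j \<le> 2 * (1 / 3 :: real) ^ Suc j" for x j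
    by (auto simp: d_def indicator_def)
  have summ: "summable (d x)" for x
    by (rule summable_comparison_test'[where N=0, OF sums_summable[OF geo[of 0]]]) (use dle in auto)
  define code where "code x = (\<Sum>j. d x j)" for x
  have code_meas: "code \<in> borel_measurable borel"
  proof -
    have [measurable]: "A j \<in> sets borel" for j using Aopen by auto
    show ?thesis unfolding code_def[abs_def] d_def by measurable
  qed
  have code_bd: "code x \<in> {0..1}" for x
  proof -
    have "code x \<le> (\<Sum>j. 2 * (1 / 3 :: real) ^ Suc j)"
      unfolding code_def using dle summ sums_summable[OF geo[of 0]] by (intro suminf_le) auto
    also have "\<dots> = 1" using sums_unique[OF geo[of 0]] by simp
    finally show ?thesis using suminf_nonneg[OF summ[of x]] dle by (auto simp: code_def)
  qed
  \<comment> \<open>Ternary digits 0 and 2 only: the first disagreement contributes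
    \<open>2 * (1/3) ^ Suc j\<close>, and all later digits together at most half of that.\<close>
  have sep: "\<bar>code x - code y\<bar> \<ge> (1 / 3) ^ Suc j"
    if j: "(x \<in> A j) \<noteq> (y \<in> A j)" and less: "\<And>i. i < j \<Longrightarrow> (x \<in> A i) = (y \<in> A i)" for x y j
  proof -
    define c where "c i = d x i - d y i" for i
    have cs: "summable c" unfolding c_def by (intro summable_diff summ)
    have cb: "\<bar>c i\<bar> \<le> 2 * (1 / 3) ^ Suc i" for i
      unfolding c_def using dle[of x i] dle[of y i] by linarith
    have "code x - code y = (\<Sum>i. c i)"
      unfolding code_def c_def by (rule suminf_diff[OF summ summ])
    also have "\<dots> = (\<Sum>i. c (i + Suc j)) + (\<Sum>i<Suc j. c i)"
      by (rule suminf_split_initial_segment[OF cs])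
    also have "(\<Sum>i<Suc j. c i) = c j"
      using less by (simp add: c_def d_def indicator_def)
    finally have eq: "code x - code y = (\<Sum>i. c (i + Suc j)) + c j" .
    have s2: "summable (\<lambda>i. 2 * (1 / 3 :: real) ^ Suc (i + Suc j))"
      using geo[of "Suc j"] by (rule sums_summable)
    have s1: "summable (\<lambda>i. \<bar>c (i + Suc j)\<bar>)"
      by (rule summable_comparison_test'[where N=0, OF s2])
         (simp only: real_norm_def abs_abs cb)
    have "\<bar>\<Sum>i. c (i + Suc j)\<bar> \<le> (\<Sum>i. \<bar>c (i + Suc j)\<bar>)" by (rule summable_rabs[OF s1])
    also have "\<dots> \<le> (\<Sum>i. 2 * (1 / 3) ^ Suc (i + Suc j))"
      by (rule suminf_le[OF _ s1 s2]) (rule cb)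
    also have "\<dots> = (1 / 3) ^ Suc j" using sums_unique[OF geo[of "Suc j"]] by simp
    finally have "\<bar>\<Sum>i. c (i + Suc j)\<bar> \<le> (1 / 3) ^ Suc j" .
    moreover have "\<bar>c j\<bar> = 2 * (1 / 3) ^ Suc j"
      using j by (auto simp: c_def d_def indicator_def)
    ultimately show ?thesis unfolding eq by linarith
  qed
  \<comment> \<open>Take \<open>n\<close> beyond all indices of a finite subcover of
    \<open>\<Omega>\<close> by base sets inside balls of radius \<open>e / 2\<close>. Codes closer
    than \<open>(1/3) ^ n\<close> agree in the first \<open>n\<close> digits, so their points share
    a member of the subcover.\<close>
  have unif: "\<exists>\<delta>>0. \<forall>x\<in>\<Omega>. \<forall>y\<in>\<Omega>. \<bar>code x - code y\<bar> < \<delta> \<longrightarrow> dist x y < e" if e: "e > 0" for e :: real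
  proof -
    have "\<exists>j. x \<in> A j \<and> A j \<subseteq> ball x (e / 2)" for x
    proof -
      obtain B where "B \<in> \<B>" "x \<in> B" "B \<subseteq> ball x (e / 2)"
        using topological_basisE[OF \<B>(2) open_ball, of x x "e / 2"] e by auto
      then show ?thesis using from_nat_into_surj[OF \<B>(1), of B] by (auto simp: A_def)
    qed
    then obtain J where J: "\<And>x. x \<in> A (J x)" "\<And>x. A (J x) \<subseteq> ball x (e / 2)" by metis
    obtain D where D: "finite D" "\<Omega> \<subseteq> (\<Union>x\<in>D. A (J x))"
    proof (rule compactE_image[OF \<Omega>, of UNIV "\<lambda>x. A (J x)"])
      show "\<Omega> \<subseteq> (\<Union>x\<in>UNIV. A (J x))" using J by auto
    qed (use Aopen in auto)
    define n where "n = Suc (Max (insert 0 (J ` D)))"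
    have n: "J x < n" if "x \<in> D" for x
      using that D(1) by (auto simp: n_def less_Suc_eq_le intro!: Max_ge)
    have "dist x y < e" if x: "x \<in> \<Omega>" and y: "y \<in> \<Omega>" and l: "\<bar>code x - code y\<bar> < (1 / 3) ^ n" for x y
    proof -
      have agree: "(x \<in> A i) = (y \<in> A i)" if "i < n" for i
      proof (rule ccontr)
        assume "(x \<in> A i) \<noteq> (y \<in> A i)"
        define j where "j = (LEAST i. (x \<in> A i) \<noteq> (y \<in> A i))"
        have j: "(x \<in> A j) \<noteq> (y \<in> A j)" "j \<le> i"
          using LeastI[of "\<lambda>i. (x \<in> A i) \<noteq> (y \<in> A i)" i] Least_le[of "\<lambda>i. (x \<in> A i) \<noteq> (y \<in> A i)" i]
            \<open>(x \<in> A i) \<noteq> (y \<in> A i)\<close> by (auto simp: j_def)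
        have "(1 / 3) ^ Suc j \<le> \<bar>code x - code y\<bar>"
        proof (rule sep[OF j(1)])
          show "(x \<in> A k) = (y \<in> A k)" if "k < j" for k
            using not_less_Least[OF that[unfolded j_def]] by simp
        qed
        moreover have "(1 / 3 :: real) ^ n \<le> (1 / 3) ^ Suc j"
          using j that by (intro power_decreasing) auto
        ultimately show False using l by linarith
      qed
      obtain z where z: "z \<in> D" "x \<in> A (J z)" using D x by auto
      with agree n have "y \<in> A (J z)" by blast
      with z J(2)[of z] have "dist z x < e / 2" "dist z y < e / 2" by auto
      then show ?thesis by (metis dist_commute dist_triangle_half_l)
    qed
    then show ?thesis by (intro exI[of _ "(1/3) ^ n"]) auto
  qed
  have inj: "inj_on code \<Omega>"
  proof (rule inj_onI)
    fix x y assume xy: "x \<in> \<Omega>" "y \<in> \<Omega>" "code x = code y"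
    have "dist x y < e" if "e > 0" for e using unif[OF that] xy by auto
    then show "x = y" by (metis dist_pos_lt less_irrefl)
  qed
  define dec0 where "dec0 = inv_into \<Omega> code"
  have dec0: "dec0 (code x) = x" if "x \<in> \<Omega>" for x using inj that by (simp add: dec0_def)
  have "uniformly_continuous_on (code ` \<Omega>) dec0"
    unfolding uniformly_continuous_on_def
  proof (intro allI impI)
    fix e :: real assume "e > 0"
    from unif[OF this] obtain \<delta> where "\<delta> > 0"
      "\<forall>x\<in>\<Omega>. \<forall>y\<in>\<Omega>. \<bar>code x - code y\<bar> < \<delta> \<longrightarrow> dist x y < e" by blast
    then show "\<exists>d>0. \<forall>x\<in>code ` \<Omega>. \<forall>x'\<in>code ` \<Omega>. dist x' x < d \<longrightarrow> dist (dec0 x') (dec0 x) < e"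
      by (intro exI[of _ \<delta>]) (auto simp: dec0 dist_real_def)
  qed
  then obtain g where g: "uniformly_continuous_on (closure (code ` \<Omega>)) g"
    "\<And>x. x \<in> code ` \<Omega> \<Longrightarrow> dec0 x = g x"
    by (rule uniformly_continuous_on_extension_on_closure) (rule that, assumption, blast)
  have gc: "continuous_on (closure (code ` \<Omega>)) g"
    using g(1) by (rule uniformly_continuous_imp_continuous)
  obtain B where B: "\<And>x. x \<in> \<Omega> \<Longrightarrow> norm x \<le> B" "B \<ge> 0"
    using compact_imp_bounded[OF \<Omega>] unfolding bounded_pos by (meson less_imp_le)
  have "g ` closure (code ` \<Omega>) \<subseteq> cball 0 B"
  proof (rule image_closure_subset[OF gc closed_cball])
    show "g ` code ` \<Omega> \<subseteq> cball 0 B" using B by (auto simp flip: g(2) simp: dec0)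
  qed
  \<comment> \<open>Tietze extension preserves the norm bound; bounded range ensures that continuous
    functions composed with the decoding map are bounded, as weak convergence on the line
    requires.\<close>
  then obtain h where h: "continuous_on UNIV h" "\<And>x. x \<in> closure (code ` \<Omega>) \<Longrightarrow> h x = g x"
    "\<And>x. x \<in> UNIV \<Longrightarrow> norm (h x) \<le> B"
    using Tietze[OF gc, of UNIV B] B(2) by (auto simp: image_subset_iff)
  show thesis
  proof (rule that[OF code_meas code_bd h(1)])
    show "bounded (range h)" using h(3) by (auto simp: bounded_iff)
    show "h (code x) = x" if "x \<in> \<Omega>" for x
      using h(2)[of "code x"] g(2)[of "code x"] dec0[OF that] that closure_subset[of "code ` \<Omega>"] by auto
  qed
qed

definition carried_by :: "'a::topological_space measure \<Rightarrow> 'a set \<Rightarrow> bool" where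
  "carried_by M S \<longleftrightarrow> emeasure M (- S) = 0"

lemma AE_carried_by:
  assumes "finite_borel M" "closed S" "carried_by M S"
  shows "AE x in M. x \<in> S"
proof -
  have "- S \<in> null_sets M"
    using assms by (auto simp: carried_by_def finite_borel_def null_sets_def)
  from AE_not_in[OF this] show ?thesis by simp
qed

lemma continuous_clamp_on_compact:
  fixes f :: "'a::euclidean_space \<Rightarrow> real"
  assumes "compact S" "continuous_on UNIV f"
  obtains g B where "continuous_on UNIV g" "\<And>x. \<bar>g x\<bar> \<le> B" "\<And>x. x \<in> S \<Longrightarrow> g x = f x" "B \<ge> 0"
proof -
  have "bounded (f ` S)"
    using assms by (intro compact_imp_bounded compact_continuous_image) (auto intro: continuous_on_subset)
  then obtain B where B: "\<And>x. x \<in> S \<Longrightarrow> \<bar>f x\<bar> \<le> B" "B > 0"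
    unfolding bounded_pos by auto
  show thesis
  proof (rule that[of "\<lambda>x. max (- B) (min B (f x))" B])
    show "continuous_on UNIV (\<lambda>x. max (- B) (min B (f x)))" using assms by (intro continuous_intros)
  qed (use B(2) in \<open>auto simp: abs_le_iff max_def min_def dest!: B(1)\<close>)
qed

lemma integrable_continuous_carried:
  fixes f :: "'a::euclidean_space \<Rightarrow> real"
  assumes S: "compact S" and M: "finite_borel M" "carried_by M S" and f: "continuous_on UNIV f"
  shows "integrable M f"
proof -
  obtain g B where g: "continuous_on UNIV g" "\<And>x. \<bar>g x\<bar> \<le> B" "\<And>x. x \<in> S \<Longrightarrow> g x = f x"
    using continuous_clamp_on_compact[OF S f] by metis
  have "f \<in> borel_measurable M"
    using f M(1) by (simp add: borel_measurable_continuous_onI finite_borel_def cong: measurable_cong_sets)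
  moreover have "AE x in M. g x = f x"
    using AE_carried_by[OF M(1) compact_imp_closed[OF S] M(2)] by eventually_elim (rule g(3))
  ultimately show ?thesis
    using integrable_cong_AE_imp[OF integrable_bounded_continuous[OF M(1) g(1,2)]] by blast
qed

text \<open>The images under \<open>code\<close> live on a bounded interval, so they are tight and
  Helly's theorem gives a limit on the line, which \<open>dec\<close> carries back. Convergence
  transfers because \<open>f\<close> composed with \<open>dec\<close> is bounded and continuous, and
  integrates against the image of \<open>\<mu> n\<close> as \<open>f\<close> does against
  \<open>\<mu> n\<close>.\<close>

lemma weak_compactness_prob:
  fixes \<mu> :: "nat \<Rightarrow> 'a::euclidean_space measure"
  assumes \<Omega>: "compact \<Omega>" and \<mu>: "\<And>n. finite_borel (\<mu> n)" "\<And>n. emeasure (\<mu> n) UNIV = 1"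
    "\<And>n. carried_by (\<mu> n) \<Omega>"
  obtains r \<tau> where "strict_mono (r :: nat \<Rightarrow> nat)" "finite_borel \<tau>" "carried_by \<tau> \<Omega>"
    "\<And>f :: 'a \<Rightarrow> real. continuous_on UNIV f \<Longrightarrow> (\<lambda>n. \<integral>x. f x \<partial>\<mu> (r n)) \<longlonglongrightarrow> (\<integral>x. f x \<partial>\<tau>)"
proof -
  obtain code :: "'a \<Rightarrow> real" and dec where cd: "code \<in> borel_measurable borel" "\<And>x. code x \<in> {0..1}"
    "continuous_on UNIV dec" "bounded (range dec)" "\<And>x. x \<in> \<Omega> \<Longrightarrow> dec (code x) = x"
    using compact_real_coding[OF \<Omega>] by blast
  have [measurable]: "dec \<in> borel_measurable borel" by (rule borel_measurable_continuous_onI[OF cd(3)])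
  note [measurable] = cd(1)
  have sets\<mu> [simp, measurable_cong]: "sets (\<mu> n) = sets borel" for n using \<mu>(1) by (rule finite_borelD)
  have space\<mu> [simp]: "space (\<mu> n) = UNIV" for n using \<mu>(1) by (rule finite_borelD)
  define \<nu> where "\<nu> n = distr (\<mu> n) borel code" for n
  have pr: "prob_space (\<mu> n)" for n by (rule prob_spaceI) (simp add: \<mu>(2))
  have rd: "real_distribution (\<nu> n)" for n
    using prob_space.prob_space_distr[OF pr[of n], of code borel]
    by (simp add: \<nu>_def real_distribution_def real_distribution_axioms_def)
  \<comment> \<open>Tightness is phrased with half-open intervals; starting at -1 keeps the code 0
    inside.\<close>
  have mass: "measure (\<nu> n) {-1<..1} = 1" for n
  proof -
    interpret prob_space "\<nu> n" using rd by (simp add: real_distribution_def)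
    have "code -` {-1<..1} = UNIV" using cd(2) by (auto simp: less_le_trans[OF _ conjunct1[OF cd(2)[unfolded atLeastAtMost_iff]]])
    then have "emeasure (\<nu> n) {-1<..1} = 1"
      unfolding \<nu>_def by (subst emeasure_distr) (auto simp: \<mu>(2))
    then show ?thesis by (simp add: measure_def)
  qed
  have "tight \<nu>"
    unfolding tight_def by (intro conjI allI impI rd, rule exI[of _ "-1"], rule exI[of _ 1]) (simp add: mass)
  then obtain r M where r: "strict_mono r" "real_distribution M" "weak_conv_m (\<nu> \<circ> id \<circ> r) M"
    using tight_imp_convergent_subsubsequence[of \<nu> id] by (auto simp: strict_mono_def)
  interpret M: real_distribution M by (rule r(2))
  define \<tau> where "\<tau> = distr M borel dec"
  have wc: "(\<lambda>n. \<integral>t. f t \<partial>\<nu> (r n)) \<longlonglongrightarrow> (\<integral>t. f t \<partial>M)"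
    if "continuous_on UNIV f" "\<And>t. \<bar>f t\<bar> \<le> B" for f :: "real \<Rightarrow> real" and B
    using weak_conv_imp_integral_bdd_continuous_conv[OF _ _ r(3), of f B] rd r(2) that
    by (simp add: continuous_on_eq_continuous_at)
  have bdd: "\<exists>B. \<forall>t. \<bar>f (dec t)\<bar> \<le> B" if "continuous_on UNIV f" for f :: "'a \<Rightarrow> real"
  proof -
    have "bounded (f ` closure (range dec))"
      using cd(4) that by (intro compact_imp_bounded compact_continuous_image)
        (auto intro: continuous_on_subset simp: compact_closure)
    then show ?thesis
      unfolding bounded_iff using closure_subset[of "range dec"] by fastforce
  qed
  have lim: "(\<lambda>n. \<integral>x. f x \<partial>\<mu> (r n)) \<longlonglongrightarrow> (\<integral>x. f x \<partial>\<tau>)"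
    if f: "continuous_on UNIV f" for f :: "'a \<Rightarrow> real"
  proof -
    have [measurable]: "f \<in> borel_measurable borel" by (rule borel_measurable_continuous_onI[OF f])
    obtain B where B: "\<And>t. \<bar>f (dec t)\<bar> \<le> B" using bdd[OF f] by blast
    have "(\<lambda>n. \<integral>t. f (dec t) \<partial>\<nu> (r n)) \<longlonglongrightarrow> (\<integral>t. f (dec t) \<partial>M)"
      by (rule wc[OF _ B]) (intro continuous_on_compose2[OF f cd(3)], auto)
    moreover have "(\<integral>t. f (dec t) \<partial>\<nu> n) = (\<integral>x. f x \<partial>\<mu> n)" for n
      unfolding \<nu>_def using AE_carried_by[OF \<mu>(1) compact_imp_closed[OF \<Omega>] \<mu>(3), of n]
      by (subst integral_distr) (auto intro!: integral_cong_AE simp: cd(5))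
    moreover have "(\<integral>t. f (dec t) \<partial>M) = (\<integral>x. f x \<partial>\<tau>)"
      unfolding \<tau>_def by (subst integral_distr) auto
    ultimately show ?thesis by simp
  qed
  have fb: "finite_borel \<tau>"
    unfolding \<tau>_def finite_borel_def by (auto intro!: M.finite_measure_distr)
  have "\<Omega> \<noteq> {}" using \<mu>(2,3) by (auto simp: carried_by_def)
  have "carried_by \<tau> \<Omega>"
  proof -
    \<comment> \<open>The distance to \<open>\<Omega>\<close> is continuous with integral 0 along
      the sequence, hence also in the limit.\<close>
    define f where "f x = infdist x \<Omega>" for x
    have f: "continuous_on UNIV f" unfolding f_def by (intro continuous_intros)
    have [measurable]: "f \<in> borel_measurable borel" by (rule borel_measurable_continuous_onI[OF f])
    obtain B where B: "\<And>t. \<bar>f (dec t)\<bar> \<le> B" using bdd[OF f] by blast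
    have "(\<integral>x. f x \<partial>\<mu> n) = 0" for n
      using AE_carried_by[OF \<mu>(1) compact_imp_closed[OF \<Omega>] \<mu>(3), of n]
      by (intro integral_eq_zero_AE) (auto simp: f_def elim!: eventually_mono)
    then have "(\<integral>x. f x \<partial>\<tau>) = 0" using lim[OF f] by (simp add: LIMSEQ_const_iff)
    moreover have "integrable \<tau> f"
      unfolding \<tau>_def using B by (subst integrable_distr_eq) (simp_all, rule M.integrable_const_bound[where B=B], simp_all)
    ultimately have "AE x in \<tau>. f x = 0"
      using integral_nonneg_eq_0_iff_AE[of \<tau> f] infdist_nonneg[of _ \<Omega>] by (simp add: f_def[abs_def])
    then have "AE x in \<tau>. x \<in> \<Omega>"
      using \<Omega> \<open>\<Omega> \<noteq> {}\<close> by (auto simp: f_def in_closed_iff_infdist_zero compact_imp_closed elim!: eventually_mono)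
    moreover have "- \<Omega> \<in> sets \<tau>"
      using compact_imp_closed[OF \<Omega>] finite_borelD(1)[OF fb] by (simp add: borel_closed)
    ultimately have "- \<Omega> \<in> null_sets \<tau>" by (simp add: AE_iff_null_sets)
    then show ?thesis by (simp add: carried_by_def null_setsD1)
  qed
  from that[OF r(1) fb this lim] show thesis .
qed

lemma finite_borel_density_const:
  assumes M: "finite_borel M"
  shows "finite_borel (density M (\<lambda>_. ennreal c))"
proof -
  interpret finite_measure M using M by (rule finite_borelD)
  show ?thesis
    using finite_borelD(1)[OF M]
    by (auto simp: finite_borel_def emeasure_density_const ennreal_mult_eq_top_iff intro!: finite_measureI)
qed

lemma carried_by_density:
  assumes M: "finite_borel M" "carried_by M S" "closed S" and f: "f \<in> borel_measurable M"
  shows "carried_by (density M f) S"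
proof -
  have "- S \<in> null_sets M"
    using M by (auto simp: carried_by_def finite_borel_def null_sets_def)
  then have "- S \<in> null_sets (density M f)"
    using absolutely_continuousI_density[OF f] by (auto simp: absolutely_continuous_def)
  then show ?thesis by (simp add: carried_by_def null_setsD1)
qed

lemma integral_density_const:
  fixes f :: "'a::euclidean_space \<Rightarrow> real"
  assumes M: "finite_borel M" and f: "f \<in> borel_measurable borel" and c: "c \<ge> 0"
  shows "(\<integral>x. f x \<partial>density M (\<lambda>_. ennreal c)) = c * (\<integral>x. f x \<partial>M)"
  using assms finite_borelD(1)[OF M] by (subst integral_density) (auto cong: measurable_cong_sets)

text \<open>Along a subsequence the masses converge. If their limit is positive, the tail is
  normalized to probability measures and rescaled afterwards; if it is 0, the measures converge to
  the null measure.\<close>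

lemma weak_compactness:
  fixes \<sigma> :: "nat \<Rightarrow> 'a::euclidean_space measure"
  assumes \<Omega>: "compact \<Omega>" and \<sigma>: "\<And>n. finite_borel (\<sigma> n)" "\<And>n. measure (\<sigma> n) UNIV \<le> C"
    "\<And>n. carried_by (\<sigma> n) \<Omega>"
  obtains r \<tau> where "strict_mono (r :: nat \<Rightarrow> nat)" "finite_borel \<tau>" "carried_by \<tau> \<Omega>"
    "\<And>f :: 'a \<Rightarrow> real. continuous_on UNIV f \<Longrightarrow> (\<lambda>n. \<integral>x. f x \<partial>\<sigma> (r n)) \<longlonglongrightarrow> (\<integral>x. f x \<partial>\<tau>)"
proof -
  have cl: "closed \<Omega>" using \<Omega> by (rule compact_imp_closed)
  define m where "m n = measure (\<sigma> n) UNIV" for n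
  have "\<And>n. m n \<in> {0..C}" using \<sigma>(2) by (auto simp: m_def)
  then obtain l r where lr: "strict_mono (r :: nat \<Rightarrow> nat)" "(m \<circ> r) \<longlonglongrightarrow> l" "l \<in> {0..C}"
    using seq_compactE[OF compact_imp_seq_compact[OF compact_Icc[of 0 C]], of m] by (metis atLeastAtMost_iff)
  show thesis
  proof (cases "l = 0")
    case True
    have "(\<lambda>n. \<integral>x. f x \<partial>\<sigma> (r n)) \<longlonglongrightarrow> (\<integral>x. f x \<partial>null_measure borel)"
      if f: "continuous_on UNIV f" for f :: "'a \<Rightarrow> real"
    proof -
      obtain g B where g: "continuous_on UNIV g" "\<And>x. \<bar>g x\<bar> \<le> B" "\<And>x. x \<in> \<Omega> \<Longrightarrow> g x = f x" "B \<ge> 0"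
        using continuous_clamp_on_compact[OF \<Omega> f] by metis
      have "norm (\<integral>x. f x \<partial>\<sigma> n) \<le> B * m n" for n
      proof -
        interpret finite_measure "\<sigma> n" using \<sigma>(1) by (rule finite_borelD)
        have "\<bar>f x\<bar> \<le> B" if "x \<in> \<Omega>" for x using g(2)[of x] g(3)[OF that] by simp
        then have "(\<integral>x. \<bar>f x\<bar> \<partial>\<sigma> n) \<le> (\<integral>x. B \<partial>\<sigma> n)"
          using integrable_continuous_carried[OF \<Omega> \<sigma>(1,3) f, of n] AE_carried_by[OF \<sigma>(1) cl \<sigma>(3), of n] g
          by (intro integral_mono_AE) (auto elim!: eventually_mono)
        also have "\<dots> = B * m n" using finite_borelD(3)[OF \<sigma>(1)] by (simp add: m_def mult.commute)
        finally show ?thesis unfolding real_norm_def using integral_abs_bound[of "\<sigma> n" f] by linarith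
      qed
      then have ev: "\<forall>\<^sub>F n in sequentially. norm (\<integral>x. f x \<partial>\<sigma> (r n)) \<le> B * m (r n)"
        by (rule always_eventually[OF allI])
      have "(\<lambda>n. B * m (r n)) \<longlonglongrightarrow> 0"
        using tendsto_mult_left[OF lr(2), of B] True by (simp add: o_def)
      from Lim_null_comparison[OF ev this] show ?thesis by (simp only: integral_null_measure)
    qed
    moreover have "finite_borel (null_measure borel :: 'a measure)"
      by (auto simp: finite_borel_def intro!: finite_measureI)
    moreover have "carried_by (null_measure borel) \<Omega>" by (simp add: carried_by_def)
    ultimately show ?thesis using that[OF lr(1), of "null_measure borel"] by blast
  next
    case False
    with lr(3) have "l > 0" by simp
    then have "eventually (\<lambda>n. m (r n) > 0) sequentially"
      using order_tendstoD(1)[OF lr(2)] by (simp add: o_def)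
    then obtain k where k: "\<And>n. n \<ge> k \<Longrightarrow> m (r n) > 0" by (auto simp: eventually_sequentially)
    define s where "s n = r (n + k)" for n
    have s: "strict_mono s" using lr(1) by (auto simp: s_def strict_mono_def)
    have ms: "m (s n) > 0" for n using k by (simp add: s_def)
    have mlim: "(\<lambda>n. m (s n)) \<longlonglongrightarrow> l" using LIMSEQ_ignore_initial_segment[OF lr(2), of k] by (simp add: s_def o_def)
    define \<mu> where "\<mu> n = density (\<sigma> (s n)) (\<lambda>_. ennreal (1 / m (s n)))" for n
    have 1: "finite_borel (\<mu> n)" for n unfolding \<mu>_def by (rule finite_borel_density_const[OF \<sigma>(1)])
    have 2: "emeasure (\<mu> n) UNIV = 1" for n
    proof -
      interpret finite_measure "\<sigma> (s n)" using \<sigma>(1) by (rule finite_borelD)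
      show ?thesis unfolding \<mu>_def using ms[of n] finite_borelD(1)[OF \<sigma>(1)]
        by (simp add: emeasure_density_const emeasure_eq_measure m_def ennreal_mult'[symmetric])
    qed
    have 3: "carried_by (\<mu> n) \<Omega>" for n
      unfolding \<mu>_def by (intro carried_by_density \<sigma> cl) auto
    obtain q \<tau> where q: "strict_mono (q :: nat \<Rightarrow> nat)" "finite_borel \<tau>" "carried_by \<tau> \<Omega>"
      "\<And>f :: 'a \<Rightarrow> real. continuous_on UNIV f \<Longrightarrow> (\<lambda>n. \<integral>x. f x \<partial>\<mu> (q n)) \<longlonglongrightarrow> (\<integral>x. f x \<partial>\<tau>)"
      using weak_compactness_prob[of \<Omega> \<mu>, OF \<Omega> 1 2 3] by blast
    show ?thesis
    proof (rule that)
      show "strict_mono (s \<circ> q)" by (rule strict_mono_o[OF s q(1)])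
      show "finite_borel (density \<tau> (\<lambda>_. ennreal l))" by (rule finite_borel_density_const[OF q(2)])
      show "carried_by (density \<tau> (\<lambda>_. ennreal l)) \<Omega>" by (intro carried_by_density q cl) auto
      fix f :: "'a \<Rightarrow> real" assume f: "continuous_on UNIV f"
      have [measurable]: "f \<in> borel_measurable borel" by (rule borel_measurable_continuous_onI[OF f])
      have "(\<lambda>n. m (s (q n)) * (\<integral>x. f x \<partial>\<mu> (q n))) \<longlonglongrightarrow> l * (\<integral>x. f x \<partial>\<tau>)"
        using LIMSEQ_subseq_LIMSEQ[OF mlim q(1)] by (intro tendsto_mult q(4) f) (simp add: o_def)
      moreover have "m (s n) * (\<integral>x. f x \<partial>\<mu> n) = (\<integral>x. f x \<partial>\<sigma> (s n))" for n
        unfolding \<mu>_def using ms[of n] by (subst integral_density_const[OF \<sigma>(1)]) auto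
      moreover have "(\<integral>x. f x \<partial>density \<tau> (\<lambda>_. ennreal l)) = l * (\<integral>x. f x \<partial>\<tau>)"
        using lr(3) by (intro integral_density_const[OF q(2)]) auto
      ultimately show "(\<lambda>n. \<integral>x. f x \<partial>\<sigma> ((s \<circ> q) n)) \<longlonglongrightarrow> (\<integral>x. f x \<partial>density \<tau> (\<lambda>_. ennreal l))"
        unfolding o_def by (simp only:)
    qed
  qed
qed

section \<open>Strictly superharmonic functions\<close>

text \<open>\<open>h\<^sup>2\<close> times the discrete Laplacian with step \<open>h\<close>; a
  difference quotient also applies to minima, which are not differentiable.\<close>

definition second_diff :: "('a::euclidean_space \<Rightarrow> real) \<Rightarrow> 'a \<Rightarrow> real \<Rightarrow> real" where
  "second_diff f x h = (\<Sum>b\<in>Basis. f (x + h *\<^sub>R b) + f (x - h *\<^sub>R b) - 2 * f x)"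

text \<open>Strictness, a definite negative multiple of \<open>h\<^sup>2\<close>, beats the
  \<open>o(h\<^sup>2)\<close> second differences of a harmonic function at a maximum of the
  difference.\<close>

definition strictly_superharmonic_at :: "('a::euclidean_space \<Rightarrow> real) \<Rightarrow> 'a \<Rightarrow> bool" where
  "strictly_superharmonic_at f x \<longleftrightarrow>
     (\<exists>c>0. \<forall>\<^sub>F h in at_right 0. second_diff f x h \<le> - c * h\<^sup>2)"

lemma second_diff_diff:
  "second_diff (\<lambda>x. f x - g x) x h = second_diff f x h - second_diff g x h"
  unfolding second_diff_def sum_subtractf[symmetric] by (intro sum.cong) auto

lemma second_diff_add:
  "second_diff (\<lambda>x. f x + g x) x h = second_diff f x h + second_diff g x h"
  unfolding second_diff_def sum.distrib[symmetric] by (intro sum.cong) auto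

lemma second_diff_cmult:
  "second_diff (\<lambda>x. c * f x) x h = c * second_diff f x h"
  unfolding second_diff_def sum_distrib_left by (intro sum.cong) (auto simp: algebra_simps)

lemma second_diff_mono:
  fixes x :: "'a::euclidean_space"
  assumes "f x = g x" "\<And>y. dist y x < \<delta> \<Longrightarrow> f y \<le> g y" "\<bar>h\<bar> < \<delta>"
  shows "second_diff f x h \<le> second_diff g x h"
  unfolding second_diff_def
proof (rule sum_mono)
  fix b :: 'a assume b: "b \<in> Basis"
  have "f (x + h *\<^sub>R b) \<le> g (x + h *\<^sub>R b)" "f (x - h *\<^sub>R b) \<le> g (x - h *\<^sub>R b)"
    using assms(3) b by (auto intro!: assms(2) simp: dist_norm)
  then show "f (x + h *\<^sub>R b) + f (x - h *\<^sub>R b) - 2 * f x \<le> g (x + h *\<^sub>R b) + g (x - h *\<^sub>R b) - 2 * g x"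
    using assms(1) by simp
qed

text \<open>A function that touches \<open>g\<close> from below at \<open>x\<close> has smaller
  second differences there. This makes the property stable under minima.\<close>

lemma strictly_superharmonic_at_touching:
  assumes g: "strictly_superharmonic_at g x" and "f x = g x" "\<delta> > 0" "\<And>y. dist y x < \<delta> \<Longrightarrow> f y \<le> g y"
  shows "strictly_superharmonic_at f x"
proof -
  obtain c where c: "c > 0" "\<forall>\<^sub>F h in at_right 0. second_diff g x h \<le> - c * h\<^sup>2"
    using g by (auto simp: strictly_superharmonic_at_def)
  have "\<forall>\<^sub>F h in at_right 0. h \<in> {0<..<\<delta>}"
    using assms(3) by (rule eventually_at_right_real)
  with c(2) have "\<forall>\<^sub>F h in at_right 0. second_diff f x h \<le> - c * h\<^sup>2"
  proof eventually_elim
    case (elim h)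
    have "second_diff f x h \<le> second_diff g x h"
      using elim by (intro second_diff_mono[of f x g \<delta>] assms) auto
    with elim show ?case by simp
  qed
  with c(1) show ?thesis by (auto simp: strictly_superharmonic_at_def)
qed

text \<open>At a positive global maximum of \<open>u - s\<close>, necessarily off \<open>K\<close>,
  second differences of \<open>u - s\<close> are nonpositive, although those of \<open>u\<close> are
  negligible and those of \<open>s\<close> are at most \<open>- c * h\<^sup>2\<close>.\<close>

theorem maximum_principle:
  fixes u s :: "'a::euclidean_space \<Rightarrow> real"
  assumes cont: "continuous_on UNIV u" "continuous_on UNIV s"
    and inf: "\<And>e. e > 0 \<Longrightarrow> \<exists>R. \<forall>x. norm x \<ge> R \<longrightarrow> u x - s x \<le> e"
    and harm: "\<And>x e. x \<notin> K \<Longrightarrow> e > 0 \<Longrightarrow> \<forall>\<^sub>F h in at_right 0. \<bar>second_diff u x h\<bar> \<le> e * h\<^sup>2"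
    and sup: "\<And>x. x \<notin> K \<Longrightarrow> strictly_superharmonic_at s x"
    and K: "\<And>x. x \<in> K \<Longrightarrow> u x \<le> s x"
  shows "u x \<le> s x"
proof (rule ccontr)
  define v where "v x = u x - s x" for x
  assume "\<not> u x \<le> s x"
  then have vx: "v x > 0" by (simp add: v_def)
  \<comment> \<open>Outside this radius the difference is at most half of its value at
    \<open>x\<close>, so a maximum over the ball is global.\<close>
  obtain R where R: "\<And>y. norm y \<ge> R \<Longrightarrow> v y \<le> v x / 2" using inf[of "v x / 2"] vx by (auto simp: v_def)
  have "x \<in> cball 0 \<bar>R\<bar>" using R[of x] vx by (cases "norm x \<ge> R") auto
  moreover have "continuous_on (cball 0 \<bar>R\<bar>) v"
    unfolding v_def using cont by (intro continuous_intros) (auto intro: continuous_on_subset)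
  ultimately obtain z where z: "z \<in> cball 0 \<bar>R\<bar>" "\<And>y. y \<in> cball 0 \<bar>R\<bar> \<Longrightarrow> v y \<le> v z"
    using continuous_attains_sup[of "cball 0 \<bar>R\<bar>" v] by auto
  have xz: "v x \<le> v z" using z(2) \<open>x \<in> cball 0 \<bar>R\<bar>\<close> by blast
  have max: "v y \<le> v z" for y
  proof (cases "y \<in> cball 0 \<bar>R\<bar>")
    case False
    then have "norm y \<ge> R" by auto
    then show ?thesis using R[of y] xz vx by linarith
  qed (rule z)
  have "z \<notin> K" using K[of z] xz vx by (auto simp: v_def)
  obtain c where c: "c > 0" "\<forall>\<^sub>F h in at_right 0. second_diff s z h \<le> - c * h\<^sup>2"
    using sup[OF \<open>z \<notin> K\<close>] by (auto simp: strictly_superharmonic_at_def)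
  have "\<forall>\<^sub>F h in at_right 0. \<bar>second_diff u z h\<bar> \<le> (c / 2) * h\<^sup>2"
    using harm[OF \<open>z \<notin> K\<close>, of "c / 2"] c(1) by (simp only: half_gt_zero)
  moreover have "\<forall>\<^sub>F h in at_right (0::real). h > 0" by (auto simp: eventually_at_filter)
  ultimately have "\<forall>\<^sub>F h in at_right (0::real). False"
    using c(2)
  proof eventually_elim
    case (elim h)
    have "second_diff v z h \<le> 0"
      unfolding second_diff_def by (intro sum_nonpos) (smt (verit) max)
    then have "second_diff u z h \<le> second_diff s z h"
      unfolding v_def second_diff_diff by simp
    with elim have "- (c / 2) * h\<^sup>2 \<le> - c * h\<^sup>2" by linarith
    moreover have "c * h\<^sup>2 > 0" using c(1) elim by simp
    ultimately show False by simp
  qed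
  then show False by (simp add: trivial_limit_at_right_real)
qed

corollary strictly_superharmonic_nonneg:
  fixes s :: "'a::euclidean_space \<Rightarrow> real"
  assumes s: "continuous_on UNIV s" "\<And>e. e > 0 \<Longrightarrow> \<exists>R. \<forall>x. norm x \<ge> R \<longrightarrow> \<bar>s x\<bar> \<le> e"
    "\<And>x. strictly_superharmonic_at s x"
  shows "0 \<le> s x"
proof (rule maximum_principle[of "\<lambda>_. 0" s "{}"])
  fix e :: real assume "e > 0"
  then obtain R where "\<forall>x. norm x \<ge> R \<longrightarrow> \<bar>s x\<bar> \<le> e" using s(2) by blast
  then show "\<exists>R. \<forall>x. norm x \<ge> R \<longrightarrow> 0 - s x \<le> e" by (intro exI[of _ R]) (auto simp: abs_le_iff)
qed (use s in \<open>auto simp: second_diff_def\<close>)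

section \<open>Second differences of bubbles\<close>

lemma powr_taylor_bound:
  fixes a u y \<rho> :: real
  assumes a: "a > 0" and "\<rho> > 0" "u \<ge> \<rho>" "u + y \<ge> \<rho>"
  shows "\<bar>(u + y) powr - a - (u powr - a - a * u powr (- a - 1) * y + a * (a + 1) / 2 * u powr (- a - 2) * y\<^sup>2)\<bar>
    \<le> a * (a + 1) * (a + 2) * \<rho> powr (- a - 3) * \<bar>y\<bar> ^ 3"
proof (cases "y = 0")
  case False
  \<comment> \<open>The derivatives of \<open>t powr - a\<close> up to order 3, as Taylor's theorem
    expects them; the Lagrange remainder is then estimated with its factor 1/6 dropped.\<close>
  define D where "D m t = (case m of 0 \<Rightarrow> t powr - a | Suc 0 \<Rightarrow> - a * t powr (- a - 1)
    | Suc (Suc 0) \<Rightarrow> a * (a + 1) * t powr (- a - 2)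
    | _ \<Rightarrow> - a * (a + 1) * (a + 2) * t powr (- a - 3))" for m :: nat and t :: real
  have D: "DERIV (D m) t :> D (Suc m) t" if m: "m < 3" and t: "t > 0" for m t
  proof -
    consider "m = 0" | "m = 1" | "m = 2" using m by fastforce
    then show ?thesis
    proof cases
      case 1
      have "((\<lambda>t. t powr - a) has_real_derivative - a * t powr (- a - 1)) (at t)"
        using t by (rule has_real_derivative_powr)
      then show ?thesis using 1 by (simp add: D_def[abs_def])
    next
      case 2
      have "((\<lambda>t. - a * t powr (- a - 1)) has_real_derivative - a * ((- a - 1) * t powr (- a - 1 - 1))) (at t)"
        using t by (intro DERIV_cmult has_real_derivative_powr)
      then show ?thesis using 2 by (simp add: D_def[abs_def] algebra_simps)
    next
      case 3
      have "((\<lambda>t. a * (a + 1) * t powr (- a - 2)) has_real_derivative a * (a + 1) * ((- a - 2) * t powr (- a - 2 - 1))) (at t)"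
        using t by (intro DERIV_cmult has_real_derivative_powr)
      then show ?thesis using 3 by (simp add: D_def[abs_def] algebra_simps numeral_2_eq_2)
    qed
  qed
  obtain t where t: "if u + y < u then u + y < t \<and> t < u else u < t \<and> t < u + y"
    "D 0 (u + y) = (\<Sum>m<3. (D m u / fact m) * (u + y - u) ^ m) + (D 3 t / fact 3) * (u + y - u) ^ 3"
    using Taylor[of 3 D "D 0" "\<rho>" "max u (u + y)" u "u + y"] assms False D by auto
  have t\<rho>: "t \<ge> \<rho>" using t(1) assms by (auto split: if_splits)
  have "(\<Sum>m<3. (D m u / fact m) * (u + y - u) ^ m)
    = u powr - a - a * u powr (- a - 1) * y + a * (a + 1) / 2 * u powr (- a - 2) * y\<^sup>2"
    by (simp add: D_def eval_nat_numeral)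
  then have "(u + y) powr - a - (u powr - a - a * u powr (- a - 1) * y + a * (a + 1) / 2 * u powr (- a - 2) * y\<^sup>2)
    = (D 3 t / fact 3) * y ^ 3"
    using t(2) by (simp add: D_def[of 0])
  also have "\<bar>\<dots>\<bar> = a * (a + 1) * (a + 2) / 6 * t powr (- a - 3) * \<bar>y\<bar> ^ 3"
    using a by (simp add: D_def numeral_3_eq_3 abs_mult power_abs fact_numeral eval_nat_numeral)
  also have "\<dots> \<le> a * (a + 1) * (a + 2) * \<rho> powr (- a - 3) * \<bar>y\<bar> ^ 3"
    using a assms t\<rho> by (intro mult_right_mono mult_mono powr_mono2') auto
  finally show ?thesis .
qed simp

text \<open>For \<open>c = 0\<close> this is the kernel, except for the junk value \<open>0\<close> at the origin.\<close>

definition bubble :: "real \<Rightarrow> 'a::euclidean_space \<Rightarrow> real" where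
  "bubble c x = (c + (norm x)\<^sup>2) powr - kexp TYPE('a)"

lemma continuous_on_bubble:
  assumes "c > 0" shows "continuous_on S (bubble c)"
proof -
  have "c + (norm x)\<^sup>2 > 0" for x :: 'a using assms by (intro add_pos_nonneg) auto
  then have "c + (norm x)\<^sup>2 \<noteq> 0" for x :: 'a by (metis less_irrefl)
  then show ?thesis unfolding bubble_def by (intro continuous_intros) auto
qed

lemma kexp_pos: "DIM('a::euclidean_space) \<ge> 3 \<Longrightarrow> kexp TYPE('a) > 0"
  by (simp add: kexp_def)

text \<open>Moving by \<open>h\<close> along an axis changes the squared norm by
  \<open>h\<^sup>2\<close> plus or minus \<open>2 * h * (x \<bullet> b)\<close>; the powers are
  expanded to second order in that increment. The constant is uniform in \<open>x\<close> so that,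
  for \<open>c = 0\<close>, the estimate can be integrated against a measure. The condition
  \<open>h * (1 + 2 * R) \<le> \<rho>\<close> keeps the shifted argument at least
  \<open>\<rho>\<close>.\<close>

lemma bubble_second_diff:
  fixes c \<rho> R :: real
  assumes D: "DIM('a::euclidean_space) \<ge> 3" and \<rho>: "\<rho> > 0" and R: "R \<ge> 0"
  defines "a \<equiv> kexp TYPE('a)"
  shows "\<exists>C\<ge>0. \<forall>(x::'a) h. c + (norm x)\<^sup>2 \<ge> 2 * \<rho> \<longrightarrow> norm x \<le> R \<longrightarrow> 0 < h \<longrightarrow> h \<le> 1 \<longrightarrow> h * (1 + 2 * R) \<le> \<rho>
    \<longrightarrow> \<bar>second_diff (bubble c) x h + 4 * a * (a + 1) * c * (c + (norm x)\<^sup>2) powr (- a - 2) * h\<^sup>2\<bar> \<le> C * h ^ 3"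
proof -
  have a: "a > 0" "2 * a = real DIM('a) - 2" using D by (auto simp: a_def kexp_def)
  define N where "N = real DIM('a)"
  define K where "K = a * (a + 1) * (a + 2) * \<rho> powr (- a - 3)"
  define E where "E = 1 + 2 * R"
  define C where "C = N * (2 * (K * E ^ 3)) + N * (a * (a + 1) * \<rho> powr (- a - 2))"
  have K0: "K \<ge> 0" using a by (simp add: K_def)
  have E0: "E \<ge> 0" using R by (simp add: E_def)
  have N0: "N \<ge> 0" by (simp add: N_def)
  have "\<bar>second_diff (bubble c) x h + 4 * a * (a + 1) * c * (c + (norm x)\<^sup>2) powr (- a - 2) * h\<^sup>2\<bar> \<le> C * h ^ 3"
    if u: "c + (norm x)\<^sup>2 \<ge> 2 * \<rho>" and x: "norm x \<le> R" and h: "0 < h" "h \<le> 1" "h * (1 + 2 * R) \<le> \<rho>" for x :: 'a and h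
  proof -
    define u where "u = c + (norm x)\<^sup>2"
    have u0: "u > 0" "u \<ge> \<rho>" "u \<ge> 2 * \<rho>" using u \<rho> by (auto simp: u_def)
    \<comment> \<open>The second-order Taylor polynomial of \<open>(u + y) powr - a\<close>.\<close>
    define P where "P y = u powr - a - a * u powr (- a - 1) * y + a * (a + 1) / 2 * u powr (- a - 2) * y\<^sup>2" for y
    have bnd: "\<bar>bubble c (x + (e * h) *\<^sub>R b) - P (h\<^sup>2 + 2 * e * h * (x \<bullet> b))\<bar> \<le> K * (E * h) ^ 3"
      if b: "b \<in> Basis" and e: "e = 1 \<or> e = -1" for b e
    proof -
      define y where "y = h\<^sup>2 + 2 * e * h * (x \<bullet> b)"
      have n: "(norm (x + (e * h) *\<^sub>R b))\<^sup>2 = (norm x)\<^sup>2 + y"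
        using b e unfolding power2_norm_eq_inner y_def
        by (auto simp: inner_simps algebra_simps inner_commute power2_eq_square)
      have "\<bar>x \<bullet> b\<bar> \<le> R" using Basis_le_norm[OF b, of x] x by linarith
      then have "\<bar>2 * e * h * (x \<bullet> b)\<bar> \<le> 2 * h * R" using e h by (auto simp: abs_mult)
      moreover have "h\<^sup>2 \<le> h" using h by (simp add: power2_eq_square mult_left_le)
      ultimately have y: "\<bar>y\<bar> \<le> E * h" unfolding y_def E_def using h abs_triangle_ineq[of "h\<^sup>2" "2 * e * h * (x \<bullet> b)"]
        by (simp add: algebra_simps)
      then have "u + y \<ge> \<rho>" using h u0 by (simp add: E_def mult.commute)
      from powr_taylor_bound[OF a(1) \<rho> u0(2) this]
      have "\<bar>(u + y) powr - a - P y\<bar> \<le> K * \<bar>y\<bar> ^ 3" by (simp add: P_def K_def)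
      also have "\<dots> \<le> K * (E * h) ^ 3" using y K0 by (intro mult_left_mono power_mono) auto
      finally show ?thesis using n by (simp add: bubble_def a_def[symmetric] u_def y_def[symmetric] add.assoc)
    qed
    have bx: "bubble c x = u powr - a" by (simp add: bubble_def u_def a_def)
    have main: "(\<Sum>b\<in>Basis. P (h\<^sup>2 + 2 * 1 * h * (x \<bullet> b)) + P (h\<^sup>2 + 2 * (-1) * h * (x \<bullet> b)) - 2 * bubble c x)
      = - 4 * a * (a + 1) * c * u powr (- a - 2) * h\<^sup>2 + N * (a * (a + 1) * u powr (- a - 2)) * h ^ 4"
    proof -
      have "(\<Sum>b\<in>Basis. P (h\<^sup>2 + 2 * 1 * h * (x \<bullet> b)) + P (h\<^sup>2 + 2 * (-1) * h * (x \<bullet> b)) - 2 * bubble c x)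
        = (\<Sum>b\<in>(Basis::'a set). (- 2 * a * u powr (- a - 1) * h\<^sup>2 + a * (a + 1) * u powr (- a - 2) * h ^ 4)
            + 4 * a * (a + 1) * u powr (- a - 2) * h\<^sup>2 * (x \<bullet> b)\<^sup>2)"
        unfolding P_def bx by (intro sum.cong refl) (simp add: field_simps power2_eq_square power4_eq_xxxx)
      also have "\<dots> = N * (- 2 * a * u powr (- a - 1) * h\<^sup>2 + a * (a + 1) * u powr (- a - 2) * h ^ 4)
          + 4 * a * (a + 1) * u powr (- a - 2) * h\<^sup>2 * (\<Sum>b\<in>Basis. (x \<bullet> b)\<^sup>2)"
        by (simp add: sum.distrib N_def sum_distrib_left)
      also have "(\<Sum>b\<in>Basis. (x \<bullet> b)\<^sup>2) = u - c"
        unfolding u_def power2_norm_eq_inner by (subst (2) euclidean_inner) (simp add: power2_eq_square)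
      also have "u powr (- a - 1) = u powr (- a - 2) * u"
      proof -
        have "u powr (- a - 1) = u powr ((- a - 2) + 1)" by (rule arg_cong[of _ _ "(powr) u"]) simp
        then show ?thesis using u0(1) by (simp only: powr_add) simp
      qed
      also have "N * (- 2 * a * (u powr (- a - 2) * u) * h\<^sup>2 + a * (a + 1) * u powr (- a - 2) * h ^ 4)
          + 4 * a * (a + 1) * u powr (- a - 2) * h\<^sup>2 * (u - c)
         = - 4 * a * (a + 1) * c * u powr (- a - 2) * h\<^sup>2 + N * (a * (a + 1) * u powr (- a - 2)) * h ^ 4"
      proof -
        \<comment> \<open>Harmonicity of the kernel: with this exponent the terms with
          \<open>u powr (- a - 1)\<close> cancel, and only the term with factor \<open>c\<close>
          survives at order \<open>h\<^sup>2\<close>.\<close>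
        have N: "N = 2 * a + 2" using a(2) by (simp add: N_def)
        show ?thesis unfolding N by algebra
      qed
      finally show ?thesis .
    qed
    have "\<bar>second_diff (bubble c) x h - (\<Sum>b\<in>Basis. P (h\<^sup>2 + 2 * 1 * h * (x \<bullet> b)) + P (h\<^sup>2 + 2 * (-1) * h * (x \<bullet> b)) - 2 * bubble c x)\<bar>
      \<le> (\<Sum>b\<in>(Basis::'a set). 2 * (K * (E * h) ^ 3))"
      unfolding second_diff_def sum_subtractf[symmetric]
    proof (rule order_trans[OF sum_abs sum_mono])
      fix b :: 'a assume b: "b \<in> Basis"
      from bnd[OF b, of 1] bnd[OF b, of "-1"]
      show "\<bar>bubble c (x + h *\<^sub>R b) + bubble c (x - h *\<^sub>R b) - 2 * bubble c x
        - (P (h\<^sup>2 + 2 * 1 * h * (x \<bullet> b)) + P (h\<^sup>2 + 2 * - 1 * h * (x \<bullet> b)) - 2 * bubble c x)\<bar> \<le> 2 * (K * (E * h) ^ 3)"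
        by (simp add: abs_le_iff)
    qed
    then have 1: "\<bar>second_diff (bubble c) x h + 4 * a * (a + 1) * c * u powr (- a - 2) * h\<^sup>2
        - N * (a * (a + 1) * u powr (- a - 2)) * h ^ 4\<bar> \<le> N * (2 * (K * (E * h) ^ 3))"
      unfolding main by (simp add: N_def algebra_simps)
    have "N * (a * (a + 1) * u powr (- a - 2)) * h ^ 4 \<le> N * (a * (a + 1) * \<rho> powr (- a - 2)) * h ^ 3"
      using N0 a(1) u0 \<rho> h by (intro mult_mono powr_mono2' power_decreasing) auto
    moreover have "0 \<le> N * (a * (a + 1) * u powr (- a - 2)) * h ^ 4" using N0 a(1) h by simp
    ultimately have "\<bar>second_diff (bubble c) x h + 4 * a * (a + 1) * c * u powr (- a - 2) * h\<^sup>2\<bar>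
      \<le> N * (2 * (K * (E * h) ^ 3)) + N * (a * (a + 1) * \<rho> powr (- a - 2)) * h ^ 3"
      using 1 by linarith
    also have "\<dots> = C * h ^ 3" by (simp add: C_def power_mult_distrib algebra_simps)
    finally show ?thesis by (simp add: u_def)
  qed
  moreover have "C \<ge> 0" using N0 K0 E0 a by (simp add: C_def)
  ultimately show ?thesis by blast
qed

text \<open>At a fixed point the cubic error is eventually below any multiple of
  \<open>h\<^sup>2\<close>.\<close>

lemma bubble_second_diff_at:
  fixes x :: "'a::euclidean_space"
  assumes D: "DIM('a) \<ge> 3" and c: "c > 0" and e: "e > 0"
  defines "a \<equiv> kexp TYPE('a)"
  shows "\<forall>\<^sub>F h in at_right 0. second_diff (bubble c) x h
    \<le> - 4 * a * (a + 1) * c * (c + (norm x)\<^sup>2) powr (- a - 2) * h\<^sup>2 + e * h\<^sup>2"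
proof -
  define \<rho> where "\<rho> = c / 2"
  have \<rho>: "\<rho> > 0" "2 * \<rho> \<le> c + (norm x)\<^sup>2" using c by (auto simp: \<rho>_def)
  obtain C where C: "C \<ge> 0" "\<forall>(x'::'a) h. c + (norm x')\<^sup>2 \<ge> 2 * \<rho> \<longrightarrow> norm x' \<le> norm x \<longrightarrow> 0 < h \<longrightarrow> h \<le> 1
      \<longrightarrow> h * (1 + 2 * norm x) \<le> \<rho>
    \<longrightarrow> \<bar>second_diff (bubble c) x' h + 4 * a * (a + 1) * c * (c + (norm x')\<^sup>2) powr (- a - 2) * h\<^sup>2\<bar> \<le> C * h ^ 3"
    using bubble_second_diff[OF D \<rho>(1) norm_ge_zero[of x], of c] unfolding a_def by blast
  define \<delta> where "\<delta> = min 1 (min (\<rho> / (1 + 2 * norm x)) (e / (C + 1)))"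
  have p: "1 + 2 * norm x > 0" using norm_ge_zero[of x] by linarith
  have "\<delta> > 0" using \<rho> p C e by (simp add: \<delta>_def)
  then have "\<forall>\<^sub>F h in at_right 0. h \<in> {0<..<\<delta>}" by (rule eventually_at_right_real)
  then show ?thesis
  proof eventually_elim
    case (elim h)
    then have h: "0 < h" "h \<le> 1" "h < \<rho> / (1 + 2 * norm x)" "h < e / (C + 1)" by (auto simp: \<delta>_def)
    have "h * (1 + 2 * norm x) \<le> \<rho>" using h(3) p by (simp add: field_simps)
    with C(2) h \<rho>(2) have *: "\<bar>second_diff (bubble c) x h + 4 * a * (a + 1) * c * (c + (norm x)\<^sup>2) powr (- a - 2) * h\<^sup>2\<bar> \<le> C * h ^ 3"
      by auto
    have "C * h \<le> e" using h(4) C(1) h(1) by (simp add: field_simps)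
    then have "C * h * h\<^sup>2 \<le> e * h\<^sup>2" by (rule mult_right_mono) simp
    then have "C * h ^ 3 \<le> e * h\<^sup>2" by (simp add: power3_eq_cube power2_eq_square mult_ac)
    with * show ?case by linarith
  qed
qed

lemma bubble_superharmonic:
  fixes x :: "'a::euclidean_space"
  assumes D: "DIM('a) \<ge> 3" and c: "c > 0" and K: "K > 0"
  shows "strictly_superharmonic_at (\<lambda>x. K * bubble c x) x"
proof -
  define a where "a = kexp TYPE('a)"
  define k where "k = 4 * a * (a + 1) * c * (c + (norm x)\<^sup>2) powr (- a - 2)"
  have "c + (norm x)\<^sup>2 > 0" using c by (intro add_pos_nonneg) auto
  then have "k > 0" using kexp_pos[OF D] c unfolding k_def a_def by simp
  have "\<forall>\<^sub>F h in at_right 0. second_diff (bubble c) x h \<le> - k * h\<^sup>2 + (k / 2) * h\<^sup>2"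
    using bubble_second_diff_at[OF D c, of "k / 2" x] \<open>k > 0\<close> by (simp add: k_def a_def)
  then have "\<forall>\<^sub>F h in at_right 0. second_diff (\<lambda>x. K * bubble c x) x h \<le> - (K * (k / 2)) * h\<^sup>2"
  proof eventually_elim
    case (elim h)
    then have "second_diff (bubble c) x h \<le> - (k / 2) * h\<^sup>2" by (simp add: algebra_simps)
    then have "K * second_diff (bubble c) x h \<le> K * (- (k / 2) * h\<^sup>2)" using K by (intro mult_left_mono) auto
    then show ?case by (simp add: second_diff_cmult mult_ac)
  qed
  then show ?thesis using K \<open>k > 0\<close> unfolding strictly_superharmonic_at_def
    by (intro exI[of _ "K * (k / 2)"]) auto
qed

lemma bubble_vanishes:
  assumes D: "DIM('a::euclidean_space) \<ge> 3" and c: "c > 0" and e: "e > 0"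
  shows "\<exists>R. \<forall>x::'a. norm x \<ge> R \<longrightarrow> \<bar>K * bubble c x\<bar> \<le> e"
proof -
  have "((\<lambda>r. \<bar>K\<bar> * (c + r\<^sup>2) powr - kexp TYPE('a)) \<longlongrightarrow> \<bar>K\<bar> * 0) at_top"
  proof (intro tendsto_mult_left tendsto_neg_powr)
    show "- kexp TYPE('a) < 0" using kexp_pos[OF D] by simp
    show "filterlim (\<lambda>r::real. c + r\<^sup>2) at_top at_top" by real_asymp
  qed
  then have "\<forall>\<^sub>F r in at_top. \<bar>K\<bar> * (c + r\<^sup>2) powr - kexp TYPE('a) < e"
    using e by (auto dest: order_tendstoD(2))
  then obtain R where "\<And>r. r \<ge> R \<Longrightarrow> \<bar>K\<bar> * (c + r\<^sup>2) powr - kexp TYPE('a) < e"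
    by (auto simp: eventually_at_top_linorder)
  then show ?thesis by (intro exI[of _ R]) (force simp: bubble_def abs_mult)
qed

section \<open>Superharmonic extension of smooth functions\<close>

lemma compact_positive_bound:
  fixes f :: "'a::euclidean_space \<Rightarrow> real"
  assumes "compact S" "continuous_on S f" "\<And>x. x \<in> S \<Longrightarrow> f x > 0"
  shows "\<exists>\<eta>>0. \<forall>x\<in>S. f x \<ge> \<eta>"
proof (cases "S = {}")
  case False
  obtain z where "z \<in> S" "\<And>y. y \<in> S \<Longrightarrow> f z \<le> f y"
    using continuous_attains_inf[OF assms(1) False assms(2)] by blast
  then show ?thesis using assms(3)[of z] by blast
qed (auto intro: exI[of _ 1])

text \<open>Taylor expansion to second order along each axis, in both directions: the first-order
  terms cancel, and the second derivatives are bounded on the ball of radius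
  \<open>\<bar>R\<bar> + 1\<close>, which contains all points reached with steps
  \<open>h \<le> 1\<close>.\<close>

lemma smooth_second_diff_bound:
  fixes \<phi> :: "'a::euclidean_space \<Rightarrow> real"
  assumes \<phi>: "smooth_on UNIV \<phi>"
  shows "\<exists>C. \<forall>x h. norm x \<le> R \<longrightarrow> 0 < h \<longrightarrow> h \<le> 1 \<longrightarrow> second_diff \<phi> x h \<le> C * h\<^sup>2"
proof -
  define D1 where "D1 b x = frechet_derivative \<phi> (at x) b" for b x
  define D2 where "D2 b x = frechet_derivative (D1 b) (at x) b" for b x
  have "Ck_on UNIV (Suc (Suc 0)) \<phi>" using \<phi> unfolding smooth_on_def by blast
  then have d0: "\<phi> differentiable (at x)" and d1: "D1 b differentiable (at x)"
    and c2: "continuous_on UNIV (D2 b)" for x b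
    unfolding D1_def D2_def by auto
  have line: "DERIV (\<lambda>t. f (x + t *\<^sub>R b)) t :> frechet_derivative f (at (x + t *\<^sub>R b)) b"
    if f: "f differentiable (at (x + t *\<^sub>R b))" for f :: "'a \<Rightarrow> real" and x b t
  proof -
    have fd: "(f has_derivative frechet_derivative f (at (x + t *\<^sub>R b))) (at (x + t *\<^sub>R b))"
      using f by (simp add: frechet_derivative_works)
    interpret bounded_linear "frechet_derivative f (at (x + t *\<^sub>R b))"
      using fd by (rule has_derivative_bounded_linear)
    have "((\<lambda>t. x + t *\<^sub>R b) has_derivative (\<lambda>s. s *\<^sub>R b)) (at t)"
      by (auto intro!: derivative_eq_intros)
    from has_derivative_compose[OF this fd] show ?thesis
      by (simp add: has_field_derivative_def scaleR mult.commute[of _ "frechet_derivative f (at (x + t *\<^sub>R b)) b"])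
  qed
  have "\<exists>B. \<forall>y\<in>cball 0 (\<bar>R\<bar> + 1). \<bar>D2 b y\<bar> \<le> B" for b
  proof -
    have "bounded (D2 b ` cball 0 (\<bar>R\<bar> + 1))"
      using c2[of b] by (intro compact_imp_bounded compact_continuous_image) (auto intro: continuous_on_subset)
    then show ?thesis unfolding bounded_iff by auto
  qed
  then obtain B where B: "\<And>b y. y \<in> cball 0 (\<bar>R\<bar> + 1) \<Longrightarrow> \<bar>D2 b y\<bar> \<le> B b" by metis
  have "second_diff \<phi> x h \<le> (\<Sum>b\<in>Basis. B b) * h\<^sup>2" if x: "norm x \<le> R" and h: "0 < h" "h \<le> 1" for x h
    unfolding second_diff_def sum_distrib_right
  proof (rule sum_mono)
    fix b :: 'a assume b: "b \<in> Basis"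
    define T where "T m t = (case m of 0 \<Rightarrow> \<phi> (x + t *\<^sub>R b) | Suc 0 \<Rightarrow> D1 b (x + t *\<^sub>R b) | _ \<Rightarrow> D2 b (x + t *\<^sub>R b))"
      for m :: nat and t
    have T: "DERIV (T m) t :> T (Suc m) t" if m: "m < 2" for m t
    proof -
      consider "m = 0" | "m = 1" using m by fastforce
      then show ?thesis
        by cases (use line[OF d0] line[OF d1] in \<open>simp_all add: T_def[abs_def] D1_def D2_def\<close>)
    qed
    have half: "\<exists>t. \<bar>t\<bar> \<le> 1 \<and> \<phi> (x + e *\<^sub>R b) = \<phi> x + D1 b x * e + D2 b (x + t *\<^sub>R b) / 2 * e\<^sup>2"
      if e: "e \<noteq> 0" "\<bar>e\<bar> \<le> 1" for e
    proof -
      obtain t where t: "if e < 0 then e < t \<and> t < 0 else 0 < t \<and> t < e"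
        "T 0 e = (\<Sum>m<2. (T m 0 / fact m) * (e - 0) ^ m) + (T 2 t / fact 2) * (e - 0) ^ 2"
      proof -
        have "-1 \<le> e" "e \<le> 1" using e by auto
        then show thesis using Taylor[of 2 T "T 0" "-1" 1 0 e] T e(1) that by fastforce
      qed
      then show ?thesis using e by (intro exI[of _ t]) (auto simp: T_def eval_nat_numeral split: if_splits)
    qed
    obtain t1 where t1: "\<bar>t1\<bar> \<le> 1" "\<phi> (x + h *\<^sub>R b) = \<phi> x + D1 b x * h + D2 b (x + t1 *\<^sub>R b) / 2 * h\<^sup>2"
      using half[of h] h by auto
    obtain t2 where t2: "\<bar>t2\<bar> \<le> 1" "\<phi> (x + (- h) *\<^sub>R b) = \<phi> x + D1 b x * (- h) + D2 b (x + t2 *\<^sub>R b) / 2 * (- h)\<^sup>2"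
      using half[of "- h"] h by auto
    have "D2 b (x + t *\<^sub>R b) \<le> B b" if "\<bar>t\<bar> \<le> 1" for t
    proof -
      have "norm (x + t *\<^sub>R b) \<le> \<bar>R\<bar> + 1"
        using norm_triangle_ineq[of x "t *\<^sub>R b"] x that b by simp
      then show ?thesis using B[of "x + t *\<^sub>R b" b] by simp
    qed
    then have "(D2 b (x + t1 *\<^sub>R b) + D2 b (x + t2 *\<^sub>R b)) / 2 * h\<^sup>2 \<le> B b * h\<^sup>2"
      using add_mono[of "D2 b (x + t1 *\<^sub>R b)" "B b" "D2 b (x + t2 *\<^sub>R b)" "B b"] t1(1) t2(1)
      by (intro mult_right_mono) auto
    then show "\<phi> (x + h *\<^sub>R b) + \<phi> (x - h *\<^sub>R b) - 2 * \<phi> x \<le> B b * h\<^sup>2"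
      using t1(2) t2(2) by (simp add: field_simps)
  qed
  then show ?thesis by blast
qed

text \<open>On a ball the Laplacian of the bubble is bounded away from 0 by its value at the rim, so
  a large multiple outweighs the bounded second differences of \<open>\<phi>\<close>.\<close>

lemma smooth_add_bubble_superharmonic:
  fixes \<phi> :: "'a::euclidean_space \<Rightarrow> real"
  assumes D: "DIM('a) \<ge> 3" and \<phi>: "smooth_on UNIV \<phi>"
  shows "\<exists>K0. \<forall>K\<ge>K0. \<forall>x. norm x \<le> R \<longrightarrow> strictly_superharmonic_at (\<lambda>x. \<phi> x + K * bubble 1 x) x"
proof -
  define a where "a = kexp TYPE('a)"
  have a: "a > 0" using kexp_pos[OF D] by (simp add: a_def)
  define k where "k r = 4 * a * (a + 1) * (1 + r\<^sup>2) powr (- a - 2)" for r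
  have kpos: "k r > 0" for r
  proof -
    have "1 + r\<^sup>2 > 0" by (intro add_pos_nonneg) auto
    then show ?thesis using a by (simp add: k_def)
  qed
  obtain C where C: "\<And>x h. norm x \<le> R \<Longrightarrow> 0 < h \<Longrightarrow> h \<le> 1 \<Longrightarrow> second_diff \<phi> x h \<le> C * h\<^sup>2"
    using smooth_second_diff_bound[OF \<phi>] by blast
  \<comment> \<open>Gives a surplus of 1 over \<open>C\<close>: one half absorbs the error of the
    bubble expansion, the other half is the strictness constant.\<close>
  define K0 where "K0 = max 1 ((C + 1) / k R)"
  have "strictly_superharmonic_at (\<lambda>x. \<phi> x + K * bubble 1 x) x" if K: "K \<ge> K0" and x: "norm x \<le> R" for K x
  proof -
    have K1: "K > 0" "K * k R \<ge> C + 1" using K kpos[of R] by (auto simp: K0_def field_simps)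
    have kx: "k R \<le> k (norm x)"
    proof -
      have "1 + (norm x)\<^sup>2 > 0" by (intro add_pos_nonneg) auto
      moreover have "(norm x)\<^sup>2 \<le> R\<^sup>2" using x by (intro power_mono) auto
      ultimately show ?thesis unfolding k_def using a by (intro mult_left_mono powr_mono2') auto
    qed
    have "K * k (norm x) \<ge> C + 1" using mult_left_mono[OF kx, of K] K1 by linarith
    have ev: "\<forall>\<^sub>F h in at_right 0. h \<in> {0<..<1::real}" by (rule eventually_at_right_real) simp
    have "\<forall>\<^sub>F h in at_right 0. second_diff (bubble 1) x h \<le> - k (norm x) * h\<^sup>2 + (1 / (2 * K)) * h\<^sup>2"
      using bubble_second_diff_at[OF D, of 1 "1 / (2 * K)" x] K1(1) by (simp add: k_def a_def)
    then have "\<forall>\<^sub>F h in at_right 0. second_diff (\<lambda>x. \<phi> x + K * bubble 1 x) x h \<le> - (1 / 2) * h\<^sup>2"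
      using ev
    proof eventually_elim
      case (elim h)
      have "K * second_diff (bubble 1) x h \<le> K * (- k (norm x) * h\<^sup>2 + (1 / (2 * K)) * h\<^sup>2)"
        using elim K1 by (intro mult_left_mono) auto
      also have "\<dots> = - (K * k (norm x)) * h\<^sup>2 + (1 / 2) * h\<^sup>2"
        using K1(1) by (simp add: algebra_simps)
      also have "\<dots> \<le> - (C + 1) * h\<^sup>2 + (1 / 2) * h\<^sup>2"
        using \<open>K * k (norm x) \<ge> C + 1\<close> by (intro add_right_mono mult_right_mono) auto
      finally show ?case
        using C[OF x, of h] elim by (simp add: second_diff_add second_diff_cmult algebra_simps)
    qed
    then show ?thesis unfolding strictly_superharmonic_at_def by (intro exI[of _ "1/2"]) auto
  qed
  then show ?thesis by blast
qed

text \<open>Near \<open>\<Omega>\<close> the function \<open>\<phi> + K * bubble 1\<close> lies below \<open>K\<close> times a second, steeper bubble,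
  and far away it lies above; since minima of superharmonic functions are superharmonic,
  switching over to the second bubble makes the function vanish at infinity.\<close>

lemma superharmonic_extension:
  fixes \<phi> :: "'a::euclidean_space \<Rightarrow> real"
  assumes D: "DIM('a) \<ge> 3" and \<phi>: "smooth_on UNIV \<phi>" and \<Omega>: "bounded \<Omega>"
  obtains s K where "K > 0" "continuous_on UNIV s" "\<And>e. e > 0 \<Longrightarrow> \<exists>R. \<forall>x. norm x \<ge> R \<longrightarrow> \<bar>s x\<bar> \<le> e"
    "\<And>x. strictly_superharmonic_at s x" "\<And>x. x \<in> \<Omega> \<Longrightarrow> s x = \<phi> x + K * bubble 1 x"
proof -
  define a where "a = kexp TYPE('a)"
  have a: "a > 0" using kexp_pos[OF D] by (simp add: a_def)
  obtain R0 where R0: "R0 > 0" "\<And>x. x \<in> \<Omega> \<Longrightarrow> norm x \<le> R0" using \<Omega> by (auto simp: bounded_pos)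
  define q where "q = (R0 + 1)\<^sup>2"
  \<comment> \<open>Chosen so that \<open>w1\<close> and \<open>w2\<close> agree exactly on the
    sphere of radius \<open>R0 + 1\<close>, with \<open>w2\<close> larger inside and smaller
    outside.\<close>
  define l where "l = (1 + q) / (1 / 2 + q)"
  have q: "q > 0" using R0 by (simp add: q_def)
  have l: "l > 1" using q by (simp add: l_def field_simps)
  define w1 w2 :: "'a \<Rightarrow> real" where "w1 = bubble 1" and "w2 x = l powr - a * bubble (1/2) x" for x
  have w2: "w2 x = (l * (1 / 2 + (norm x)\<^sup>2)) powr - a" for x
    using l by (simp add: w2_def bubble_def a_def powr_mult)
  have cmp: "1 + t - l * (1 / 2 + t) = (q - t) * (1 / 2) / (1 / 2 + q)" for t
    using q by (simp add: l_def field_simps)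
  have near: "w2 x > w1 x" if "norm x < R0 + 1" for x
  proof -
    have "(norm x)\<^sup>2 < q" unfolding q_def using that by (intro power_strict_mono) auto
    then have "(q - (norm x)\<^sup>2) * (1 / 2) / (1 / 2 + q) > 0" using q by simp
    then have "l * (1 / 2 + (norm x)\<^sup>2) < 1 + (norm x)\<^sup>2" using cmp[of "(norm x)\<^sup>2"] by linarith
    moreover have "l * (1 / 2 + (norm x)\<^sup>2) > 0" using l by (intro mult_pos_pos add_pos_nonneg) auto
    ultimately show ?thesis unfolding w2 w1_def bubble_def a_def[symmetric] using a by (intro powr_less_mono2_neg) auto
  qed
  have far: "w2 x < w1 x" if "norm x > R0 + 1" for x
  proof -
    have "(norm x)\<^sup>2 > q" unfolding q_def using that R0 by (intro power_strict_mono) auto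
    then have "(q - (norm x)\<^sup>2) * (1 / 2) / (1 / 2 + q) < 0" using q by (simp add: divide_less_0_iff)
    then have "l * (1 / 2 + (norm x)\<^sup>2) > 1 + (norm x)\<^sup>2" using cmp[of "(norm x)\<^sup>2"] by linarith
    moreover have "1 + (norm x)\<^sup>2 > 0" by (intro add_pos_nonneg) auto
    ultimately show ?thesis unfolding w2 w1_def bubble_def a_def[symmetric] using a by (intro powr_less_mono2_neg) auto
  qed
  have cw: "continuous_on S w1" "continuous_on S w2" for S
    unfolding w1_def w2_def by (auto intro!: continuous_intros continuous_on_bubble)
  have c\<phi>: "continuous_on S \<phi>" for S
    using \<phi>[unfolded smooth_on_def, rule_format, of 0] by (auto intro: continuous_on_subset)
  obtain \<eta>1 where \<eta>1: "\<eta>1 > 0" "\<And>x. x \<in> cball 0 R0 \<Longrightarrow> w2 x - w1 x \<ge> \<eta>1"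
    using compact_positive_bound[of "cball 0 R0" "\<lambda>x. w2 x - w1 x"] near
    by (force intro!: continuous_intros cw)
  define A where "A = cball 0 (R0 + 2) - ball (0::'a) (R0 + 3 / 2)"
  have "compact A" unfolding A_def by (intro compact_diff) auto
  then obtain \<eta>2 where \<eta>2: "\<eta>2 > 0" "\<And>x. x \<in> A \<Longrightarrow> w1 x - w2 x \<ge> \<eta>2"
    using compact_positive_bound[of A "\<lambda>x. w1 x - w2 x"] far
    by (force intro!: continuous_intros cw simp: A_def)
  have "bounded (\<phi> ` cball 0 (R0 + 2))"
    by (intro compact_imp_bounded compact_continuous_image c\<phi>) auto
  then obtain B where B: "\<And>x. norm x \<le> R0 + 2 \<Longrightarrow> \<bar>\<phi> x\<bar> \<le> B" "B > 0"
    unfolding bounded_pos image_iff by (metis image_eqI mem_cball_0 real_norm_def)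
  obtain K0 where K0: "\<And>K x. K \<ge> K0 \<Longrightarrow> norm x \<le> R0 + 2 \<Longrightarrow> strictly_superharmonic_at (\<lambda>x. \<phi> x + K * bubble 1 x) x"
    using smooth_add_bubble_superharmonic[OF D \<phi>] by blast
  \<comment> \<open>Magnifies the gap between \<open>w1\<close> and \<open>w2\<close> beyond the
    bound \<open>B\<close> on \<open>\<phi>\<close>, both on the ball around \<open>\<Omega>\<close>
    and on the annulus \<open>A\<close>.\<close>
  define K where "K = max K0 (max (B / \<eta>1) (B / \<eta>2))"
  have "K \<ge> B / \<eta>1" "K \<ge> B / \<eta>2" "K \<ge> K0" by (auto simp: K_def)
  then have K: "K * \<eta>1 \<ge> B" "K * \<eta>2 \<ge> B" "K \<ge> K0"
    using \<eta>1(1) \<eta>2(1) by (auto simp: field_simps)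
  moreover have "B / \<eta>1 > 0" using B(2) \<eta>1(1) by simp
  ultimately have K: "K > 0" "K * \<eta>1 \<ge> B" "K * \<eta>2 \<ge> B" "K \<ge> K0"
    using \<open>K \<ge> B / \<eta>1\<close> by linarith+
  define f where "f x = \<phi> x + K * w1 x" for x
  define g where "g x = K * w2 x" for x
  have fg_near: "f x \<le> g x" if "norm x \<le> R0" for x
  proof -
    have "K * \<eta>1 \<le> K * (w2 x - w1 x)" using \<eta>1(2)[of x] that K(1) by (intro mult_left_mono) auto
    then show ?thesis using B(1)[of x] that K(2) by (simp add: f_def g_def algebra_simps abs_le_iff)
  qed
  have fg_far: "g x \<le> f x" if "x \<in> A" for x
  proof -
    have "K * \<eta>2 \<le> K * (w1 x - w2 x)" using \<eta>2(2)[of x] that K(1) by (intro mult_left_mono) auto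
    then show ?thesis using B(1)[of x] that K(3) by (simp add: f_def g_def algebra_simps abs_le_iff A_def)
  qed
  \<comment> \<open>On the annulus between radii \<open>R0 + 3/2\<close> and \<open>R0 + 2\<close>
    the minimum already equals \<open>g\<close>, so the two descriptions overlap on an open set and
    every local property can be checked on one of them.\<close>
  define s where "s x = (if norm x < R0 + 2 then min (f x) (g x) else g x)" for x
  have s_far: "s x = g x" if "norm x \<ge> R0 + 3 / 2" for x
    using fg_far[of x] that by (auto simp: s_def A_def)
  have cfg: "continuous_on S f" "continuous_on S g" for S
    unfolding f_def g_def by (auto intro!: continuous_intros cw c\<phi>)
  have gsup: "strictly_superharmonic_at g x" for x
  proof -
    have "g = (\<lambda>x. (K * l powr - a) * bubble (1/2) x)" by (simp add: g_def w2_def fun_eq_iff)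
    then show ?thesis using bubble_superharmonic[OF D, of "1/2" "K * l powr - a" x] K(1) l by simp
  qed
  show thesis
  proof (rule that[OF K(1)])
    have "continuous_on (ball 0 (R0 + 2)) s"
      by (rule continuous_on_eq[of _ "\<lambda>x. min (f x) (g x)"]) (auto simp: s_def intro!: continuous_intros cfg)
    moreover have "continuous_on (- cball 0 (R0 + 3 / 2)) s"
      by (rule continuous_on_eq[OF cfg(2)]) (auto simp: s_far)
    ultimately have "continuous_on (ball 0 (R0 + 2) \<union> - cball 0 (R0 + 3 / 2)) s"
      by (intro continuous_on_open_Un) auto
    moreover have "ball 0 (R0 + 2) \<union> - cball 0 (R0 + 3 / 2) = (UNIV :: 'a set)" by auto
    ultimately show "continuous_on UNIV s" by simp
    show "\<exists>R. \<forall>x. norm x \<ge> R \<longrightarrow> \<bar>s x\<bar> \<le> e" if e: "e > 0" for e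
    proof -
      obtain R where R: "\<And>x::'a. norm x \<ge> R \<Longrightarrow> \<bar>(K * l powr - a) * bubble (1/2) x\<bar> \<le> e"
        using bubble_vanishes[OF D, of "1/2" e "K * l powr - a"] e by auto
      have "\<bar>s x\<bar> \<le> e" if "norm x \<ge> max R (R0 + 2)" for x
        using R[of x] s_far[of x] that by (simp add: g_def w2_def mult.assoc)
      then show ?thesis by blast
    qed
    show "s x = \<phi> x + K * bubble 1 x" if "x \<in> \<Omega>" for x
      using fg_near[of x] R0(2)[OF that] by (simp add: s_def f_def w1_def)
    show "strictly_superharmonic_at s x" for x
    proof (cases "norm x < R0 + 2")
      case True
      have le: "s y \<le> f y" "s y \<le> g y" if "dist y x < R0 + 2 - norm x" for y
      proof -
        have "norm y < R0 + 2" using norm_triangle_ineq2[of y x] that by (simp add: dist_norm)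
        then show "s y \<le> f y" "s y \<le> g y" by (simp_all add: s_def)
      qed
      consider "s x = f x" | "s x = g x" using True by (cases "f x \<le> g x") (simp_all add: s_def)
      then show ?thesis
      proof cases
        case 1
        have "strictly_superharmonic_at f x"
          using K0[OF K(4), of x] True by (simp add: f_def[abs_def] w1_def)
        then show ?thesis
          by (rule strictly_superharmonic_at_touching[where \<delta>="R0 + 2 - norm x"]) (use 1 True le in auto)
      next
        case 2
        show ?thesis
          by (rule strictly_superharmonic_at_touching[OF gsup, where \<delta>="R0 + 2 - norm x"]) (use 2 True le in auto)
      qed
    next
      case False
      have "s y \<le> g y" if "dist y x < 1 / 2" for y
      proof -
        have "norm y \<ge> R0 + 3 / 2" using norm_triangle_ineq2[of x y] that False by (simp add: dist_norm norm_minus_commute)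
        then show ?thesis by (simp add: s_far)
      qed
      then show ?thesis
        by (intro strictly_superharmonic_at_touching[OF gsup, where \<delta>="1/2"]) (use False s_far in auto)
    qed
  qed
qed

section \<open>The domination principle\<close>

definition trunc_kernel :: "real \<Rightarrow> 'a::euclidean_space \<Rightarrow> real" where
  "trunc_kernel r z = max ((norm z)\<^sup>2) r powr - kexp TYPE('a)"

lemma min_kernel:
  fixes x y :: "'a::euclidean_space"
  assumes D: "DIM('a) \<ge> 3" and r: "r > 0"
  shows "min (kernel x y) (ennreal (r powr - kexp TYPE('a))) = ennreal (trunc_kernel r (x - y))"
proof (cases "x = y")
  case True
  then show ?thesis using r by (simp add: kernel_diagonal[OF D] trunc_kernel_def max_def)
next
  case False
  then have p: "(norm (x - y))\<^sup>2 > 0" by simp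
  have a: "- kexp TYPE('a) \<le> 0" using kexp_pos[OF D] by simp
  show ?thesis
    unfolding kernel_eq_powr[OF D False] trunc_kernel_def
    using powr_mono2'[OF a p, of r] powr_mono2'[OF a r, of "(norm (x - y))\<^sup>2"]
    by (cases "(norm (x - y))\<^sup>2 \<le> r") (auto simp: max_def min_def)
qed

lemma trunc_kernel_bounds:
  assumes D: "DIM('a::euclidean_space) \<ge> 3" and r: "r > 0"
  shows "0 \<le> trunc_kernel r (z::'a)" "trunc_kernel r z \<le> r powr - kexp TYPE('a)"
  using kexp_pos[OF D] r by (auto simp: trunc_kernel_def intro!: powr_mono2')

lemma continuous_on_trunc_kernel:
  assumes "r > 0" shows "continuous_on S (trunc_kernel r)"
  unfolding trunc_kernel_def using assms by (intro continuous_intros) auto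

text \<open>The error of truncation. Subtraction of extended nonnegative reals is cut off at 0, so
  the integrand is the part of the kernel above the truncation level.\<close>

definition excess :: "'a::euclidean_space measure \<Rightarrow> real \<Rightarrow> 'a \<Rightarrow> ennreal" where
  "excess M r x = (\<integral>\<^sup>+y. kernel x y - ennreal (r powr - kexp TYPE('a)) \<partial>M)"

lemma measurable_excess:
  assumes M: "finite_borel M"
  shows "excess M r \<in> borel_measurable borel"
proof -
  interpret finite_measure M using M by (rule finite_borelD)
  have [simp, measurable_cong]: "sets M = sets borel" using M by (rule finite_borelD)
  show ?thesis unfolding excess_def[abs_def] by measurable
qed

lemma pot_split:
  fixes M :: "'a::euclidean_space measure"
  assumes D: "DIM('a) \<ge> 3" and M: "finite_borel M" and r: "r > 0"
  shows "pot M x = ennreal (\<integral>y. trunc_kernel r (x - y) \<partial>M) + excess M r x"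
proof -
  interpret finite_measure M using M by (rule finite_borelD)
  have [simp, measurable_cong]: "sets M = sets borel" using M by (rule finite_borelD)
  have [measurable]: "(\<lambda>y. trunc_kernel r (x - y)) \<in> borel_measurable borel"
    by (intro borel_measurable_continuous_onI continuous_on_compose2[OF continuous_on_trunc_kernel[OF r, of UNIV]]
        continuous_intros) auto
  have "integrable M (\<lambda>y. trunc_kernel r (x - y))"
    using trunc_kernel_bounds[OF D r]
    by (intro integrable_const_bound[where B="r powr - kexp TYPE('a)"]) auto
  then have "ennreal (\<integral>y. trunc_kernel r (x - y) \<partial>M) = (\<integral>\<^sup>+y. ennreal (trunc_kernel r (x - y)) \<partial>M)"
    using trunc_kernel_bounds[OF D r] by (intro nn_integral_eq_integral[symmetric]) auto
  moreover have "kernel x y = ennreal (trunc_kernel r (x - y)) + (kernel x y - ennreal (r powr - kexp TYPE('a)))" for y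
    unfolding min_kernel[OF D r, symmetric]
  proof (cases "kernel x y \<le> ennreal (r powr - kexp TYPE('a))")
    case True
    then have "kernel x y < top" using ennreal_less_top le_less_trans by blast
    with True show "kernel x y = min (kernel x y) (ennreal (r powr - kexp TYPE('a))) + (kernel x y - ennreal (r powr - kexp TYPE('a)))"
      by (simp add: min_def diff_eq_0_ennreal)
  qed (simp add: min_def add_diff_inverse_ennreal)
  then have "pot M x = (\<integral>\<^sup>+y. ennreal (trunc_kernel r (x - y)) + (kernel x y - ennreal (r powr - kexp TYPE('a))) \<partial>M)"
    unfolding pot_def by (intro nn_integral_cong) auto
  ultimately show ?thesis unfolding excess_def by (simp add: nn_integral_add)
qed

lemma continuous_trunc_potential:
  fixes M :: "'a::euclidean_space measure"
  assumes D: "DIM('a) \<ge> 3" and M: "finite_borel M" and r: "r > 0"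
  shows "continuous_on UNIV (\<lambda>x. \<integral>y. trunc_kernel r (x - y) \<partial>M)"
proof -
  interpret finite_measure M using M by (rule finite_borelD)
  have [simp, measurable_cong]: "sets M = sets borel" using M by (rule finite_borelD)
  have [measurable]: "(\<lambda>y. trunc_kernel r (x - y)) \<in> borel_measurable borel" for x :: 'a
    by (intro borel_measurable_continuous_onI continuous_on_compose2[OF continuous_on_trunc_kernel[OF r, of UNIV]]
        continuous_intros) auto
  show ?thesis
    unfolding continuous_on_sequentially
  proof (intro allI ballI impI)
    fix X :: "nat \<Rightarrow> 'a" and x assume X: "(\<forall>n. X n \<in> UNIV) \<and> X \<longlonglongrightarrow> x"
    have "(\<lambda>n. \<integral>y. trunc_kernel r (X n - y) \<partial>M) \<longlonglongrightarrow> (\<integral>y. trunc_kernel r (x - y) \<partial>M)"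
    proof (rule integral_dominated_convergence[where w="\<lambda>_. r powr - kexp TYPE('a)"])
      show "AE y in M. (\<lambda>n. trunc_kernel r (X n - y)) \<longlonglongrightarrow> trunc_kernel r (x - y)"
        using X by (intro AE_I2 continuous_on_tendsto_compose[OF continuous_on_trunc_kernel[OF r, of UNIV]] tendsto_intros) auto
      show "AE y in M. norm (trunc_kernel r (X n - y)) \<le> r powr - kexp TYPE('a)" for n
        using trunc_kernel_bounds[OF D r] by auto
    qed auto
    then show "((\<lambda>x. \<integral>y. trunc_kernel r (x - y) \<partial>M) \<circ> X) \<longlonglongrightarrow> (\<integral>y. trunc_kernel r (x - y) \<partial>M)"
      by (simp add: o_def)
  qed
qed

lemma continuous_on_uniform_approx:
  fixes u :: "'a::metric_space \<Rightarrow> real"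
  assumes "\<And>e. e > 0 \<Longrightarrow> \<exists>g. continuous_on UNIV g \<and> (\<forall>x. \<bar>u x - g x\<bar> \<le> e)"
  shows "continuous_on UNIV u"
  unfolding continuous_on_iff
proof (intro ballI allI impI)
  fix x and e :: real assume "e > 0"
  then obtain g where g: "continuous_on UNIV g" "\<And>x. \<bar>u x - g x\<bar> \<le> e / 3"
    using assms[of "e / 3"] by auto
  then obtain d where d: "d > 0" "\<And>y. dist y x < d \<Longrightarrow> dist (g y) (g x) < e / 3"
    using \<open>e > 0\<close> unfolding continuous_on_iff by (metis UNIV_I divide_pos_pos zero_less_numeral)
  have "dist (u y) (u x) < e" if "dist y x < d" for y
    using d(2)[OF that] g(2)[of x] g(2)[of y] unfolding dist_real_def by linarith
  with d(1) show "\<exists>d>0. \<forall>x'\<in>UNIV. dist x' x < d \<longrightarrow> dist (u x') (u x) < e" by blast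
qed

text \<open>A density rather than a restricted space, so that the result is again a measure on all
  Borel sets of the whole space.\<close>

definition restrict_to :: "'a measure \<Rightarrow> 'a set \<Rightarrow> 'a measure" where
  "restrict_to M K = density M (indicator K)"

lemma finite_borel_restrict_to:
  assumes M: "finite_borel M" and K: "K \<in> sets borel"
  shows "finite_borel (restrict_to M K)"
proof -
  interpret finite_measure M using M by (rule finite_borelD)
  have [simp]: "sets M = sets borel" "space M = UNIV" using M by (auto dest: finite_borelD)
  have "emeasure (restrict_to M K) UNIV = emeasure M K"
    using K unfolding restrict_to_def by (subst emeasure_density) (auto intro: borel_measurable_indicator)
  then show ?thesis using K
    by (auto simp: finite_borel_def restrict_to_def emeasure_eq_measure intro!: finite_measureI)
qed

lemma nn_integral_restrict_to:
  assumes M: "finite_borel M" and K: "K \<in> sets borel" and f: "f \<in> borel_measurable borel"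
  shows "(\<integral>\<^sup>+x. f x \<partial>restrict_to M K) = (\<integral>\<^sup>+x. indicator K x * f x \<partial>M)"
proof -
  have [simp, measurable_cong]: "sets M = sets borel" using M by (rule finite_borelD)
  show ?thesis unfolding restrict_to_def using K f by (subst nn_integral_density) auto
qed

lemma carried_by_restrict_to:
  assumes M: "finite_borel M" and K: "K \<in> sets borel"
  shows "carried_by (restrict_to M K) K"
proof -
  have [simp, measurable_cong]: "sets M = sets borel" using M by (rule finite_borelD)
  have "emeasure (restrict_to M K) (- K) = (\<integral>\<^sup>+x. 0 \<partial>M)"
    unfolding restrict_to_def using K
    by (subst emeasure_density) (auto intro!: nn_integral_cong simp: indicator_def simp flip: of_bool_conj)
  then show ?thesis by (simp add: carried_by_def)
qed

text \<open>The point of \<open>K\<close> nearest to \<open>x\<close> is at most twice as far from any other point of \<open>K\<close> as \<open>x\<close> is;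
  hence uniform smallness of the excess on \<open>K\<close> spreads to the whole space.\<close>

lemma continuity_principle:
  fixes M :: "'a::euclidean_space measure"
  assumes D: "DIM('a) \<ge> 3" and M: "finite_borel M" and K: "compact K"
    and unif: "\<And>e. e > 0 \<Longrightarrow> \<exists>r>0. \<forall>x\<in>K. excess M r x \<le> ennreal e"
  shows "\<exists>u. continuous_on UNIV u \<and> (\<forall>x. 0 \<le> u x \<and> pot (restrict_to M K) x = ennreal (u x))"
proof (cases "K = {}")
  case True
  have "pot (restrict_to M K) x = 0" for x
    using True finite_borelD(1)[OF M] unfolding pot_def restrict_to_def by (subst nn_integral_density) auto
  then show ?thesis by (intro exI[of _ "\<lambda>_. 0"]) auto
next
  case False
  define a where "a = kexp TYPE('a)"
  have a: "a > 0" using kexp_pos[OF D] by (simp add: a_def)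
  \<comment> \<open>Doubling a distance multiplies the squared distance by 4 and hence divides the
    kernel by \<open>4 powr a\<close>.\<close>
  define C where "C = 4 powr a"
  have C: "C > 0" by (simp add: C_def)
  have Kb: "K \<in> sets borel" using K by (simp add: borel_compact)
  have R: "finite_borel (restrict_to M K)" using M Kb by (rule finite_borel_restrict_to)
  have [simp, measurable_cong]: "sets M = sets borel" using M by (rule finite_borelD)
  have kle: "kernel x y \<le> ennreal C * kernel z y"
    if z: "z \<in> K" "\<And>y. y \<in> K \<Longrightarrow> dist x z \<le> dist x y" and y: "y \<in> K" for x y z
  proof (cases "z = y")
    case True
    then show ?thesis using C by (simp add: kernel_diagonal[OF D] ennreal_mult_top)
  next
    case ne: False
    then have "x \<noteq> y" using z(2)[OF y] by auto
    have "norm (z - y) \<le> 2 * norm (x - y)"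
      using z(2)[OF y] dist_triangle[of z y x] by (simp add: dist_norm norm_minus_commute)
    then have "(norm (z - y))\<^sup>2 \<le> (2 * norm (x - y))\<^sup>2" by (intro power_mono) auto
    then have "(4 * (norm (x - y))\<^sup>2) powr - a \<le> ((norm (z - y))\<^sup>2) powr - a"
      using a ne by (intro powr_mono2') (auto simp: power_mult_distrib)
    then have "C * ((4 * (norm (x - y))\<^sup>2) powr - a) \<le> C * ((norm (z - y))\<^sup>2) powr - a"
      using C by (intro mult_left_mono) auto
    moreover have "C * ((4 * (norm (x - y))\<^sup>2) powr - a) = ((norm (x - y))\<^sup>2) powr - a"
      unfolding C_def by (simp add: powr_mult powr_minus)
    ultimately show ?thesis
      using C by (simp add: kernel_eq_powr[OF D ne] kernel_eq_powr[OF D \<open>x \<noteq> y\<close>] a_def[symmetric]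
          ennreal_mult'[symmetric])
  qed
  have small: "\<exists>r>0. \<forall>x. excess (restrict_to M K) r x \<le> ennreal e" if e: "e > 0" for e
  proof -
    obtain r where r: "r > 0" "\<And>x. x \<in> K \<Longrightarrow> excess M r x \<le> ennreal (e / C)"
      using unif[of "e / C"] e C by auto
    \<comment> \<open>Replacing \<open>r\<close> by \<open>r / 4\<close> raises the truncation level
      by the same factor \<open>C\<close> that the kernel comparison loses, so the excesses compare
      with constant \<open>C\<close>.\<close>
    have rc: "(r / 4) powr - a = C * r powr - a"
      using r(1) by (simp add: C_def powr_divide powr_minus field_simps)
    have "excess (restrict_to M K) (r / 4) x \<le> ennreal e" for x
    proof -
      obtain z where z: "z \<in> K" "\<And>y. y \<in> K \<Longrightarrow> dist x z \<le> dist x y"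
        using distance_attains_inf[OF compact_imp_closed[OF K] False, of x] by blast
      have "excess (restrict_to M K) (r / 4) x = (\<integral>\<^sup>+y. indicator K y * (kernel x y - ennreal ((r / 4) powr - a)) \<partial>M)"
        unfolding excess_def a_def[symmetric] by (rule nn_integral_restrict_to[OF M Kb]) measurable
      also have "\<dots> \<le> (\<integral>\<^sup>+y. ennreal C * (kernel z y - ennreal (r powr - a)) \<partial>M)"
      proof (rule nn_integral_mono)
        fix y
        show "indicator K y * (kernel x y - ennreal ((r / 4) powr - a)) \<le> ennreal C * (kernel z y - ennreal (r powr - a))"
        proof (cases "y \<in> K")
          case True
          have "kernel x y - ennreal ((r / 4) powr - a) \<le> ennreal C * kernel z y - ennreal C * ennreal (r powr - a)"
            unfolding rc using C by (subst ennreal_mult') (auto intro!: ennreal_minus_mono kle[OF z True])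
          also have "\<dots> = ennreal C * (kernel z y - ennreal (r powr - a))"
            by (simp add: ennreal_right_diff_distrib)
          finally show ?thesis using True by simp
        qed simp
      qed
      also have "\<dots> = ennreal C * excess M r z"
        unfolding excess_def a_def[symmetric] by (rule nn_integral_cmult) measurable
      also have "\<dots> \<le> ennreal C * ennreal (e / C)" using r(2)[OF z(1)] by (intro mult_left_mono) auto
      also have "\<dots> = ennreal e" using C e by (simp add: ennreal_mult'[symmetric])
      finally show ?thesis .
    qed
    then show ?thesis using r(1) by (intro exI[of _ "r / 4"]) auto
  qed
  define u where "u x = enn2real (pot (restrict_to M K) x)" for x
  have fin: "pot (restrict_to M K) x < \<infinity>" for x
  proof -
    obtain r where r: "r > 0" "excess (restrict_to M K) r x \<le> ennreal 1" using small[of 1] by auto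
    show ?thesis unfolding pot_split[OF D R r(1)] using r(2) by (auto simp: less_top[symmetric] top_unique)
  qed
  have "continuous_on UNIV u"
  proof (rule continuous_on_uniform_approx)
    fix e :: real assume e: "e > 0"
    obtain r where r: "r > 0" "\<And>x. excess (restrict_to M K) r x \<le> ennreal e" using small[OF e] by auto
    define g where "g x = (\<integral>y. trunc_kernel r (x - y) \<partial>restrict_to M K)" for x
    have "\<bar>u x - g x\<bar> \<le> e" for x
    proof -
      obtain t where t: "excess (restrict_to M K) r x = ennreal t" "0 \<le> t" "t \<le> e"
        using r(2)[of x] e by (cases "excess (restrict_to M K) r x") (auto simp: top_unique)
      have "g x \<ge> 0" unfolding g_def using trunc_kernel_bounds[OF D r(1)] by (intro integral_nonneg_AE) auto
      then have "pot (restrict_to M K) x = ennreal (g x + t)"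
        unfolding pot_split[OF D R r(1)] t(1) g_def[symmetric] using t(2) by simp
      then have "u x = g x + t" using t \<open>g x \<ge> 0\<close> by (simp only: u_def enn2real_ennreal add_nonneg_nonneg)
      then show ?thesis using t by simp
    qed
    then show "\<exists>g. continuous_on UNIV g \<and> (\<forall>x. \<bar>u x - g x\<bar> \<le> e)"
      using continuous_trunc_potential[OF D R r(1)] by (intro exI[of _ g]) (auto simp: g_def[abs_def])
  qed
  then show ?thesis using fin by (intro exI[of _ u]) (auto simp: u_def less_top)
qed

lemma potential_vanishes:
  fixes M :: "'a::euclidean_space measure"
  assumes D: "DIM('a) \<ge> 3" and M: "finite_borel M" and K: "compact K" "carried_by M K" and e: "e > 0"
  shows "\<exists>R. \<forall>x. norm x \<ge> R \<longrightarrow> pot M x \<le> ennreal e"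
proof -
  interpret finite_measure M using M by (rule finite_borelD)
  define a where "a = kexp TYPE('a)"
  have a: "a > 0" using kexp_pos[OF D] by (simp add: a_def)
  obtain B where B: "\<And>x. x \<in> K \<Longrightarrow> norm x \<le> B" "B > 0"
    using compact_imp_bounded[OF K(1)] by (auto simp: bounded_pos)
  have "((\<lambda>r. measure M UNIV * (r\<^sup>2) powr - a) \<longlongrightarrow> measure M UNIV * 0) at_top"
  proof (intro tendsto_mult_left tendsto_neg_powr)
    show "- a < 0" using a by simp
    show "filterlim (\<lambda>r::real. r\<^sup>2) at_top at_top" by real_asymp
  qed
  then have "\<forall>\<^sub>F r in at_top. measure M UNIV * (r\<^sup>2) powr - a < e \<and> r > 0"
    using e by (auto dest: order_tendstoD(2) intro: eventually_conj eventually_gt_at_top)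
  then obtain T where T: "measure M UNIV * (T\<^sup>2) powr - a < e" "T > 0"
    by (auto simp: eventually_at_top_linorder)
  have "pot M x \<le> ennreal e" if x: "norm x \<ge> B + T" for x
  proof -
    have "pot M x \<le> (\<integral>\<^sup>+y. ennreal ((T\<^sup>2) powr - a) \<partial>M)"
      unfolding pot_def
    proof (rule nn_integral_mono_AE)
      show "AE y in M. kernel x y \<le> ennreal ((T\<^sup>2) powr - a)"
        using AE_carried_by[OF M compact_imp_closed[OF K(1)] K(2)]
      proof eventually_elim
        case (elim y)
        have "norm (x - y) \<ge> T" using norm_triangle_ineq2[of x y] x B(1)[OF elim] by linarith
        then have "x \<noteq> y" "T\<^sup>2 \<le> (norm (x - y))\<^sup>2" using T by (auto intro: power_mono)
        then show ?case using a T(2)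
          by (auto simp: kernel_eq_powr[OF D \<open>x \<noteq> y\<close>] a_def[symmetric] intro!: ennreal_leI powr_mono2')
      qed
    qed
    also have "\<dots> = ennreal (measure M UNIV * (T\<^sup>2) powr - a)"
      using finite_borelD(3)[OF M] by (simp add: emeasure_eq_measure ennreal_mult'' mult.commute)
    also have "\<dots> \<le> ennreal e" using T by (intro ennreal_leI) auto
    finally show ?thesis .
  qed
  then show ?thesis by blast
qed

text \<open>Near \<open>x\<close> the potential is an integral of translates of
  \<open>bubble 0\<close>, with singularities on \<open>K\<close> at distance at least
  \<open>\<delta>\<close> from \<open>x\<close>. The uniform cubic estimate for their second
  differences is integrated against the finite measure \<open>M\<close>.\<close>

lemma potential_harmonic:
  fixes M :: "'a::euclidean_space measure"
  assumes D: "DIM('a) \<ge> 3" and M: "finite_borel M" and K: "compact K" "carried_by M K"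
    and u: "\<And>x. 0 \<le> u x" "\<And>x. pot M x = ennreal (u x)" and x: "x \<notin> K" and e: "e > 0"
  shows "\<forall>\<^sub>F h in at_right 0. \<bar>second_diff u x h\<bar> \<le> e * h\<^sup>2"
proof -
  interpret finite_measure M using M by (rule finite_borelD)
  have [simp, measurable_cong]: "sets M = sets borel" using M by (rule finite_borelD)
  have [simp]: "space M = UNIV" using M by (rule finite_borelD)
  have AEK: "AE y in M. y \<in> K" by (rule AE_carried_by[OF M compact_imp_closed[OF K(1)] K(2)])
  have "open (- K)" using compact_imp_closed[OF K(1)] by auto
  then obtain \<delta> where \<delta>: "\<delta> > 0" "ball x \<delta> \<subseteq> - K" using x by (metis ComplI open_contains_ball)
  obtain B where B: "\<And>y. y \<in> K \<Longrightarrow> norm y \<le> B" "B > 0"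
    using compact_imp_bounded[OF K(1)] by (auto simp: bounded_pos)
  define R where "R = norm x + B"
  define m where "m = measure M UNIV"
  have [measurable]: "(\<lambda>y. bubble 0 (z - y)) \<in> borel_measurable borel" for z :: 'a
    unfolding bubble_def by measurable
  have rep: "integrable M (\<lambda>y. bubble 0 (z - y))" "u z = (\<integral>y. bubble 0 (z - y) \<partial>M)" if z: "z \<notin> K" for z
  proof -
    have nn: "ennreal (u z) = (\<integral>\<^sup>+y. ennreal (bubble 0 (z - y)) \<partial>M)"
      unfolding u(2)[symmetric] pot_def
    proof (rule nn_integral_cong_AE)
      show "AE y in M. kernel z y = ennreal (bubble 0 (z - y))"
        using AEK
      proof eventually_elim
        case (elim y)
        then have "z \<noteq> y" using z by auto
        then show ?case by (simp add: kernel_eq_powr[OF D] bubble_def)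
      qed
    qed
    show "integrable M (\<lambda>y. bubble 0 (z - y))"
      by (rule integrableI_nn_integral_finite[OF _ _ nn[symmetric]]) (auto simp: u bubble_def)
    show "u z = (\<integral>y. bubble 0 (z - y) \<partial>M)"
      by (subst integral_eq_nn_integral) (auto simp: nn[symmetric] u, simp add: bubble_def)
  qed
  \<comment> \<open>With \<open>c = 0\<close> the quadratic main term disappears. The lower bound
    \<open>2 * \<rho>\<close> on the squared norm is \<open>\<delta>\<^sup>2\<close>, and
    \<open>R\<close> bounds the distance from \<open>x\<close> to points of
    \<open>K\<close>.\<close>
  obtain C where C: "C \<ge> 0" "\<forall>(z::'a) h. 0 + (norm z)\<^sup>2 \<ge> 2 * (\<delta>\<^sup>2 / 2) \<longrightarrow> norm z \<le> R \<longrightarrow> 0 < h \<longrightarrow> h \<le> 1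
      \<longrightarrow> h * (1 + 2 * R) \<le> \<delta>\<^sup>2 / 2
    \<longrightarrow> \<bar>second_diff (bubble 0) z h + 4 * kexp TYPE('a) * (kexp TYPE('a) + 1) * 0 * (0 + (norm z)\<^sup>2) powr (- kexp TYPE('a) - 2) * h\<^sup>2\<bar> \<le> C * h ^ 3"
    using bubble_second_diff[OF D, of "\<delta>\<^sup>2 / 2" R 0] \<delta>(1) B(2) by (auto simp: R_def)
  have R1: "1 + 2 * R > 0" using B(2) by (simp add: R_def add_pos_nonneg)
  \<comment> \<open>Steps below \<open>\<delta>\<close> stay off \<open>K\<close>; the last bound
    absorbs the total error \<open>C * m * h ^ 3\<close> into \<open>e * h\<^sup>2\<close>.\<close>
  define \<eta> where "\<eta> = min (min 1 \<delta>) (min (\<delta>\<^sup>2 / 2 / (1 + 2 * R)) (e / (C * m + 1)))"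
  have m0: "m \<ge> 0" by (simp add: m_def)
  have Cm: "C * m + 1 > 0" using C(1) m0 by (simp add: add_nonneg_pos)
  have "\<eta> > 0" using \<delta>(1) R1 Cm e by (simp add: \<eta>_def)
  then have "\<forall>\<^sub>F h in at_right 0. h \<in> {0<..<\<eta>}" by (rule eventually_at_right_real)
  then show ?thesis
  proof eventually_elim
    case (elim h)
    then have h: "0 < h" "h \<le> 1" "h < \<delta>" "h < \<delta>\<^sup>2 / 2 / (1 + 2 * R)" "h < e / (C * m + 1)" by (auto simp: \<eta>_def)
    have hR: "h * (1 + 2 * R) \<le> \<delta>\<^sup>2 / 2" using h(4) R1 by (simp add: field_simps)
    have out: "x + h *\<^sub>R b \<notin> K" "x - h *\<^sub>R b \<notin> K" if "b \<in> Basis" for b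
    proof -
      have "x + h *\<^sub>R b \<in> ball x \<delta>" "x - h *\<^sub>R b \<in> ball x \<delta>" using h that by (auto simp: dist_norm)
      then show "x + h *\<^sub>R b \<notin> K" "x - h *\<^sub>R b \<notin> K" using \<delta>(2) by blast+
    qed
    have eq: "(\<lambda>y. second_diff (bubble 0) (x - y) h) = (\<lambda>y. \<Sum>b\<in>Basis. bubble 0 ((x + h *\<^sub>R b) - y)
        + bubble 0 ((x - h *\<^sub>R b) - y) - 2 * bubble 0 (x - y))"
      by (simp add: second_diff_def algebra_simps)
    have int: "integrable M (\<lambda>y. bubble 0 ((x + h *\<^sub>R b) - y) + bubble 0 ((x - h *\<^sub>R b) - y) - 2 * bubble 0 (x - y))"
      if "b \<in> Basis" for b
      by (intro Bochner_Integration.integrable_diff Bochner_Integration.integrable_add integrable_mult_right rep out that x)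
    have "second_diff u x h = (\<Sum>b\<in>Basis. \<integral>y. bubble 0 ((x + h *\<^sub>R b) - y)
        + bubble 0 ((x - h *\<^sub>R b) - y) - 2 * bubble 0 (x - y) \<partial>M)"
      unfolding second_diff_def
    proof (rule sum.cong[OF refl])
      fix b :: 'a assume b: "b \<in> Basis"
      note r = rep(1)[OF out(1)[OF b]] rep(1)[OF out(2)[OF b]] rep(1)[OF x]
      show "u (x + h *\<^sub>R b) + u (x - h *\<^sub>R b) - 2 * u x = (\<integral>y. bubble 0 ((x + h *\<^sub>R b) - y)
        + bubble 0 ((x - h *\<^sub>R b) - y) - 2 * bubble 0 (x - y) \<partial>M)"
        unfolding rep(2)[OF out(1)[OF b]] rep(2)[OF out(2)[OF b]] rep(2)[OF x] using r by simp
    qed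
    also have "\<dots> = (\<integral>y. second_diff (bubble 0) (x - y) h \<partial>M)"
      unfolding eq by (rule Bochner_Integration.integral_sum[symmetric]) (rule int)
    finally have sd: "second_diff u x h = (\<integral>y. second_diff (bubble 0) (x - y) h \<partial>M)" .
    have "AE y in M. \<bar>second_diff (bubble 0) (x - y) h\<bar> \<le> C * h ^ 3"
      using AEK
    proof eventually_elim
      case (elim y)
      have "y \<notin> ball x \<delta>" using elim \<delta>(2) by auto
      then have "norm (x - y) \<ge> \<delta>" by (simp add: dist_norm)
      then have "(norm (x - y))\<^sup>2 \<ge> \<delta>\<^sup>2" using \<delta>(1) by (intro power_mono) auto
      moreover have "norm (x - y) \<le> R" using norm_triangle_ineq4[of x y] B(1)[OF elim] by (simp add: R_def)
      ultimately show ?case using C(2)[rule_format, of "x - y" h] h hR by simp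
    qed
    moreover have "integrable M (\<lambda>y. second_diff (bubble 0) (x - y) h)"
      unfolding eq by (rule Bochner_Integration.integrable_sum) (rule int)
    ultimately have "(\<integral>y. \<bar>second_diff (bubble 0) (x - y) h\<bar> \<partial>M) \<le> (\<integral>y. C * h ^ 3 \<partial>M)"
      by (intro integral_mono_AE) auto
    also have "\<dots> = (C * m * h) * h\<^sup>2" by (simp add: m_def power3_eq_cube power2_eq_square mult_ac)
    also have "\<dots> \<le> e * h\<^sup>2"
    proof (rule mult_right_mono)
      have "h * (C * m + 1) < e" using h(5) Cm by (simp add: field_simps)
      then show "C * m * h \<le> e" using h(1) by (simp add: algebra_simps)
    qed simp
    finally show ?case
      unfolding sd using integral_abs_bound[of M "\<lambda>y. second_diff (bubble 0) (x - y) h"] by linarith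
  qed
qed

section \<open>Exhaustion by compact sets and domination\<close>

lemma egorov_tail:
  fixes T :: "nat \<Rightarrow> 'a \<Rightarrow> ennreal"
  assumes "finite_measure M" and T: "\<And>n. T n \<in> borel_measurable M"
    and mono: "\<And>m n x. m \<le> n \<Longrightarrow> T n x \<le> T m x"
    and lim: "AE x in M. (\<lambda>n. T n x) \<longlonglongrightarrow> 0" and \<delta>: "\<delta> > 0"
  shows "\<exists>A\<in>sets M. measure M (space M - A) \<le> \<delta> \<and> (\<forall>e>0. \<exists>n. \<forall>x\<in>A. T n x \<le> ennreal e)"
proof -
  interpret finite_measure M by fact
  note [measurable] = T
  \<comment> \<open>For fixed \<open>m\<close> these sets decrease in \<open>n\<close> to a null
    set. Choosing \<open>N m\<close> so that the \<open>m\<close>-th one has measure below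
    \<open>\<delta> / 2 ^ Suc m\<close> leaves a union of measure at most
    \<open>\<delta>\<close>.\<close>
  define B where "B m n = {x \<in> space M. T n x > ennreal (1 / Suc m)}" for m n
  have Bs [measurable]: "B m n \<in> sets M" for m n unfolding B_def by measurable
  have "(\<lambda>n. measure M (B m n)) \<longlonglongrightarrow> measure M (\<Inter>n. B m n)" for m
  proof (rule finite_Lim_measure_decseq)
    show "decseq (B m)" unfolding decseq_def B_def using mono by (auto intro: less_le_trans)
  qed auto
  moreover have "measure M (\<Inter>n. B m n) = 0" for m
  proof -
    have "AE x in M. x \<notin> (\<Inter>n. B m n)"
      using lim
    proof eventually_elim
      case (elim x)
      then have "\<forall>\<^sub>F n in sequentially. T n x < ennreal (1 / Suc m)"
        by (intro order_tendstoD(2)) auto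
      then obtain n where "T n x < ennreal (1 / Suc m)" by (auto simp: eventually_sequentially)
      then have "x \<notin> B m n" by (auto simp: B_def)
      then show ?case by auto
    qed
    then have "(\<Inter>n. B m n) \<in> null_sets M" by (subst AE_iff_null_sets) auto
    then show ?thesis by (simp add: measure_eq_0_null_sets)
  qed
  ultimately have "\<exists>n. measure M (B m n) < \<delta> * (1 / 2) ^ Suc m" for m
    using order_tendstoD(2)[of "\<lambda>n. measure M (B m n)" 0 sequentially "\<delta> * (1 / 2) ^ Suc m"] \<delta>
    by (force simp: eventually_sequentially)
  then obtain N where N: "\<And>m. measure M (B m (N m)) < \<delta> * (1 / 2) ^ Suc m" by metis
  define A where "A = space M - (\<Union>m. B m (N m))"
  have geo: "(\<lambda>m. \<delta> * (1 / 2) ^ Suc m) sums \<delta>"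
    using sums_mult[OF power_half_series, of \<delta>] by simp
  have summ: "summable (\<lambda>m. measure M (B m (N m)))"
    by (rule summable_comparison_test'[OF sums_summable[OF geo], of 0]) (use N in \<open>auto intro: less_imp_le\<close>)
  have "measure M (\<Union>m. B m (N m)) \<le> (\<Sum>m. measure M (B m (N m)))"
    by (rule finite_measure_subadditive_countably[OF _ summ]) auto
  also have "\<dots> \<le> (\<Sum>m. \<delta> * (1 / 2) ^ Suc m)"
    by (rule suminf_le[OF less_imp_le[OF N] summ sums_summable[OF geo]])
  also have "\<dots> = \<delta>" using geo by (rule sums_unique[symmetric])
  finally have "measure M (\<Union>m. B m (N m)) \<le> \<delta>" .
  moreover have "space M - A = (\<Union>m. B m (N m))" using sets.sets_into_space[OF Bs] by (auto simp: A_def)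
  moreover have "\<exists>n. \<forall>x\<in>A. T n x \<le> ennreal e" if e: "e > 0" for e
  proof -
    obtain m where "1 / Suc m < e" using nat_approx_posE[OF e] by auto
    moreover have "T (N m) x \<le> ennreal (1 / Suc m)" if "x \<in> A" for x
      using that by (force simp: A_def B_def not_less)
    ultimately show ?thesis by (meson ennreal_leI less_imp_le order_trans)
  qed
  moreover have "A \<in> sets M" unfolding A_def by measurable
  ultimately show ?thesis by (intro bexI[of _ A]) auto
qed

lemma inner_regular_compact:
  fixes M :: "'a::euclidean_space measure"
  assumes M: "finite_borel M" and A: "A \<in> sets borel" and e: "e > 0"
  obtains K where "compact K" "K \<subseteq> A" "measure M (A - K) \<le> e"
proof -
  interpret finite_measure M using M by (rule finite_borelD)
  have s: "sets M = sets borel" "space M = UNIV" using M by (auto dest: finite_borelD)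
  have "emeasure M A = (SUP K \<in> {K. K \<subseteq> A \<and> compact K}. emeasure M K)"
    by (rule inner_regular) (use s A in auto)
  moreover have "{K. K \<subseteq> A \<and> compact K} \<noteq> {}" by (metis (mono_tags) compact_empty empty_subsetI mem_Collect_eq empty_iff)
  moreover have "emeasure M A \<noteq> \<infinity>" by simp
  ultimately have "\<exists>K\<in>{K. K \<subseteq> A \<and> compact K}. emeasure M A < emeasure M K + ennreal e"
    by (intro SUP_approx_ennreal[OF e])
  then obtain K where K: "K \<subseteq> A" "compact K" "emeasure M A < emeasure M K + ennreal e"
    by auto
  have Ks: "K \<in> sets M" using K(2) s by (simp add: borel_compact)
  have "measure M A < measure M K + e"
    using K(3) e by (simp add: emeasure_eq_measure ennreal_plus[symmetric] ennreal_less_iff del: ennreal_plus)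
  then have "measure M (A - K) \<le> e" using K(1) Ks A s by (subst finite_measure_Diff) auto
  with K that show thesis by blast
qed

text \<open>Almost every value of the kernel is finite, so the truncation level eventually exceeds
  it; the kernel itself, integrable because the potential is finite, dominates.\<close>

lemma excess_tendsto_0:
  fixes M :: "'a::euclidean_space measure"
  assumes D: "DIM('a) \<ge> 3" and M: "finite_borel M" and fin: "pot M x < \<infinity>"
  shows "(\<lambda>n. excess M (1 / Suc n) x) \<longlonglongrightarrow> 0"
proof -
  have [simp, measurable_cong]: "sets M = sets borel" using M by (rule finite_borelD)
  define a where "a = kexp TYPE('a)"
  have a: "a > 0" using kexp_pos[OF D] by (simp add: a_def)
  have c: "(1 / Suc n) powr - a = (Suc n) powr a" for n
    by (simp add: powr_divide powr_minus)
  have "(\<lambda>n. excess M (1 / Suc n) x) \<longlonglongrightarrow> (\<integral>\<^sup>+y. 0 \<partial>M)"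
    unfolding excess_def a_def[symmetric]
  proof (rule nn_integral_dominated_convergence[where w="kernel x"])
    show "integral\<^sup>N M (kernel x) < \<infinity>" using fin by (simp add: pot_def)
    have "AE y in M. kernel x y \<noteq> \<infinity>"
      using fin by (intro nn_integral_PInf_AE) (auto simp: pot_def)
    then show "AE y in M. (\<lambda>n. kernel x y - ennreal ((1 / Suc n) powr - a)) \<longlonglongrightarrow> 0"
    proof eventually_elim
      case (elim y)
      then obtain t where t: "kernel x y = ennreal t" "t \<ge> 0" by (cases "kernel x y") auto
      have "filterlim (\<lambda>n. real (Suc n) powr a) at_top sequentially"
        using a by real_asymp
      then have "\<forall>\<^sub>F n in sequentially. real (Suc n) powr a \<ge> t" by (simp add: filterlim_at_top)
      then have "\<forall>\<^sub>F n in sequentially. kernel x y - ennreal ((1 / Suc n) powr - a) = 0"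
        by eventually_elim (simp only: t c, simp add: ennreal_minus ennreal_neg)
      then show ?case by (rule tendsto_eventually)
    qed
    show "AE y in M. kernel x y - ennreal ((1 / Suc n) powr - a) \<le> kernel x y" for n
      by (auto intro: diff_le_self_ennreal)
  qed auto
  then show ?thesis by simp
qed

text \<open>By Egorov's theorem and regularity, \<open>M\<close> is exhausted by restrictions to compact sets \<open>K\<close> whose
  potentials are continuous. Such a potential minus \<open>s\<close> cannot have a positive maximum off \<open>K\<close>.\<close>

theorem domination_principle:
  fixes M :: "'a::euclidean_space measure"
  assumes D: "DIM('a) \<ge> 3" and M: "finite_borel M"
    and s: "continuous_on UNIV s" "\<And>e. e > 0 \<Longrightarrow> \<exists>R. \<forall>x. norm x \<ge> R \<longrightarrow> \<bar>s x\<bar> \<le> e"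
      "\<And>x. strictly_superharmonic_at s x"
    and le: "AE x in M. pot M x \<le> ennreal (s x)"
  shows "pot M x \<le> ennreal (s x)"
proof -
  interpret finite_measure M using M by (rule finite_borelD)
  have [simp, measurable_cong]: "sets M = sets borel" using M by (rule finite_borelD)
  have [simp]: "space M = UNIV" using M by (rule finite_borelD)
  define a where "a = kexp TYPE('a)"
  have a: "a > 0" using kexp_pos[OF D] by (simp add: a_def)
  note [measurable] = measurable_pot[OF M] measurable_excess[OF M] borel_measurable_continuous_onI[OF s(1)]
  note s0 = strictly_superharmonic_nonneg[OF s]
  have exm: "excess M (1 / Suc n) x \<le> excess M (1 / Suc m) x" if "m \<le> n" for m n x
    unfolding excess_def a_def[symmetric] using that a
    by (intro nn_integral_mono ennreal_minus_mono ennreal_leI powr_mono2') (auto simp: field_simps)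
  have "\<exists>K. compact K \<and> measure M (- K) \<le> \<delta> \<and> (\<forall>x. pot (restrict_to M K) x \<le> ennreal (s x))"
    if \<delta>: "\<delta> > 0" for \<delta>
  proof -
    have "AE x in M. (\<lambda>n. excess M (1 / Suc n) x) \<longlonglongrightarrow> 0"
      using le
    proof eventually_elim
      case (elim x)
      then have "pot M x < \<infinity>" using ennreal_less_top[of "s x"] by (metis infinity_ennreal_def le_less_trans)
      then show ?case by (rule excess_tendsto_0[OF D M])
    qed
    then obtain A where A: "A \<in> sets M" "measure M (space M - A) \<le> \<delta> / 2"
      "\<And>e. e > 0 \<Longrightarrow> \<exists>n. \<forall>x\<in>A. excess M (1 / Suc n) x \<le> ennreal e"
      using egorov_tail[of M "\<lambda>n. excess M (1 / Suc n)" "\<delta> / 2"] exm \<delta> finite_measure_axioms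
        measurable_excess[OF M] by (auto cong: measurable_cong_sets)
    \<comment> \<open>Intersecting with this set of full measure turns the almost-everywhere bound
      into a bound at every point of \<open>K\<close>, as the maximum principle demands.\<close>
    define A' where "A' = A \<inter> {x. pot M x \<le> ennreal (s x)}"
    have [measurable]: "A \<in> sets borel" using A(1) by simp
    have A': "A' \<in> sets borel" unfolding A'_def by measurable
    have mA': "measure M (- A') \<le> \<delta> / 2"
    proof -
      have "measure M (- A') = measure M (- A)"
        unfolding A'_def using le by (intro measure_eq_AE) (auto elim!: eventually_mono)
      then show ?thesis using A(2) by (simp add: Compl_eq_Diff_UNIV)
    qed
    obtain K where K: "compact K" "K \<subseteq> A'" "measure M (A' - K) \<le> \<delta> / 2"
      using inner_regular_compact[OF M A', of "\<delta> / 2"] \<delta> by auto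
    have Kb [measurable]: "K \<in> sets borel" using K(1) by (simp add: borel_compact)
    have "- K = - A' \<union> (A' - K)" using K(2) by auto
    then have "measure M (- K) \<le> measure M (- A') + measure M (A' - K)"
      using A' Kb by (simp only:) (intro measure_Un_le, auto)
    with mA' K(3) have mK: "measure M (- K) \<le> \<delta>" by linarith
    have unif: "\<exists>r>0. \<forall>x\<in>K. excess M r x \<le> ennreal e" if e: "e > 0" for e
    proof -
      obtain n where "\<forall>x\<in>A. excess M (1 / Suc n) x \<le> ennreal e" using A(3)[OF e] by blast
      then show ?thesis using K(2) by (intro exI[of _ "1 / Suc n"]) (auto simp: A'_def)
    qed
    obtain u where u: "continuous_on UNIV u" "\<And>x. 0 \<le> u x" "\<And>x. pot (restrict_to M K) x = ennreal (u x)"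
      using continuity_principle[OF D M K(1) unif] by blast
    have R: "finite_borel (restrict_to M K)" using M Kb by (rule finite_borel_restrict_to)
    have RK: "carried_by (restrict_to M K) K" using M Kb by (rule carried_by_restrict_to)
    have "u x \<le> s x" for x
    proof (rule maximum_principle[OF u(1) s(1), of K])
      fix e :: real assume e: "e > 0"
      obtain R1 where R1: "\<And>x. norm x \<ge> R1 \<Longrightarrow> pot (restrict_to M K) x \<le> ennreal e"
        using potential_vanishes[OF D R K(1) RK e] by blast
      have "u x - s x \<le> e" if "norm x \<ge> R1" for x
        using R1[OF that] s0[of x] e by (simp add: u(3))
      then show "\<exists>R. \<forall>x. norm x \<ge> R \<longrightarrow> u x - s x \<le> e" by blast
    next
      fix x assume "x \<in> K"
      have "pot (restrict_to M K) x \<le> pot M x"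
        unfolding pot_def by (subst nn_integral_restrict_to[OF M Kb]) (auto intro!: nn_integral_mono simp: indicator_def)
      also have "\<dots> \<le> ennreal (s x)" using \<open>x \<in> K\<close> K(2) by (auto simp: A'_def)
      finally show "u x \<le> s x" using s0[of x] by (simp add: u(3))
    qed (use potential_harmonic[OF D R K(1) RK u(2,3)] s(3) in auto)
    then have "\<forall>x. pot (restrict_to M K) x \<le> ennreal (s x)" by (auto simp: u(3) intro: ennreal_leI)
    with K(1) mK show ?thesis by blast
  qed
  then have "\<exists>K. compact K \<and> measure M (- K) \<le> (1 / 2) ^ n \<and> (\<forall>x. pot (restrict_to M K) x \<le> ennreal (s x))" for n
    by simp
  then obtain K where K: "\<And>n. compact (K n)" "\<And>n. measure M (- K n) \<le> (1 / 2) ^ n"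
    "\<And>n x. pot (restrict_to M (K n)) x \<le> ennreal (s x)"
    by metis
  have Kb [measurable]: "K n \<in> sets borel" for n using K(1) by (simp add: borel_compact)
  \<comment> \<open>The sets \<open>K n\<close> need not be nested. By Borel-Cantelli almost every
    point lies in all but finitely many of them, so Fatou's lemma passes the bound from the
    restricted potentials to that of \<open>M\<close>.\<close>
  have "AE y in M. \<forall>\<^sub>F n in sequentially. y \<in> space M - (- K n)"
  proof (rule borel_cantelli_AE1)
    show "summable (\<lambda>n. measure M (- K n))"
      by (rule summable_comparison_test'[of "\<lambda>n. (1 / 2) ^ n" 0]) (use K(2) in auto)
  qed (auto simp: less_top[symmetric])
  then have "AE y in M. kernel x y = liminf (\<lambda>n. indicator (K n) y * kernel x y)"
  proof eventually_elim
    case (elim y)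
    then have "\<forall>\<^sub>F n in sequentially. indicator (K n) y * kernel x y = kernel x y"
      by eventually_elim simp
    then have "(\<lambda>n. indicator (K n) y * kernel x y) \<longlonglongrightarrow> kernel x y" by (rule tendsto_eventually)
    then show ?case by (intro lim_imp_Liminf[symmetric]) auto
  qed
  then have "pot M x = (\<integral>\<^sup>+y. liminf (\<lambda>n. indicator (K n) y * kernel x y) \<partial>M)"
    unfolding pot_def by (rule nn_integral_cong_AE)
  also have "\<dots> \<le> liminf (\<lambda>n. \<integral>\<^sup>+y. indicator (K n) y * kernel x y \<partial>M)"
    by (rule nn_integral_liminf) measurable
  also have "\<dots> = liminf (\<lambda>n. pot (restrict_to M (K n)) x)"
    unfolding pot_def by (subst nn_integral_restrict_to[OF M Kb]) auto
  also have "\<dots> \<le> limsup (\<lambda>n. pot (restrict_to M (K n)) x)" by (rule Liminf_le_Limsup) auto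
  also have "\<dots> \<le> ennreal (s x)" using K(3) by (intro Limsup_bounded) auto
  finally show ?thesis .
qed

section \<open>The obstacle problem\<close>

definition lin :: "real \<Rightarrow> 'a::topological_space measure \<Rightarrow> real \<Rightarrow> 'a measure \<Rightarrow> 'a measure" where
  "lin c M d N = measure_of UNIV (sets borel) (\<lambda>A. ennreal c * emeasure M A + ennreal d * emeasure N A)"

lemma sets_lin [simp, measurable_cong]: "sets (lin c M d N) = sets borel"
  and space_lin [simp]: "space (lin c M d N) = UNIV"
  using sets.sigma_sets_eq[of "borel :: 'a::topological_space measure"]
  by (simp_all add: lin_def sets_measure_of_conv space_measure_of_conv)

lemma emeasure_lin:
  assumes "sets M = sets borel" "sets N = sets borel" and A: "A \<in> sets borel"
  shows "emeasure (lin c M d N) A = ennreal c * emeasure M A + ennreal d * emeasure N A"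
proof (rule emeasure_measure_of[OF lin_def])
  show "countably_additive (sets (lin c M d N)) (\<lambda>A. ennreal c * emeasure M A + ennreal d * emeasure N A)"
    unfolding countably_additive_def using assms(1,2)
    by (auto simp: suminf_add[symmetric] suminf_emeasure ennreal_suminf_cmult)
qed (use A in \<open>auto simp: positive_def\<close>)

lemma nn_integral_lin:
  assumes M: "sets M = sets borel" and N: "sets N = sets borel" and f: "f \<in> borel_measurable borel"
  shows "(\<integral>\<^sup>+x. f x \<partial>lin c M d N) = ennreal c * (\<integral>\<^sup>+x. f x \<partial>M) + ennreal d * (\<integral>\<^sup>+x. f x \<partial>N)"
  using f
proof (induction rule: borel_measurable_induct)
  case (cong f g)
  then show ?case by (simp cong: nn_integral_cong)
next
  case (set A)
  then show ?case using M N by (simp add: emeasure_lin)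
next
  case (mult u v)
  have [measurable]: "u \<in> borel_measurable M" "u \<in> borel_measurable N"
    using mult(2) M N by (simp_all cong: measurable_cong_sets)
  show ?case using mult by (simp add: nn_integral_cmult algebra_simps)
next
  case (add u v)
  have [measurable]: "u \<in> borel_measurable M" "u \<in> borel_measurable N" "v \<in> borel_measurable M" "v \<in> borel_measurable N"
    using add(1,3) M N by (simp_all cong: measurable_cong_sets)
  show ?case using add by (simp add: nn_integral_add algebra_simps)
next
  case (seq U)
  have [measurable]: "U i \<in> borel_measurable M" "U i \<in> borel_measurable N" for i
    using seq.hyps(1) M N by (simp_all cong: measurable_cong_sets)
  have incU: "incseq U" using seq by blast
  have inc: "incseq (\<lambda>i. \<integral>\<^sup>+x. U i x \<partial>R)" for R
    using incU by (auto simp: incseq_def le_fun_def intro: nn_integral_mono)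
  have "(\<integral>\<^sup>+x. (SUP i. U i) x \<partial>lin c M d N) = (SUP i. \<integral>\<^sup>+x. U i x \<partial>lin c M d N)"
    using seq.hyps(1) incU unfolding SUP_apply by (intro nn_integral_monotone_convergence_SUP) auto
  also have "\<dots> = (SUP i. ennreal c * (\<integral>\<^sup>+x. U i x \<partial>M) + ennreal d * (\<integral>\<^sup>+x. U i x \<partial>N))"
    using seq.IH by simp
  also have "\<dots> = ennreal c * (SUP i. \<integral>\<^sup>+x. U i x \<partial>M) + ennreal d * (SUP i. \<integral>\<^sup>+x. U i x \<partial>N)"
    using inc by (subst ennreal_SUP_add) (auto simp: SUP_mult_left_ennreal incseq_def intro!: mult_left_mono)
  also have "\<dots> = ennreal c * (\<integral>\<^sup>+x. (SUP i. U i) x \<partial>M) + ennreal d * (\<integral>\<^sup>+x. (SUP i. U i) x \<partial>N)"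
    unfolding SUP_apply using incU by (simp add: nn_integral_monotone_convergence_SUP)
  finally show ?case .
qed

lemma finite_borel_lin:
  assumes "finite_borel M" "finite_borel N"
  shows "finite_borel (lin c M d N)"
proof -
  interpret M: finite_measure M using assms(1) by (rule finite_borelD)
  interpret N: finite_measure N using assms(2) by (rule finite_borelD)
  have "emeasure (lin c M d N) UNIV \<noteq> \<infinity>"
    using assms by (subst emeasure_lin) (auto dest: finite_borelD simp: ennreal_mult_eq_top_iff)
  then show ?thesis by (auto simp: finite_borel_def intro!: finite_measureI)
qed

lemma carried_by_lin:
  assumes "finite_borel M" "finite_borel N" "carried_by M S" "carried_by N S" "closed S"
  shows "carried_by (lin c M d N) S"
proof -
  have "- S \<in> sets borel" using assms(5) by (simp add: borel_open)
  then show ?thesis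
    using assms(3,4) finite_borelD(1)[OF assms(1)] finite_borelD(1)[OF assms(2)]
    by (simp add: carried_by_def emeasure_lin)
qed

lemma integral_lin:
  fixes f :: "'a::topological_space \<Rightarrow> real"
  assumes M: "sets M = sets borel" and N: "sets N = sets borel"
    and f: "integrable M f" "integrable N f" and cd: "c \<ge> 0" "d \<ge> 0"
  shows "integrable (lin c M d N) f"
    and "(\<integral>x. f x \<partial>lin c M d N) = c * (\<integral>x. f x \<partial>M) + d * (\<integral>x. f x \<partial>N)"
proof -
  have [measurable]: "f \<in> borel_measurable borel"
    using borel_measurable_integrable[OF f(1)] M by (simp cong: measurable_cong_sets)
  have nn: "(\<integral>\<^sup>+x. g x \<partial>lin c M d N) = ennreal c * (\<integral>\<^sup>+x. g x \<partial>M) + ennreal d * (\<integral>\<^sup>+x. g x \<partial>N)"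
    if "g \<in> borel_measurable borel" for g
    by (rule nn_integral_lin[OF M N that])
  have "(\<integral>\<^sup>+x. ennreal (norm (f x)) \<partial>lin c M d N) < \<infinity>"
    using f unfolding integrable_iff_bounded
    by (subst nn) (auto simp: ennreal_mult_less_top)
  then show int: "integrable (lin c M d N) f" unfolding integrable_iff_bounded by simp
  have fin: "(\<integral>\<^sup>+x. ennreal (f x) \<partial>R) < top" "(\<integral>\<^sup>+x. ennreal (- f x) \<partial>R) < top" if "integrable R f" for R
  proof -
    have "(\<integral>\<^sup>+x. ennreal (norm (f x)) \<partial>R) < \<infinity>" using that unfolding integrable_iff_bounded by simp
    moreover have "(\<integral>\<^sup>+x. ennreal (f x) \<partial>R) \<le> (\<integral>\<^sup>+x. ennreal (norm (f x)) \<partial>R)"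
      "(\<integral>\<^sup>+x. ennreal (- f x) \<partial>R) \<le> (\<integral>\<^sup>+x. ennreal (norm (f x)) \<partial>R)"
      by (auto intro!: nn_integral_mono ennreal_leI)
    ultimately show "(\<integral>\<^sup>+x. ennreal (f x) \<partial>R) < top" "(\<integral>\<^sup>+x. ennreal (- f x) \<partial>R) < top"
      by (auto intro: le_less_trans)
  qed
  show "(\<integral>x. f x \<partial>lin c M d N) = c * (\<integral>x. f x \<partial>M) + d * (\<integral>x. f x \<partial>N)"
    unfolding real_lebesgue_integral_def[OF int] real_lebesgue_integral_def[OF f(1)] real_lebesgue_integral_def[OF f(2)]
    using fin[OF f(1)] fin[OF f(2)] cd
    by (subst (1 2) nn) (auto simp: enn2real_plus enn2real_mult ennreal_mult_less_top algebra_simps)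
qed

lemma gauss_transform_lin:
  assumes "finite_borel M" "finite_borel N" "c \<ge> 0" "d \<ge> 0"
  shows "gauss_transform (lin c M d N) q = c * gauss_transform M q + d * gauss_transform N q"
  unfolding gauss_transform_def
  using assms by (intro integral_lin integrable_gauss) (auto dest: finite_borelD)

text \<open>The test measures for all quasi-everywhere statements; finite energy prevents them from
  charging polar sets.\<close>

definition energy_on :: "'a::euclidean_space set \<Rightarrow> 'a measure \<Rightarrow> bool" where
  "energy_on \<Omega> M \<longleftrightarrow> finite_borel M \<and> carried_by M \<Omega> \<and> mutual_energy M M < \<infinity>"

text \<open>The energy inner product as a real number. On measures of finite energy it agrees with
  \<open>mutual_energy\<close>, and its integral converges by the inequality between the product and
  the squares.\<close>

definition ip :: "'a::euclidean_space measure \<Rightarrow> 'a measure \<Rightarrow> real" where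
  "ip M N = (\<integral>q. gauss_transform M q * gauss_transform N q \<partial>gauss_space)"

lemma energy_onD:
  assumes "energy_on \<Omega> M"
  shows "finite_borel M" "carried_by M \<Omega>" "mutual_energy M M < \<infinity>"
  using assms by (auto simp: energy_on_def)

lemma ip_commute: "ip M N = ip N M"
  by (simp add: ip_def mult.commute)

lemma square_integrable_gauss_transform:
  fixes M :: "'a::euclidean_space measure"
  assumes D: "DIM('a) \<ge> 3" and M: "energy_on \<Omega> M"
  shows "integrable gauss_space (\<lambda>q. (gauss_transform M q)\<^sup>2)"
proof -
  note fb = energy_onD(1)[OF M]
  note [measurable] = measurable_gauss_transform[OF fb]
  show ?thesis
    using energy_onD(3)[OF M] unfolding mutual_energy_eq_gauss[OF D fb fb]
    by (intro integrableI_nonneg) (auto simp: power2_eq_square)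
qed

lemma integrable_gauss_product:
  fixes M :: "'a::euclidean_space measure"
  assumes D: "DIM('a) \<ge> 3" and M: "energy_on \<Omega> M" and N: "energy_on \<Omega>' N"
  shows "integrable gauss_space (\<lambda>q. gauss_transform M q * gauss_transform N q)"
proof (rule Bochner_Integration.integrable_bound)
  show "integrable gauss_space (\<lambda>q. (gauss_transform M q)\<^sup>2 + (gauss_transform N q)\<^sup>2)"
    using square_integrable_gauss_transform[OF D M] square_integrable_gauss_transform[OF D N] by simp
  show "(\<lambda>q. gauss_transform M q * gauss_transform N q) \<in> borel_measurable gauss_space"
    using energy_onD(1)[OF M] energy_onD(1)[OF N] by measurable
  show "AE q in gauss_space. norm (gauss_transform M q * gauss_transform N q)
      \<le> norm ((gauss_transform M q)\<^sup>2 + (gauss_transform N q)\<^sup>2)"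
  proof (rule AE_I2)
    fix q
    have "2 * (gauss_transform M q * gauss_transform N q) \<le> (gauss_transform M q)\<^sup>2 + (gauss_transform N q)\<^sup>2"
      using sum_squares_bound[of "gauss_transform M q" "gauss_transform N q"] by simp
    moreover have "0 \<le> gauss_transform M q * gauss_transform N q"
      using gauss_transform_nonneg[of M q] gauss_transform_nonneg[of N q] by simp
    ultimately show "norm (gauss_transform M q * gauss_transform N q)
      \<le> norm ((gauss_transform M q)\<^sup>2 + (gauss_transform N q)\<^sup>2)" by simp
  qed
qed

lemma ip_nonneg: "0 \<le> ip M N"
  unfolding ip_def using gauss_transform_nonneg[of M] gauss_transform_nonneg[of N]
  by (intro integral_nonneg_AE) auto

lemma mutual_energy_eq_ip:
  fixes M :: "'a::euclidean_space measure"
  assumes D: "DIM('a) \<ge> 3" and M: "energy_on \<Omega> M" and N: "energy_on \<Omega>' N"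
  shows "mutual_energy M N = ennreal (ip M N)"
  unfolding mutual_energy_eq_gauss[OF D energy_onD(1)[OF M] energy_onD(1)[OF N]] ip_def
  using integrable_gauss_product[OF D M N] gauss_transform_nonneg[of M] gauss_transform_nonneg[of N]
  by (intro nn_integral_eq_integral) auto

lemma energy_on_lin:
  fixes M :: "'a::euclidean_space measure"
  assumes D: "DIM('a) \<ge> 3" and \<Omega>: "closed \<Omega>" and M: "energy_on \<Omega> M" and N: "energy_on \<Omega> N"
    and cd: "c \<ge> 0" "d \<ge> 0"
  shows "energy_on \<Omega> (lin c M d N)"
proof -
  note MN = energy_onD[OF M] energy_onD[OF N]
  have fb: "finite_borel (lin c M d N)" using MN by (intro finite_borel_lin)
  have "integrable gauss_space (\<lambda>q. c * (c * (gauss_transform M q)\<^sup>2) + (2 * c * d) * (gauss_transform M q * gauss_transform N q)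
     + d * (d * (gauss_transform N q)\<^sup>2))"
    using square_integrable_gauss_transform[OF D M] square_integrable_gauss_transform[OF D N] integrable_gauss_product[OF D M N]
    by simp
  also have "(\<lambda>q. c * (c * (gauss_transform M q)\<^sup>2) + (2 * c * d) * (gauss_transform M q * gauss_transform N q)
     + d * (d * (gauss_transform N q)\<^sup>2)) = (\<lambda>q. gauss_transform (lin c M d N) q * gauss_transform (lin c M d N) q)"
    unfolding gauss_transform_lin[OF MN(1,4) cd] by (simp add: power2_eq_square algebra_simps)
  finally have "mutual_energy (lin c M d N) (lin c M d N) < \<infinity>"
    unfolding mutual_energy_eq_gauss[OF D fb fb] integrable_iff_bounded by simp
  then show ?thesis using fb MN \<Omega> by (auto simp: energy_on_def intro: carried_by_lin)
qed

lemma ip_lin: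
  fixes M :: "'a::euclidean_space measure"
  assumes D: "DIM('a) \<ge> 3" and M: "energy_on \<Omega> M" and N: "energy_on \<Omega> N" and R: "energy_on \<Omega> R"
    and cd: "c \<ge> 0" "d \<ge> 0"
  shows "ip (lin c M d N) R = c * ip M R + d * ip N R"
  unfolding ip_def gauss_transform_lin[OF energy_onD(1)[OF M] energy_onD(1)[OF N] cd]
  using integrable_gauss_product[OF D M R] integrable_gauss_product[OF D N R]
  by (simp add: distrib_right mult.assoc)

text \<open>Restriction decreases both the potential and the measure it is integrated against. It
  supplies the test measures that localize integral inequalities to pointwise ones.\<close>

lemma energy_on_restrict_to:
  fixes M :: "'a::euclidean_space measure"
  assumes M: "energy_on \<Omega> M" and \<Omega>: "closed \<Omega>" and K: "K \<in> sets borel"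
  shows "energy_on \<Omega> (restrict_to M K)"
proof -
  note M' = energy_onD[OF M]
  have fb: "finite_borel (restrict_to M K)" using M'(1) K by (rule finite_borel_restrict_to)
  have 1: "pot (restrict_to M K) x \<le> pot M x" for x
    unfolding pot_def by (subst nn_integral_restrict_to[OF M'(1) K])
      (auto intro!: nn_integral_mono simp: indicator_def)
  have "mutual_energy (restrict_to M K) (restrict_to M K) = (\<integral>\<^sup>+x. indicator K x * pot (restrict_to M K) x \<partial>M)"
    unfolding mutual_energy_eq_pot[OF fb fb] using measurable_pot[OF fb] by (rule nn_integral_restrict_to[OF M'(1) K])
  also have "\<dots> \<le> (\<integral>\<^sup>+x. pot M x \<partial>M)"
    using 1 by (intro nn_integral_mono) (auto simp: indicator_def)
  also have "\<dots> < \<infinity>" using M'(3) unfolding mutual_energy_eq_pot[OF M'(1) M'(1)] .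
  finally have "mutual_energy (restrict_to M K) (restrict_to M K) < \<infinity>" .
  moreover have "indicator K \<in> borel_measurable M"
    using K finite_borelD(1)[OF M'(1)] by (intro borel_measurable_indicator) simp
  then have "carried_by (restrict_to M K) \<Omega>"
    unfolding restrict_to_def by (rule carried_by_density[OF M'(1,2) \<Omega>])
  ultimately show ?thesis using fb by (simp add: energy_on_def)
qed

text \<open>The kernel on \<open>\<Omega>\<close> is at least its value at distance
  \<open>2 * B\<close>. This is the coercivity that positive measures have and signed ones
  lack.\<close>

lemma energy_lower_bound:
  fixes \<Omega> :: "'a::euclidean_space set"
  assumes D: "DIM('a) \<ge> 3" and \<Omega>: "compact \<Omega>"
  shows "\<exists>k>0. \<forall>M. energy_on \<Omega> M \<longrightarrow> k * (measure M UNIV)\<^sup>2 \<le> ip M M"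
proof -
  define a where "a = kexp TYPE('a)"
  have a: "a > 0" using kexp_pos[OF D] by (simp add: a_def)
  obtain B where B: "\<And>x. x \<in> \<Omega> \<Longrightarrow> norm x \<le> B" "B > 0"
    using compact_imp_bounded[OF \<Omega>] by (auto simp: bounded_pos)
  define k where "k = ((2 * B)\<^sup>2) powr - a"
  have k: "k > 0" using B(2) by (simp add: k_def)
  have kk: "ennreal k \<le> kernel x y" if "x \<in> \<Omega>" "y \<in> \<Omega>" for x y
  proof (cases "x = y")
    case False
    have "norm (x - y) \<le> 2 * B" using norm_triangle_ineq4[of x y] B(1)[of x] B(1)[of y] that by linarith
    then have "(norm (x - y))\<^sup>2 \<le> (2 * B)\<^sup>2" by (intro power_mono) auto
    then show ?thesis unfolding kernel_eq_powr[OF D False] k_def a_def[symmetric]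
      using a False by (intro ennreal_leI powr_mono2') auto
  qed (simp add: kernel_diagonal[OF D])
  have "k * (measure M UNIV)\<^sup>2 \<le> ip M M" if M: "energy_on \<Omega> M" for M
  proof -
    note M' = energy_onD[OF M]
    interpret finite_measure M using M'(1) by (rule finite_borelD)
    have [simp]: "space M = UNIV" using M'(1) by (rule finite_borelD)
    note AE = AE_carried_by[OF M'(1) compact_imp_closed[OF \<Omega>] M'(2)]
    have "ennreal (k * (measure M UNIV)\<^sup>2) = (\<integral>\<^sup>+x. \<integral>\<^sup>+y. ennreal k \<partial>M \<partial>M)"
      using k by (simp add: emeasure_eq_measure ennreal_mult'[symmetric] power2_eq_square mult.assoc)
    also have "\<dots> \<le> (\<integral>\<^sup>+x. \<integral>\<^sup>+y. kernel x y \<partial>M \<partial>M)"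
    proof (rule nn_integral_mono_AE)
      show "AE x in M. (\<integral>\<^sup>+y. ennreal k \<partial>M) \<le> (\<integral>\<^sup>+y. kernel x y \<partial>M)"
        using AE
      proof eventually_elim
        case (elim x)
        then show ?case using AE by (intro nn_integral_mono_AE) (auto elim!: eventually_mono intro: kk)
      qed
    qed
    also have "\<dots> = ennreal (ip M M)"
      using mutual_energy_eq_ip[OF D M M] mutual_energy_eq_pot[OF M'(1) M'(1)] by (simp add: pot_def)
    finally show ?thesis using ip_nonneg[of M M] by simp
  qed
  with k show ?thesis by blast
qed

lemma energy_on_null: "energy_on \<Omega> (null_measure borel)"
proof -
  have fb: "finite_borel (null_measure borel :: 'a measure)"
    by (auto simp: finite_borel_def intro!: finite_measureI)
  show ?thesis by (simp add: energy_on_def fb carried_by_def mutual_energy_eq_pot[OF fb fb])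
qed

text \<open>Direct method: the quadratic energy dominates the linear term, so masses along a
  minimizing sequence are bounded. A weak limit exists, the linear term passes to the limit, and the
  energy is lower semicontinuous by Fatou.\<close>

lemma obstacle_minimizer:
  fixes \<Omega> :: "'a::euclidean_space set"
  assumes D: "DIM('a) \<ge> 3" and \<Omega>: "compact \<Omega>" and s: "continuous_on UNIV s"
  obtains M where "energy_on \<Omega> M"
    "\<And>N. energy_on \<Omega> N \<Longrightarrow> ip M M - 2 * (\<integral>x. s x \<partial>M) \<le> ip N N - 2 * (\<integral>x. s x \<partial>N)"
proof -
  define J where "J M = ip M M - 2 * (\<integral>x. s x \<partial>M)" for M
  obtain k where k: "k > 0" "\<And>M. energy_on \<Omega> M \<Longrightarrow> k * (measure M UNIV)\<^sup>2 \<le> ip M M"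
    using energy_lower_bound[OF D \<Omega>] by blast
  obtain g S where g: "continuous_on UNIV g" "\<And>x. \<bar>g x\<bar> \<le> S" "\<And>x. x \<in> \<Omega> \<Longrightarrow> g x = s x" "S \<ge> 0"
    using continuous_clamp_on_compact[OF \<Omega> s] by metis
  have lb: "k * (measure M UNIV)\<^sup>2 - 2 * S * measure M UNIV \<le> J M" if M: "energy_on \<Omega> M" for M
  proof -
    note M' = energy_onD[OF M]
    interpret finite_measure M using M'(1) by (rule finite_borelD)
    have [simp]: "space M = UNIV" using M'(1) by (rule finite_borelD)
    have "AE x in M. s x \<le> S"
      using AE_carried_by[OF M'(1) compact_imp_closed[OF \<Omega>] M'(2)]
    proof eventually_elim
      case (elim x)
      then show ?case using g(2)[of x] g(3)[of x] by simp
    qed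
    then have "(\<integral>x. s x \<partial>M) \<le> (\<integral>x. S \<partial>M)"
      using integrable_continuous_carried[OF \<Omega> M'(1,2) s] by (intro integral_mono_AE) auto
    then have "(\<integral>x. s x \<partial>M) \<le> S * measure M UNIV" by (simp add: mult.commute)
    moreover have "2 * S * measure M UNIV = 2 * (S * measure M UNIV)" by simp
    ultimately show ?thesis using k(2)[OF M] unfolding J_def by linarith
  qed
  define \<J> where "\<J> = J ` {M. energy_on \<Omega> M}"
  have ne: "\<J> \<noteq> {}" using energy_on_null by (auto simp: \<J>_def)
  have bdd: "bdd_below \<J>"
  proof (rule bdd_belowI)
    fix j assume "j \<in> \<J>"
    then obtain M where M: "energy_on \<Omega> M" "j = J M" by (auto simp: \<J>_def)
    define m where "m = measure M UNIV"
    \<comment> \<open>Completing the square in \<open>m\<close>: the functional is at least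
      \<open>- S\<^sup>2 / k\<close>.\<close>
    have "0 \<le> (k * m - S)\<^sup>2" by simp
    then have "- (S\<^sup>2) \<le> k * (k * m\<^sup>2 - 2 * S * m)" by (simp add: power2_eq_square algebra_simps)
    then have "- (S\<^sup>2 / k) \<le> k * m\<^sup>2 - 2 * S * m" using k(1) by (simp add: field_simps)
    then show "- (S\<^sup>2 / k) \<le> j" using lb[OF M(1)] M(2) by (simp add: m_def)
  qed
  define I where "I = Inf \<J>"
  have I: "I \<le> J M" if "energy_on \<Omega> M" for M
    unfolding I_def using that bdd by (intro cInf_lower) (auto simp: \<J>_def)
  have "\<exists>M. energy_on \<Omega> M \<and> J M < I + 1 / Suc n" for n
    using cInf_lessD[OF ne, of "I + 1 / Suc n"] by (auto simp: \<J>_def I_def)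
  then obtain M where M: "\<And>n. energy_on \<Omega> (M n)" "\<And>n. J (M n) < I + 1 / Suc n" by metis
  have "J (null_measure borel) = 0"
    by (simp add: J_def ip_def gauss_transform_def)
  then have "I \<le> 0" using I[OF energy_on_null] by simp
  have Jlim: "(\<lambda>n. J (M n)) \<longlonglongrightarrow> I"
  proof (rule tendsto_sandwich[where f="\<lambda>_. I" and h="\<lambda>n. I + 1 / Suc n"])
    show "(\<lambda>n. I + 1 / Suc n) \<longlonglongrightarrow> I"
      using tendsto_add[OF tendsto_const LIMSEQ_Suc[OF lim_1_over_n], of I] by simp
  qed (use I[OF M(1)] less_imp_le[OF M(2)] in auto)
  \<comment> \<open>Mass above \<open>C\<close> would force a functional value above 1, whereas the
    minimizing sequence stays below \<open>I + 1 / Suc n\<close>, which is at most 1 because the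
    null measure gives \<open>I \<le> 0\<close>.\<close>
  define C where "C = max 1 ((2 * S + 1) / k)"
  have mass: "measure (M n) UNIV \<le> C" for n
  proof (rule ccontr)
    define m where "m = measure (M n) UNIV"
    assume "\<not> measure (M n) UNIV \<le> C"
    then have m: "m > 1" "m > (2 * S + 1) / k" by (auto simp: m_def C_def)
    then have "k * m - 2 * S > 1" using k(1) by (simp add: field_simps)
    then have "1 * 1 < m * (k * m - 2 * S)" using m(1) by (intro mult_strict_mono) auto
    then have "1 < J (M n)" using lb[OF M(1)[of n]] by (simp add: m_def power2_eq_square algebra_simps)
    moreover have "J (M n) < I + 1 / Suc n" by (rule M(2))
    moreover have "1 / Suc n \<le> (1::real)" by simp
    ultimately show False using \<open>I \<le> 0\<close> by linarith
  qed
  obtain r \<tau> where r: "strict_mono (r :: nat \<Rightarrow> nat)" "finite_borel \<tau>" "carried_by \<tau> \<Omega>"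
    "\<And>f :: 'a \<Rightarrow> real. continuous_on UNIV f \<Longrightarrow> (\<lambda>n. \<integral>x. f x \<partial>M (r n)) \<longlonglongrightarrow> (\<integral>x. f x \<partial>\<tau>)"
    using weak_compactness[of \<Omega> M C, OF \<Omega> energy_onD(1)[OF M(1)] mass energy_onD(2)[OF M(1)]] by blast
  define L where "L = I + 2 * (\<integral>x. s x \<partial>\<tau>)"
  have Llim: "(\<lambda>n. ip (M (r n)) (M (r n))) \<longlonglongrightarrow> L"
  proof -
    have "(\<lambda>n. J (M (r n)) + 2 * (\<integral>x. s x \<partial>M (r n))) \<longlonglongrightarrow> L"
      unfolding L_def using LIMSEQ_subseq_LIMSEQ[OF Jlim r(1)]
      by (intro tendsto_intros r(4) s) (simp add: o_def)
    then show ?thesis by (simp add: J_def)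
  qed
  \<comment> \<open>Each Gaussian is continuous, so weak convergence applies for every parameter
    separately.\<close>
  have gt: "(\<lambda>n. gauss_transform (M (r n)) q) \<longlonglongrightarrow> gauss_transform \<tau> q" for q
    unfolding gauss_transform_def by (rule r(4)) (auto simp: gauss_def intro!: continuous_intros)
  note [measurable] = measurable_gauss_transform[OF r(2)] measurable_gauss_transform[OF energy_onD(1)[OF M(1)]]
  have "mutual_energy \<tau> \<tau> = (\<integral>\<^sup>+q. liminf (\<lambda>n. ennreal (gauss_transform (M (r n)) q * gauss_transform (M (r n)) q)) \<partial>gauss_space)"
    unfolding mutual_energy_eq_gauss[OF D r(2) r(2)]
  proof (rule nn_integral_cong)
    fix q
    have "(\<lambda>n. ennreal (gauss_transform (M (r n)) q * gauss_transform (M (r n)) q))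
       \<longlonglongrightarrow> ennreal (gauss_transform \<tau> q * gauss_transform \<tau> q)"
      by (intro tendsto_ennrealI tendsto_mult gt)
    then show "ennreal (gauss_transform \<tau> q * gauss_transform \<tau> q)
      = liminf (\<lambda>n. ennreal (gauss_transform (M (r n)) q * gauss_transform (M (r n)) q))"
      by (intro lim_imp_Liminf[symmetric]) auto
  qed
  also have "\<dots> \<le> liminf (\<lambda>n. \<integral>\<^sup>+q. ennreal (gauss_transform (M (r n)) q * gauss_transform (M (r n)) q) \<partial>gauss_space)"
    by (rule nn_integral_liminf) measurable
  also have "\<dots> = liminf (\<lambda>n. ennreal (ip (M (r n)) (M (r n))))"
    using mutual_energy_eq_ip[OF D M(1) M(1)]
    by (simp add: mutual_energy_eq_gauss[OF D energy_onD(1)[OF M(1)] energy_onD(1)[OF M(1)]])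
  also have "\<dots> = ennreal L"
    by (rule lim_imp_Liminf) (auto intro!: tendsto_ennrealI Llim)
  finally have le: "mutual_energy \<tau> \<tau> \<le> ennreal L" .
  then have \<tau>: "energy_on \<Omega> \<tau>"
    using r(2,3) ennreal_less_top[of L] by (auto simp: energy_on_def intro: le_less_trans)
  have "L \<ge> 0" using Llim ip_nonneg by (intro LIMSEQ_le_const[OF Llim]) auto
  then have "ip \<tau> \<tau> \<le> L" using le unfolding mutual_energy_eq_ip[OF D \<tau> \<tau>] by simp
  then have "J \<tau> \<le> I" by (simp add: J_def L_def)
  then have "J \<tau> \<le> J N" if "energy_on \<Omega> N" for N using I[OF that] by linarith
  then show thesis using that[OF \<tau>] unfolding J_def by blast
qed

lemma nn_integral_le_imp_AE_le:
  assumes [measurable]: "f \<in> borel_measurable M" "g \<in> borel_measurable M"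
    and le: "AE x in M. f x \<le> g x" and int: "(\<integral>\<^sup>+x. g x \<partial>M) \<le> (\<integral>\<^sup>+x. f x \<partial>M)" "(\<integral>\<^sup>+x. g x \<partial>M) < \<infinity>"
  shows "AE x in M. g x \<le> f x"
proof -
  have fle: "(\<integral>\<^sup>+x. f x \<partial>M) \<le> (\<integral>\<^sup>+x. g x \<partial>M)" by (rule nn_integral_mono_AE[OF le])
  then have fin: "(\<integral>\<^sup>+x. f x \<partial>M) \<noteq> \<infinity>" using int by auto
  have "(\<integral>\<^sup>+x. g x - f x \<partial>M) = (\<integral>\<^sup>+x. g x \<partial>M) - (\<integral>\<^sup>+x. f x \<partial>M)"
    by (rule nn_integral_diff[OF _ _ fin le]) auto
  also have "\<dots> = 0" using int fle by (intro diff_eq_0_ennreal) (auto simp: less_top)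
  finally have "AE x in M. g x - f x = 0" by (subst (asm) nn_integral_0_iff_AE) auto
  moreover have "AE x in M. f x \<noteq> \<infinity>" using fin by (intro nn_integral_PInf_AE) auto
  ultimately show ?thesis
  proof eventually_elim
    case (elim x)
    show ?case
    proof (rule ccontr)
      assume "\<not> g x \<le> f x"
      then have "f x < g x" by simp
      then have "0 < g x - f x" by (simp add: diff_gr0_ennreal)
      with elim show False by simp
    qed
  qed
qed

text \<open>The first-order condition at a minimum: divide by \<open>t\<close> and let it tend to 0.
  It is applied with the increments of the functional along variations of the minimizer.\<close>

lemma quadratic_perturbation_nonneg:
  fixes b c :: real
  assumes "\<And>t. 0 < t \<Longrightarrow> t < 1 \<Longrightarrow> 0 \<le> t * b + t\<^sup>2 * c"
  shows "0 \<le> b"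
proof (rule ccontr)
  assume b: "\<not> 0 \<le> b"
  define t where "t = min (1 / 2) (- b / (2 * (\<bar>c\<bar> + 1)))"
  have "0 < - b / (2 * (\<bar>c\<bar> + 1))" using b by (intro divide_pos_pos) auto
  then have t: "0 < t" "t < 1" by (auto simp: t_def min_less_iff_disj)
  have "0 \<le> t * (b + t * c)" using assms[OF t] by (simp add: power2_eq_square algebra_simps)
  then have "0 \<le> b + t * c" using t(1) by (simp add: zero_le_mult_iff)
  moreover have "t * c \<le> t * (\<bar>c\<bar> + 1)" using t(1) by (intro mult_left_mono) auto
  moreover have "t * (\<bar>c\<bar> + 1) \<le> - b / (2 * (\<bar>c\<bar> + 1)) * (\<bar>c\<bar> + 1)"
    unfolding t_def by (intro mult_right_mono) auto
  moreover have "- b / (2 * (\<bar>c\<bar> + 1)) * (\<bar>c\<bar> + 1) = - b / 2"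
    by (simp add: divide_simps)
  ultimately show False using b by linarith
qed

text \<open>The minimizer of the obstacle problem has potential at least \<open>s\<close> quasi-everywhere on \<open>\<Omega>\<close>,
  with equality almost everywhere for the minimizer itself; the domination principle turns this
  into equality quasi-everywhere on \<open>\<Omega>\<close>.\<close>

theorem balayage:
  fixes \<Omega> :: "'a::euclidean_space set"
  assumes D: "DIM('a) \<ge> 3" and \<Omega>: "compact \<Omega>"
    and s: "continuous_on UNIV s" "\<And>e. e > 0 \<Longrightarrow> \<exists>R. \<forall>x. norm x \<ge> R \<longrightarrow> \<bar>s x\<bar> \<le> e"
      "\<And>x. strictly_superharmonic_at s x"
  obtains M where "energy_on \<Omega> M" "\<And>N. energy_on \<Omega> N \<Longrightarrow> ip M N = (\<integral>x. s x \<partial>N)"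
proof -
  have cl: "closed \<Omega>" using \<Omega> by (rule compact_imp_closed)
  obtain M where M: "energy_on \<Omega> M"
    "\<And>N. energy_on \<Omega> N \<Longrightarrow> ip M M - 2 * (\<integral>x. s x \<partial>M) \<le> ip N N - 2 * (\<integral>x. s x \<partial>N)"
    using obstacle_minimizer[OF D \<Omega> s(1)] by blast
  note fbM = energy_onD(1)[OF M(1)]
  note [measurable] = measurable_pot[OF fbM] borel_measurable_continuous_onI[OF s(1)]
  have int_s: "integrable N s" if "energy_on \<Omega> N" for N
    using integrable_continuous_carried[OF \<Omega> energy_onD(1,2)[OF that] s(1)] .
  note s0 = strictly_superharmonic_nonneg[OF s]
  have nn_s: "(\<integral>\<^sup>+x. ennreal (s x) \<partial>N) = ennreal (\<integral>x. s x \<partial>N)" if "energy_on \<Omega> N" for N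
    using int_s[OF that] s0 by (intro nn_integral_eq_integral) auto
  have pot_int: "(\<integral>\<^sup>+x. pot M x \<partial>N) = ennreal (ip M N)" if "energy_on \<Omega> N" for N
    using mutual_energy_eq_pot[OF energy_onD(1)[OF that] fbM] mutual_energy_eq_ip[OF D that M(1)]
    by (simp add: ip_commute)
  \<comment> \<open>Variation \<open>M + t N\<close>: adding mass in any admissible direction does
    not lower the functional.\<close>
  have ge: "(\<integral>x. s x \<partial>N) \<le> ip M N" if N: "energy_on \<Omega> N" for N
  proof -
    have "0 \<le> 2 * (ip M N - (\<integral>x. s x \<partial>N))"
    proof (rule quadratic_perturbation_nonneg)
      fix t :: real assume t: "0 < t" "t < 1"
      have L: "energy_on \<Omega> (lin 1 M t N)" using t by (intro energy_on_lin[OF D cl M(1) N]) auto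
      have "ip (lin 1 M t N) (lin 1 M t N) = 1 * ip M (lin 1 M t N) + t * ip N (lin 1 M t N)"
        using t by (intro ip_lin[OF D M(1) N L]) auto
      also have "ip M (lin 1 M t N) = 1 * ip M M + t * ip N M"
        using t by (subst ip_commute, intro ip_lin[OF D M(1) N M(1)]) auto
      also have "ip N (lin 1 M t N) = 1 * ip M N + t * ip N N"
        using t by (subst ip_commute, intro ip_lin[OF D M(1) N N]) auto
      finally have "ip (lin 1 M t N) (lin 1 M t N) = ip M M + 2 * t * ip M N + t\<^sup>2 * ip N N"
        using ip_commute[of N M] by (simp add: power2_eq_square algebra_simps)
      moreover have "(\<integral>x. s x \<partial>lin 1 M t N) = 1 * (\<integral>x. s x \<partial>M) + t * (\<integral>x. s x \<partial>N)"
        using t finite_borelD(1)[OF fbM] finite_borelD(1)[OF energy_onD(1)[OF N]]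
        by (intro integral_lin int_s M N) auto
      ultimately show "0 \<le> t * (2 * (ip M N - (\<integral>x. s x \<partial>N))) + t\<^sup>2 * ip N N"
        using M(2)[OF L] by (simp add: algebra_simps)
    qed
    then show ?thesis by simp
  qed
  \<comment> \<open>Variation \<open>(1 - t) M\<close>, encoded as \<open>lin (1 - t) M 0 M\<close>:
    only existing mass may be removed, so the reverse inequality is available for \<open>M\<close>
    itself.\<close>
  have "ip M M \<le> (\<integral>x. s x \<partial>M)"
  proof -
    have "0 \<le> 2 * ((\<integral>x. s x \<partial>M) - ip M M)"
    proof (rule quadratic_perturbation_nonneg)
      fix t :: real assume t: "0 < t" "t < 1"
      have L: "energy_on \<Omega> (lin (1 - t) M 0 M)" using t by (intro energy_on_lin[OF D cl M(1) M(1)]) auto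
      have "ip (lin (1 - t) M 0 M) (lin (1 - t) M 0 M) = (1 - t) * ip M (lin (1 - t) M 0 M) + 0 * ip M (lin (1 - t) M 0 M)"
        using t by (intro ip_lin[OF D M(1) M(1) L]) auto
      also have "ip M (lin (1 - t) M 0 M) = (1 - t) * ip M M + 0 * ip M M"
        using t by (subst ip_commute, intro ip_lin[OF D M(1) M(1) M(1)]) auto
      finally have "ip (lin (1 - t) M 0 M) (lin (1 - t) M 0 M) = (1 - t)\<^sup>2 * ip M M"
        by (simp add: power2_eq_square)
      moreover have "(\<integral>x. s x \<partial>lin (1 - t) M 0 M) = (1 - t) * (\<integral>x. s x \<partial>M) + 0 * (\<integral>x. s x \<partial>M)"
        using t finite_borelD(1)[OF fbM] by (intro integral_lin int_s M) auto
      ultimately show "0 \<le> t * (2 * ((\<integral>x. s x \<partial>M) - ip M M)) + t\<^sup>2 * ip M M"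
        using M(2)[OF L] by (simp add: power2_eq_square algebra_simps)
    qed
    then show ?thesis by simp
  qed
  then have ipM: "ip M M = (\<integral>x. s x \<partial>M)" using ge[OF M(1)] by linarith
  have above: "AE x in N. ennreal (s x) \<le> pot M x" if N: "energy_on \<Omega> N" for N
  proof -
    \<comment> \<open>Testing with the restriction of \<open>N\<close> to the set where the claim
      fails: there the pointwise and the integrated inequalities oppose each other, so the set is
      null for \<open>N\<close>.\<close>
    define U where "U = {x. pot M x < ennreal (s x)}"
    have U [measurable]: "U \<in> sets borel" unfolding U_def by measurable
    have NU: "energy_on \<Omega> (restrict_to N U)" by (rule energy_on_restrict_to[OF N cl U])
    note fbN = energy_onD(1)[OF N]
    have [simp, measurable_cong]: "sets N = sets borel" using fbN by (rule finite_borelD)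
    have [simp, measurable_cong]: "sets (restrict_to N U) = sets borel" by (simp add: restrict_to_def)
    have AEU: "AE x in restrict_to N U. x \<in> U"
      unfolding restrict_to_def by (subst AE_density) (auto simp: indicator_def)
    have "AE x in restrict_to N U. ennreal (s x) \<le> pot M x"
    proof (rule nn_integral_le_imp_AE_le)
      show "AE x in restrict_to N U. pot M x \<le> ennreal (s x)"
        using AEU by eventually_elim (auto simp: U_def)
      show "(\<integral>\<^sup>+x. ennreal (s x) \<partial>restrict_to N U) \<le> (\<integral>\<^sup>+x. pot M x \<partial>restrict_to N U)"
        unfolding nn_s[OF NU] pot_int[OF NU] using ge[OF NU] by (rule ennreal_leI)
      show "(\<integral>\<^sup>+x. ennreal (s x) \<partial>restrict_to N U) < \<infinity>"
        unfolding nn_s[OF NU] by simp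
    qed auto
    then have "AE x in N. (0::ennreal) < indicator U x \<longrightarrow> ennreal (s x) \<le> pot M x"
      unfolding restrict_to_def by (subst (asm) AE_density) auto
    then show ?thesis
    proof eventually_elim
      case (elim x)
      then show ?case by (cases "x \<in> U") (auto simp: U_def indicator_def not_less)
    qed
  qed
  have [simp, measurable_cong]: "sets M = sets borel" using fbM by (rule finite_borelD)
  have "AE x in M. pot M x \<le> ennreal (s x)"
  proof (rule nn_integral_le_imp_AE_le)
    show "(\<integral>\<^sup>+x. pot M x \<partial>M) \<le> (\<integral>\<^sup>+x. ennreal (s x) \<partial>M)"
      unfolding pot_int[OF M(1)] nn_s[OF M(1)] ipM ..
    show "(\<integral>\<^sup>+x. pot M x \<partial>M) < \<infinity>" unfolding pot_int[OF M(1)] by simp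
  qed (use above[OF M(1)] in auto)
  from domination_principle[OF D fbM s this] have below: "pot M x \<le> ennreal (s x)" for x .
  show thesis
  proof (rule that[OF M(1)])
    fix N assume N: "energy_on \<Omega> N"
    have "ennreal (ip M N) = (\<integral>\<^sup>+x. pot M x \<partial>N)" by (rule pot_int[OF N, symmetric])
    also have "\<dots> = (\<integral>\<^sup>+x. ennreal (s x) \<partial>N)"
      using above[OF N] by (intro nn_integral_cong_AE) (auto elim!: eventually_mono intro: antisym below)
    also have "\<dots> = ennreal (\<integral>x. s x \<partial>N)" by (rule nn_s[OF N])
    finally show "ip M N = (\<integral>x. s x \<partial>N)"
      using ip_nonneg[of M N] s0 by (subst (asm) ennreal_inj) (auto intro!: integral_nonneg_AE)
  qed
qed

text \<open>On \<open>\<Omega>\<close> the function \<open>\<phi>\<close> is the extension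
  \<open>s\<close> minus \<open>K * bubble 1\<close>; both are strictly superharmonic and vanish at
  infinity, so balayage applies to each.\<close>

corollary smooth_potential:
  fixes \<Omega> :: "'a::euclidean_space set"
  assumes D: "DIM('a) \<ge> 3" and \<Omega>: "compact \<Omega>" and \<phi>: "smooth_on UNIV \<phi>"
  shows "\<exists>A B. energy_on \<Omega> A \<and> energy_on \<Omega> B
    \<and> (\<forall>N. energy_on \<Omega> N \<longrightarrow> ip A N - ip B N = (\<integral>x. \<phi> x \<partial>N))"
proof (rule superharmonic_extension[OF D \<phi> compact_imp_bounded[OF \<Omega>]])
  fix s K
  assume s: "K > 0" "continuous_on UNIV s" "\<And>e. e > 0 \<Longrightarrow> \<exists>R. \<forall>x. norm x \<ge> R \<longrightarrow> \<bar>s x\<bar> \<le> e"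
    "\<And>x. strictly_superharmonic_at s x" "\<And>x. x \<in> \<Omega> \<Longrightarrow> s x = \<phi> x + K * bubble 1 x"
  define w :: "'a \<Rightarrow> real" where "w x = K * bubble 1 x" for x
  have w: "continuous_on UNIV w" unfolding w_def by (intro continuous_intros continuous_on_bubble) auto
  obtain A where A: "energy_on \<Omega> A" "\<And>N. energy_on \<Omega> N \<Longrightarrow> ip A N = (\<integral>x. s x \<partial>N)"
    using balayage[OF D \<Omega> s(2,3,4)] by blast
  have w1: "\<exists>R. \<forall>x. norm x \<ge> R \<longrightarrow> \<bar>w x\<bar> \<le> e" if "e > 0" for e
    using bubble_vanishes[OF D _ that, of 1 K] by (simp add: w_def)
  have w2: "strictly_superharmonic_at w x" for x
    using bubble_superharmonic[OF D _ s(1), of 1 x] by (simp add: w_def[abs_def])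
  obtain B where B: "energy_on \<Omega> B" "\<And>N. energy_on \<Omega> N \<Longrightarrow> ip B N = (\<integral>x. w x \<partial>N)"
    using balayage[OF D \<Omega> w w1 w2] by blast
  show ?thesis
  proof (rule exI[of _ A], rule exI[of _ B], intro conjI allI impI A(1) B(1))
    fix N assume N: "energy_on \<Omega> N"
    note N' = energy_onD[OF N]
    have c\<phi>: "continuous_on UNIV \<phi>" using \<phi>[unfolded smooth_on_def, rule_format, of 0] by simp
    note int = integrable_continuous_carried[OF \<Omega> N'(1,2)]
    have "ip A N - ip B N = (\<integral>x. s x - w x \<partial>N)"
      using A(2)[OF N] B(2)[OF N] int[OF s(2)] int[OF w] by simp
    also have "\<dots> = (\<integral>x. \<phi> x \<partial>N)"
    proof (rule integral_cong_AE)
      show "AE x in N. s x - w x = \<phi> x"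
        using AE_carried_by[OF N'(1) compact_imp_closed[OF \<Omega>] N'(2)]
        by eventually_elim (simp add: s(5) w_def)
    qed (use int[OF s(2)] int[OF w] int[OF c\<phi>] in auto)
    finally show "ip A N - ip B N = (\<integral>x. \<phi> x \<partial>N)" .
  qed
qed

section \<open>Signed measures and the minimizer\<close>

lemma signed_borel_measure_Diff:
  assumes "signed_borel_measure \<mu>" "A \<in> sets borel" "B \<in> sets borel" "B \<subseteq> A"
  shows "\<mu> (A - B) = \<mu> A - \<mu> B"
proof -
  have "B \<union> (A - B) = A" using assms(4) by auto
  then show ?thesis using signed_borel_measure_Un[OF assms(1,3), of "A - B"] assms(2,3) by auto
qed

text \<open>Otherwise one can peel off, from sets on which the measure stays unbounded, disjoint
  pieces of measure at least 1 in absolute value, whose series cannot converge. Boundedness makes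
  both Jordan parts finite.\<close>

lemma signed_borel_measure_bounded:
  fixes \<mu> :: "'a::topological_space set \<Rightarrow> real"
  assumes \<mu>: "signed_borel_measure \<mu>"
  shows "\<exists>C. \<forall>A\<in>sets borel. \<bar>\<mu> A\<bar> \<le> C"
proof (rule ccontr)
  assume unb: "\<not> ?thesis"
  define big where "big E \<longleftrightarrow> E \<in> sets borel \<and> \<not> (\<exists>C. \<forall>B\<in>sets borel. B \<subseteq> E \<longrightarrow> \<bar>\<mu> B\<bar> \<le> C)" for E
  have step: "\<exists>E'. big E' \<and> (E' \<subseteq> E \<and> 1 \<le> \<bar>\<mu> (E - E')\<bar>)" if E: "big E" for E
  proof -
    have Eb: "E \<in> sets borel" using E by (simp add: big_def)
    \<comment> \<open>The margin \<open>\<bar>\<mu> E\<bar> + 1\<close> gives both \<open>B\<close>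
      and \<open>E - B\<close> measure at least 1 in absolute value, so whichever of them is still
      unbounded may be kept and the other discarded.\<close>
    obtain B where B: "B \<in> sets borel" "B \<subseteq> E" "\<bar>\<mu> B\<bar> > \<bar>\<mu> E\<bar> + 1"
      using E unfolding big_def by (meson not_le)
    have EB: "E - B \<in> sets borel" using Eb B(1) by auto
    have 1: "1 \<le> \<bar>\<mu> (E - B)\<bar>" using signed_borel_measure_Diff[OF \<mu> Eb B(1,2)] B(3) by linarith
    have "big B \<or> big (E - B)"
    proof (rule ccontr)
      assume "\<not> (big B \<or> big (E - B))"
      then obtain C1 C2 where C: "\<And>S. S \<in> sets borel \<Longrightarrow> S \<subseteq> B \<Longrightarrow> \<bar>\<mu> S\<bar> \<le> C1"
        "\<And>S. S \<in> sets borel \<Longrightarrow> S \<subseteq> E - B \<Longrightarrow> \<bar>\<mu> S\<bar> \<le> C2"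
        using B(1) EB unfolding big_def by meson
      have "\<bar>\<mu> S\<bar> \<le> C1 + C2" if S: "S \<in> sets borel" "S \<subseteq> E" for S
      proof -
        have "\<mu> ((S \<inter> B) \<union> (S - B)) = \<mu> (S \<inter> B) + \<mu> (S - B)"
          using S(1) B(1) by (intro signed_borel_measure_Un[OF \<mu>]) auto
        moreover have "(S \<inter> B) \<union> (S - B) = S" by auto
        moreover have "\<bar>\<mu> (S \<inter> B)\<bar> \<le> C1" "\<bar>\<mu> (S - B)\<bar> \<le> C2" using S B(1) by (auto intro!: C)
        ultimately show ?thesis by simp
      qed
      then show False using E unfolding big_def by blast
    qed
    then show ?thesis
    proof
      assume "big B"
      then show ?thesis using B(2) 1 by blast
    next
      assume "big (E - B)"
      moreover have "E - (E - B) = B" using B(2) by auto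
      ultimately show ?thesis using B(3) by (intro exI[of _ "E - B"]) auto
    qed
  qed
  have "big UNIV" using unb by (auto simp: big_def)
  then have "\<exists>E. \<forall>n. big (E n) \<and> (E (Suc n) \<subseteq> E n \<and> 1 \<le> \<bar>\<mu> (E n - E (Suc n))\<bar>)"
    using step by (intro dependent_nat_choice) auto
  then obtain E where E: "\<And>n. big (E n)" "\<And>n. E (Suc n) \<subseteq> E n \<and> 1 \<le> \<bar>\<mu> (E n - E (Suc n))\<bar>"
    by metis
  have dec: "E n \<subseteq> E m" if "m \<le> n" for m n
    by (rule lift_Suc_antimono_le[of E, OF _ that]) (use E(2) in blast)
  have "disjoint_family (\<lambda>n. E n - E (Suc n))"
    unfolding disjoint_family_on_def
  proof (intro ballI impI)
    fix m n :: nat assume "m \<noteq> n"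
    then have "Suc m \<le> n \<or> Suc n \<le> m" by linarith
    then show "(E m - E (Suc m)) \<inter> (E n - E (Suc n)) = {}" using dec by blast
  qed
  moreover have "range (\<lambda>n. E n - E (Suc n)) \<subseteq> sets borel" using E(1) by (auto simp: big_def)
  ultimately have "(\<lambda>n. \<mu> (E n - E (Suc n))) sums \<mu> (\<Union>n. E n - E (Suc n))"
    using \<mu> unfolding signed_borel_measure_def by blast
  then have "(\<lambda>n. \<mu> (E n - E (Suc n))) \<longlonglongrightarrow> 0" by (intro summable_LIMSEQ_zero) (rule sums_summable)
  then have "\<forall>\<^sub>F n in sequentially. \<bar>\<mu> (E n - E (Suc n))\<bar> < 1"
    by (auto dest!: tendstoD[of _ _ _ 1])
  then obtain n where "\<bar>\<mu> (E n - E (Suc n))\<bar> < 1" by (auto simp: eventually_sequentially)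
  then show False using E(2)[of n] by simp
qed

lemma finite_borel_pos_part:
  fixes \<mu> :: "'a::topological_space set \<Rightarrow> real"
  assumes \<mu>: "signed_borel_measure \<mu>"
  shows "finite_borel (pos_part \<mu>)"
proof -
  obtain C where C: "\<And>A. A \<in> sets borel \<Longrightarrow> \<bar>\<mu> A\<bar> \<le> C" using signed_borel_measure_bounded[OF \<mu>] by blast
  have UNIV: "UNIV \<in> sets (borel :: 'a measure)" by simp
  have "emeasure (pos_part \<mu>) UNIV \<le> ennreal C"
    unfolding emeasure_pos_part[OF \<mu> UNIV] upper_variation_def
    using C by (intro SUP_least ennreal_leI) (auto simp: abs_le_iff)
  then have "emeasure (pos_part \<mu>) UNIV \<noteq> \<infinity>" by (auto simp: top_unique)
  then show ?thesis by (auto simp: finite_borel_def intro!: finite_measureI)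
qed

lemma finite_borel_neg_part:
  "signed_borel_measure \<mu> \<Longrightarrow> finite_borel (neg_part \<mu>)"
  unfolding neg_part_def by (intro finite_borel_pos_part signed_borel_measure_uminus)

lemma pos_part_ge:
  assumes \<mu>: "signed_borel_measure \<mu>" and B: "B \<in> sets borel" "B \<subseteq> A" and A: "A \<in> sets borel"
  shows "\<mu> B \<le> measure (pos_part \<mu>) A"
proof -
  interpret finite_measure "pos_part \<mu>" using finite_borel_pos_part[OF \<mu>] by (rule finite_borelD)
  have "ennreal (\<mu> B) \<le> emeasure (pos_part \<mu>) A"
    unfolding emeasure_pos_part[OF \<mu> A] by (rule upper_variation_ge[OF B])
  then show ?thesis by (simp add: emeasure_eq_measure)
qed

lemma pos_part_le:
  assumes \<mu>: "signed_borel_measure \<mu>" and A: "A \<in> sets borel"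
    and le: "\<And>B. B \<in> sets borel \<Longrightarrow> B \<subseteq> A \<Longrightarrow> \<mu> B \<le> c"
  shows "measure (pos_part \<mu>) A \<le> c"
proof -
  interpret finite_measure "pos_part \<mu>" using finite_borel_pos_part[OF \<mu>] by (rule finite_borelD)
  have "0 \<le> c" using le[of "{}"] signed_borel_measure_empty[OF \<mu>] by simp
  moreover have "emeasure (pos_part \<mu>) A \<le> ennreal c"
    unfolding emeasure_pos_part[OF \<mu> A] upper_variation_def
    using le by (intro SUP_least ennreal_leI) auto
  ultimately show ?thesis by (simp add: emeasure_eq_measure)
qed

text \<open>For \<open>B \<subseteq> A\<close> one has
  \<open>- \<mu> B = \<mu> (A - B) - \<mu> A\<close>; taking suprema over \<open>B\<close> bounds
  one variation by the other, and exchanging the signs gives the reverse bound.\<close>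

lemma Jordan_decomposition:
  assumes \<mu>: "signed_borel_measure \<mu>" and A: "A \<in> sets borel"
  shows "\<mu> A = measure (pos_part \<mu>) A - measure (neg_part \<mu>) A"
proof (rule antisym)
  note \<mu>' = signed_borel_measure_uminus[OF \<mu>]
  have "measure (neg_part \<mu>) A \<le> measure (pos_part \<mu>) A - \<mu> A"
    unfolding neg_part_def
  proof (rule pos_part_le[OF \<mu>' A])
    fix B :: "'a set" assume B: "B \<in> sets borel" "B \<subseteq> A"
    have "\<mu> (A - B) \<le> measure (pos_part \<mu>) A" using B(1) A by (intro pos_part_ge[OF \<mu>]) auto
    then show "- \<mu> B \<le> measure (pos_part \<mu>) A - \<mu> A"
      using signed_borel_measure_Diff[OF \<mu> A B] by linarith
  qed
  then show "\<mu> A \<le> measure (pos_part \<mu>) A - measure (neg_part \<mu>) A" by linarith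
  have "measure (pos_part \<mu>) A \<le> measure (neg_part \<mu>) A + \<mu> A"
  proof (rule pos_part_le[OF \<mu> A])
    fix B :: "'a set" assume B: "B \<in> sets borel" "B \<subseteq> A"
    have "- \<mu> (A - B) \<le> measure (neg_part \<mu>) A"
      unfolding neg_part_def using B(1) A by (intro pos_part_ge[OF \<mu>']) auto
    then show "\<mu> B \<le> measure (neg_part \<mu>) A + \<mu> A"
      using signed_borel_measure_Diff[OF \<mu> A B] by linarith
  qed
  then show "measure (pos_part \<mu>) A - measure (neg_part \<mu>) A \<le> \<mu> A" by linarith
qed

section \<open>Differences of positive measures\<close>

definition signed_diff :: "'a::topological_space measure \<Rightarrow> 'a measure \<Rightarrow> 'a set \<Rightarrow> real" where
  "signed_diff A B E = (if E \<in> sets borel then measure A E - measure B E else 0)"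

lemma signed_borel_measure_signed_diff:
  assumes A: "finite_borel A" and B: "finite_borel B"
  shows "signed_borel_measure (signed_diff A B)"
  unfolding signed_borel_measure_def
proof (intro conjI allI impI)
  interpret A: finite_measure A using A by (rule finite_borelD)
  interpret B: finite_measure B using B by (rule finite_borelD)
  fix E :: "nat \<Rightarrow> 'a set" assume E: "range E \<subseteq> sets borel" "disjoint_family E"
  have "(\<lambda>i. measure A (E i)) sums measure A (\<Union>i. E i)"
    using E finite_borelD(1)[OF A] by (intro A.finite_measure_UNION) auto
  moreover have "(\<lambda>i. measure B (E i)) sums measure B (\<Union>i. E i)"
    using E finite_borelD(1)[OF B] by (intro B.finite_measure_UNION) auto
  moreover have "E i \<in> sets borel" for i using E by auto
  moreover have "(\<Union>i. E i) \<in> sets borel" using E by auto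
  ultimately show "(\<lambda>i. signed_diff A B (E i)) sums signed_diff A B (\<Union>i. E i)"
    by (simp add: signed_diff_def sums_diff)
qed (simp add: signed_diff_def)

text \<open>Minimality of the Jordan decomposition. Equality can fail because \<open>A\<close> and
  \<open>B\<close> may share mass that cancels.\<close>

lemma pos_part_signed_diff_le:
  assumes A: "finite_borel A" and B: "finite_borel B" and E: "E \<in> sets borel"
  shows "emeasure (pos_part (signed_diff A B)) E \<le> emeasure A E"
proof -
  interpret A: finite_measure A using A by (rule finite_borelD)
  have [simp]: "sets A = sets borel" using A by (rule finite_borelD)
  note m = signed_borel_measure_signed_diff[OF A B]
  interpret finite_measure "pos_part (signed_diff A B)"
    using finite_borel_pos_part[OF m] by (rule finite_borelD)
  have "measure (pos_part (signed_diff A B)) E \<le> measure A E"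
  proof (rule pos_part_le[OF m E])
    fix S :: "'a set" assume S: "S \<in> sets borel" "S \<subseteq> E"
    have "measure A S \<le> measure A E" using S E by (intro A.finite_measure_mono) auto
    moreover have "signed_diff A B S = measure A S - measure B S" using S(1) by (simp add: signed_diff_def)
    ultimately show "signed_diff A B S \<le> measure A E" using measure_nonneg[of B S] by linarith
  qed
  then show ?thesis by (simp add: emeasure_eq_measure A.emeasure_eq_measure ennreal_leI)
qed

lemma neg_part_signed_diff_le:
  assumes A: "finite_borel A" and B: "finite_borel B" and E: "E \<in> sets borel"
  shows "emeasure (neg_part (signed_diff A B)) E \<le> emeasure B E"
proof -
  have "(\<lambda>E. - signed_diff A B E) = signed_diff B A" by (auto simp: signed_diff_def fun_eq_iff)
  then show ?thesis unfolding neg_part_def using pos_part_signed_diff_le[OF B A E] by simp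
qed

lemma mutual_energy_mono:
  fixes M N :: "'a::euclidean_space measure"
  assumes M: "finite_borel M" and N: "finite_borel N"
    and le: "\<And>A. A \<in> sets borel \<Longrightarrow> emeasure M A \<le> emeasure N A"
  shows "mutual_energy M M \<le> mutual_energy N N"
proof -
  have s: "sets M = sets borel" "sets N = sets borel" using M N by (auto dest: finite_borelD)
  have MN: "M \<le> N" using s le by (subst le_measure) auto
  have "pot M x \<le> pot N x" for x
    unfolding pot_def using s MN by (intro nn_integral_mono_measure) auto
  then have "(\<integral>\<^sup>+x. pot M x \<partial>M) \<le> (\<integral>\<^sup>+x. pot N x \<partial>M)" by (intro nn_integral_mono)
  also have "\<dots> \<le> (\<integral>\<^sup>+x. pot N x \<partial>N)" using s MN by (intro nn_integral_mono_measure) auto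
  finally show ?thesis using M N by (simp add: mutual_energy_eq_pot)
qed

lemma finite_borel_total_variation:
  assumes \<mu>: "signed_borel_measure \<mu>"
  shows "finite_borel (total_variation \<mu>)"
proof -
  interpret P: finite_measure "pos_part \<mu>" using finite_borel_pos_part[OF \<mu>] by (rule finite_borelD)
  interpret N: finite_measure "neg_part \<mu>" using finite_borel_neg_part[OF \<mu>] by (rule finite_borelD)
  have "emeasure (total_variation \<mu>) UNIV \<noteq> \<infinity>" by (subst emeasure_total_variation) auto
  then show ?thesis by (auto simp: finite_borel_def intro!: finite_measureI)
qed

lemma admissible_energy_on:
  fixes \<mu> :: "'a::euclidean_space set \<Rightarrow> real"
  assumes \<Omega>: "closed \<Omega>" and \<mu>: "admissible \<Omega> \<mu>"
  shows "energy_on \<Omega> (pos_part \<mu>)" "energy_on \<Omega> (neg_part \<mu>)"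
proof -
  have sb: "signed_borel_measure \<mu>" and z: "emeasure (total_variation \<mu>) (- \<Omega>) = 0"
    and fin: "mutual_energy (total_variation \<mu>) (total_variation \<mu>) < \<infinity>"
    using \<mu> by (auto simp: admissible_def)
  note fb = finite_borel_pos_part[OF sb] finite_borel_neg_part[OF sb] finite_borel_total_variation[OF sb]
  have "- \<Omega> \<in> sets borel" using \<Omega> by (simp add: borel_open)
  then have z': "emeasure (pos_part \<mu>) (- \<Omega>) = 0" "emeasure (neg_part \<mu>) (- \<Omega>) = 0"
    using z by (simp_all add: emeasure_total_variation)
  have "mutual_energy (pos_part \<mu>) (pos_part \<mu>) \<le> mutual_energy (total_variation \<mu>) (total_variation \<mu>)"
    "mutual_energy (neg_part \<mu>) (neg_part \<mu>) \<le> mutual_energy (total_variation \<mu>) (total_variation \<mu>)"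
    by (auto intro!: mutual_energy_mono fb simp: emeasure_total_variation)
  with fin fb z' show "energy_on \<Omega> (pos_part \<mu>)" "energy_on \<Omega> (neg_part \<mu>)"
    by (auto simp: energy_on_def carried_by_def)
qed

lemma measure_carried_by:
  assumes M: "finite_borel M" and \<Omega>: "closed \<Omega>" "carried_by M \<Omega>"
  shows "measure M \<Omega> = measure M UNIV"
proof -
  interpret finite_measure M using M by (rule finite_borelD)
  have "AE x in M. x \<in> \<Omega>" using AE_carried_by[OF M \<Omega>] .
  then show ?thesis using \<Omega>(1) finite_borelD(1)[OF M]
    by (intro measure_eq_AE) (auto elim!: eventually_mono)
qed

text \<open>The total variation is dominated by the sum of \<open>A\<close> and \<open>B\<close>,
  which has finite energy and lives on \<open>\<Omega>\<close>.\<close>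

lemma admissible_signed_diff:
  fixes A B :: "'a::euclidean_space measure"
  assumes D: "DIM('a) \<ge> 3" and \<Omega>: "closed \<Omega>" and A: "energy_on \<Omega> A" and B: "energy_on \<Omega> B"
    and mass: "measure A UNIV = measure B UNIV"
  shows "admissible \<Omega> (signed_diff A B)"
proof -
  let ?\<mu> = "signed_diff A B"
  note fb = energy_onD(1)[OF A] energy_onD(1)[OF B]
  note sb = signed_borel_measure_signed_diff[OF fb]
  have L: "energy_on \<Omega> (lin 1 A 1 B)" by (rule energy_on_lin[OF D \<Omega> A B]) auto
  have le: "emeasure (total_variation ?\<mu>) E \<le> emeasure (lin 1 A 1 B) E" if "E \<in> sets borel" for E
    using that fb pos_part_signed_diff_le[OF fb that] neg_part_signed_diff_le[OF fb that]
    by (simp add: emeasure_total_variation emeasure_lin finite_borelD(1) add_mono)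
  have "mutual_energy (total_variation ?\<mu>) (total_variation ?\<mu>) \<le> mutual_energy (lin 1 A 1 B) (lin 1 A 1 B)"
    by (rule mutual_energy_mono[OF finite_borel_total_variation[OF sb] energy_onD(1)[OF L] le])
  also have "\<dots> < \<infinity>" by (rule energy_onD(3)[OF L])
  finally have "mutual_energy (total_variation ?\<mu>) (total_variation ?\<mu>) < \<infinity>" .
  moreover have "emeasure (total_variation ?\<mu>) (- \<Omega>) = 0"
    using le[of "- \<Omega>"] energy_onD(2)[OF L] \<Omega> by (simp add: carried_by_def borel_open)
  moreover have "?\<mu> \<Omega> = 0"
    using mass measure_carried_by[OF fb(1) \<Omega> energy_onD(2)[OF A]] measure_carried_by[OF fb(2) \<Omega> energy_onD(2)[OF B]]
    by (simp add: signed_diff_def)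
  ultimately show ?thesis using sb by (simp add: admissible_def)
qed

section \<open>Definiteness of the energy and the Euler-Lagrange equation\<close>

lemma integral_gauss_diff_square:
  fixes X Y :: "'a::euclidean_space measure"
  assumes D: "DIM('a) \<ge> 3" and X: "energy_on \<Omega> X" and Y: "energy_on \<Omega> Y"
  shows "integrable gauss_space (\<lambda>q. (gauss_transform X q - gauss_transform Y q)\<^sup>2)"
    and "(\<integral>q. (gauss_transform X q - gauss_transform Y q)\<^sup>2 \<partial>gauss_space) = ip X X - 2 * ip X Y + ip Y Y"
proof -
  note i = integrable_gauss_product[OF D X X] integrable_gauss_product[OF D X Y] integrable_gauss_product[OF D Y Y]
  have eq: "(\<lambda>q. (gauss_transform X q - gauss_transform Y q)\<^sup>2) = (\<lambda>q. gauss_transform X q * gauss_transform X q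
     - 2 * (gauss_transform X q * gauss_transform Y q) + gauss_transform Y q * gauss_transform Y q)"
    by (auto simp: power2_eq_square algebra_simps)
  show "integrable gauss_space (\<lambda>q. (gauss_transform X q - gauss_transform Y q)\<^sup>2)"
    unfolding eq using i by simp
  show "(\<integral>q. (gauss_transform X q - gauss_transform Y q)\<^sup>2 \<partial>gauss_space) = ip X X - 2 * ip X Y + ip Y Y"
    unfolding eq ip_def using i by simp
qed

text \<open>The left side is the squared norm of the difference of the Gaussian transforms; if it
  vanishes they agree a.e., and the transform is injective. This is the source of
  uniqueness.\<close>

lemma energy_distance_zero_imp_eq:
  fixes X Y :: "'a::euclidean_space measure"
  assumes D: "DIM('a) \<ge> 3" and X: "energy_on \<Omega> X" and Y: "energy_on \<Omega> Y"
    and z: "ip X X - 2 * ip X Y + ip Y Y = 0"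
  shows "X = Y"
proof (rule gauss_transform_inject[OF D energy_onD(1)[OF X] energy_onD(1)[OF Y]])
  have "AE q in gauss_space. (gauss_transform X q - gauss_transform Y q)\<^sup>2 = 0"
    using integral_nonneg_eq_0_iff_AE[OF integral_gauss_diff_square(1)[OF D X Y]]
      integral_gauss_diff_square(2)[OF D X Y] z by simp
  then show "AE q in gauss_space. gauss_transform X q = gauss_transform Y q"
    by (auto elim!: eventually_mono)
qed

lemma smooth_on_const: "smooth_on S (\<lambda>_. c)"
proof -
  have "Ck_on S k (\<lambda>_. c)" for k
    by (induction k arbitrary: c) (auto simp: frechet_derivative_const)
  then show ?thesis by (simp add: smooth_on_def)
qed

text \<open>Euler--Lagrange equation: the potential of \<open>A - B\<close> equals \<open>(c - \<phi>) / 2\<close> quasi-everywhere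
  on \<open>\<Omega>\<close>. The constant \<open>c\<close> is the Lagrange multiplier of the mass constraint; it is adjusted by adding a
  multiple of the equilibrium distribution, which has nonzero mass unless \<open>\<Omega>\<close> carries no
  nonzero measure of finite energy.\<close>

lemma Euler_Lagrange_solution:
  fixes \<Omega> :: "'a::euclidean_space set"
  assumes D: "DIM('a) \<ge> 3" and \<Omega>: "compact \<Omega>" and \<phi>: "smooth_on UNIV \<phi>"
  shows "\<exists>A B c. energy_on \<Omega> A \<and> energy_on \<Omega> B \<and> measure A UNIV = measure B UNIV
    \<and> (\<forall>N. energy_on \<Omega> N \<longrightarrow> 2 * (ip A N - ip B N) = c * measure N UNIV - (\<integral>x. \<phi> x \<partial>N))"
proof -
  have cl: "closed \<Omega>" using \<Omega> by (rule compact_imp_closed)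
  obtain A1 B1 where 1: "energy_on \<Omega> A1" "energy_on \<Omega> B1"
    "\<And>N. energy_on \<Omega> N \<Longrightarrow> ip A1 N - ip B1 N = (\<integral>x. \<phi> x \<partial>N)"
    using smooth_potential[OF D \<Omega> \<phi>] by metis
  obtain A2 B2 where 2: "energy_on \<Omega> A2" "energy_on \<Omega> B2"
    "\<And>N. energy_on \<Omega> N \<Longrightarrow> ip A2 N - ip B2 N = (\<integral>x. 1 \<partial>N)"
    using smooth_potential[OF D \<Omega> smooth_on_const[of UNIV 1]] by metis
  define m where "m N = measure N UNIV" for N :: "'a measure"
  have eq: "ip A2 N - ip B2 N = m N" if "energy_on \<Omega> N" for N
    using 2(3)[OF that] finite_borelD(3)[OF energy_onD(1)[OF that]] by (simp add: m_def)
  define e where "e = m A2 - m B2"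
  \<comment> \<open>The multiple of the equilibrium distribution \<open>A2 - B2\<close> that
    restores total mass 0; for \<open>e = 0\<close> division yields \<open>b = 0\<close>.\<close>
  define b where "b = (m A1 - m B1) / (2 * e)"
  \<comment> \<open>\<open>lin\<close> takes nonnegative coefficients only, so a negative multiple
    is realized by exchanging the roles of \<open>A2\<close> and \<open>B2\<close>.\<close>
  define p q where "p = max b 0" and "q = max (- b) 0"
  have pq: "p \<ge> 0" "q \<ge> 0" "p - q = b" by (auto simp: p_def q_def)
  define A3 B3 where "A3 = lin p A2 q B2" and "B3 = lin p B2 q A2"
  have 3: "energy_on \<Omega> A3" "energy_on \<Omega> B3"
    unfolding A3_def B3_def
    by (rule energy_on_lin[OF D cl 2(1,2) pq(1,2)], rule energy_on_lin[OF D cl 2(2,1) pq(1,2)])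
  \<comment> \<open>As signed measures, \<open>A - B = - (A1 - B1) / 2 + b (A2 - B2)\<close>; hence
    \<open>B1\<close> enters \<open>A\<close>, and \<open>A1\<close> enters
    \<open>B\<close>.\<close>
  define A B where "A = lin (1/2) B1 1 A3" and "B = lin (1/2) A1 1 B3"
  have 4: "energy_on \<Omega> A" "energy_on \<Omega> B"
    unfolding A_def B_def
    by (rule energy_on_lin[OF D cl 1(2) 3(1)], simp, simp, rule energy_on_lin[OF D cl 1(1) 3(2)], simp, simp)
  have mlin: "m (lin c M d N) = c * m M + d * m N"
    if M: "energy_on \<Omega> M" and N: "energy_on \<Omega> N" and cd: "c \<ge> 0" "d \<ge> 0" for M N c d
  proof -
    interpret M: finite_measure M using energy_onD(1)[OF M] by (rule finite_borelD)
    interpret N: finite_measure N using energy_onD(1)[OF N] by (rule finite_borelD)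
    have [simp]: "sets M = sets borel" "sets N = sets borel"
      using energy_onD(1)[OF M] energy_onD(1)[OF N] by (auto dest: finite_borelD)
    have "emeasure (lin c M d N) UNIV = ennreal (c * m M + d * m N)"
      using cd by (simp add: emeasure_lin M.emeasure_eq_measure N.emeasure_eq_measure m_def ennreal_mult)
    then have "m (lin c M d N) = enn2real (ennreal (c * m M + d * m N))"
      unfolding m_def[of "lin c M d N"] measure_def[of "lin c M d N"] by (simp only:)
    then show ?thesis using cd by (simp only: enn2real_ennreal m_def measure_nonneg mult_nonneg_nonneg add_nonneg_nonneg)
  qed
  have mA: "m A = (1/2) * m B1 + (p * m A2 + q * m B2)"
    using mlin[OF 1(2) 3(1), of "1/2" 1] mlin[OF 2(1,2) pq(1,2)] by (simp add: A_def A3_def)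
  have mB: "m B = (1/2) * m A1 + (p * m B2 + q * m A2)"
    using mlin[OF 1(1) 3(2), of "1/2" 1] mlin[OF 2(2,1) pq(1,2)] by (simp add: B_def B3_def)
  have "m A - m B = - (1/2) * (m A1 - m B1) + (p - q) * e"
    unfolding mA mB e_def by (simp add: field_simps)
  also have "\<dots> = 0"
  proof (cases "e = 0")
    case False
    then have "b * e = (m A1 - m B1) / 2" by (simp add: b_def)
    then show ?thesis unfolding pq(3) by linarith
  next
    case True
    \<comment> \<open>The mass of the equilibrium distribution is its own energy. If that is 0, then
      \<open>A2 = B2\<close>, so every finite-energy measure on \<open>\<Omega>\<close> has mass 0
      and the constraint is trivial.\<close>
    have "ip A2 A2 - 2 * ip A2 B2 + ip B2 B2 = e"
      using eq[OF 2(1)] eq[OF 2(2)] ip_commute[of A2 B2] by (simp add: e_def)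
    then have "A2 = B2" using True by (intro energy_distance_zero_imp_eq[OF D 2(1,2)]) simp
    then have "m N = 0" if "energy_on \<Omega> N" for N using eq[OF that] by simp
    then show ?thesis using 1(1,2) True by simp
  qed
  finally have mass: "measure A UNIV = measure B UNIV" by (simp add: m_def)
  have "2 * (ip A N - ip B N) = 2 * b * measure N UNIV - (\<integral>x. \<phi> x \<partial>N)" if N: "energy_on \<Omega> N" for N
  proof -
    have "ip A N = (1/2) * ip B1 N + 1 * ip A3 N" unfolding A_def by (rule ip_lin[OF D 1(2) 3(1) N]) auto
    moreover have "ip A3 N = p * ip A2 N + q * ip B2 N" unfolding A3_def by (rule ip_lin[OF D 2(1,2) N pq(1,2)])
    moreover have "ip B N = (1/2) * ip A1 N + 1 * ip B3 N" unfolding B_def by (rule ip_lin[OF D 1(1) 3(2) N]) auto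
    moreover have "ip B3 N = p * ip B2 N + q * ip A2 N" unfolding B3_def by (rule ip_lin[OF D 2(2,1) N pq(1,2)])
    ultimately have "2 * (ip A N - ip B N) = 2 * (p - q) * (ip A2 N - ip B2 N) - (ip A1 N - ip B1 N)"
      by (simp add: algebra_simps)
    then show ?thesis unfolding eq[OF N] 1(3)[OF N] pq(3) m_def .
  qed
  with 4 mass show ?thesis by blast
qed

lemma signed_set_integral_carried:
  fixes \<mu> :: "'a::euclidean_space set \<Rightarrow> real"
  assumes \<Omega>: "compact \<Omega>" and \<mu>: "admissible \<Omega> \<mu>" and \<phi>: "continuous_on UNIV \<phi>"
  shows "signed_set_integral \<mu> \<Omega> \<phi> = (\<integral>x. \<phi> x \<partial>pos_part \<mu>) - (\<integral>x. \<phi> x \<partial>neg_part \<mu>)"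
proof -
  have "(LINT x:\<Omega>|M. \<phi> x) = (\<integral>x. \<phi> x \<partial>M)" if M: "energy_on \<Omega> M" for M
    unfolding set_lebesgue_integral_def
  proof (rule integral_cong_AE)
    have [measurable_cong]: "sets M = sets borel" using energy_onD(1)[OF M] by (rule finite_borelD)
    note [measurable] = borel_measurable_continuous_onI[OF \<phi>] borel_compact[OF \<Omega>]
    show "(\<lambda>x. indicator \<Omega> x *\<^sub>R \<phi> x) \<in> borel_measurable M" "\<phi> \<in> borel_measurable M" by measurable
    show "AE x in M. indicator \<Omega> x *\<^sub>R \<phi> x = \<phi> x"
      using AE_carried_by[OF energy_onD(1)[OF M] compact_imp_closed[OF \<Omega>] energy_onD(2)[OF M]]
      by eventually_elim simp
  qed
  then show ?thesis
    unfolding signed_set_integral_def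
    using admissible_energy_on[OF compact_imp_closed[OF \<Omega>] \<mu>] by simp
qed

lemma I2_eq_ip:
  fixes \<mu> :: "'a::euclidean_space set \<Rightarrow> real"
  assumes D: "DIM('a) \<ge> 3" and \<Omega>: "closed \<Omega>" and \<mu>: "admissible \<Omega> \<mu>"
  shows "I2 \<mu> = ip (pos_part \<mu>) (pos_part \<mu>) - 2 * ip (pos_part \<mu>) (neg_part \<mu>) + ip (neg_part \<mu>) (neg_part \<mu>)"
  unfolding I2_def
  using admissible_energy_on[OF \<Omega> \<mu>] ip_commute[of "neg_part \<mu>" "pos_part \<mu>"]
  by (simp add: mutual_energy_eq_ip[OF D] ip_nonneg)

text \<open>Completing the square: the Euler-Lagrange equation removes all linear terms from
  \<open>F\<close>, which becomes the energy of \<open>\<mu> - \<mu>0\<close> plus a constant. That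
  energy is nonnegative and vanishes only for \<open>\<mu> = \<mu>0\<close>.\<close>

theorem unique_minimizer_compact:
  fixes \<Omega> :: "'a::euclidean_space set"
  assumes D: "DIM('a) \<ge> 3" and \<Omega>: "compact \<Omega>" and \<phi>: "smooth_on UNIV \<phi>"
  shows "\<exists>!\<mu>. is_arg_min (F \<phi> \<Omega>) (admissible \<Omega>) \<mu>"
proof -
  have cl: "closed \<Omega>" using \<Omega> by (rule compact_imp_closed)
  have c\<phi>: "continuous_on UNIV \<phi>" using \<phi>[unfolded smooth_on_def, rule_format, of 0] by simp
  obtain A B c where A: "energy_on \<Omega> A" and B: "energy_on \<Omega> B"
    and mass: "measure A UNIV = measure B UNIV"
    and EL: "\<And>N. energy_on \<Omega> N \<Longrightarrow> 2 * (ip A N - ip B N) = c * measure N UNIV - (\<integral>x. \<phi> x \<partial>N)"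
    using Euler_Lagrange_solution[OF D \<Omega> \<phi>] by metis
  define \<mu>0 where "\<mu>0 = signed_diff A B"
  have adm0: "admissible \<Omega> \<mu>0" unfolding \<mu>0_def by (rule admissible_signed_diff[OF D cl A B mass])
  \<comment> \<open>\<open>X \<mu> - Y \<mu>\<close> represents \<open>\<mu> - \<mu>0\<close> as a
    difference of positive measures, to which the energy form applies.\<close>
  define X where "X \<mu> = lin 1 (pos_part \<mu>) 1 B" for \<mu>
  define Y where "Y \<mu> = lin 1 (neg_part \<mu>) 1 A" for \<mu>
  define \<Delta> where "\<Delta> \<mu> = ip (X \<mu>) (X \<mu>) - 2 * ip (X \<mu>) (Y \<mu>) + ip (Y \<mu>) (Y \<mu>)" for \<mu>
  define c0 where "c0 = ip A A - 2 * ip A B + ip B B + (\<integral>x. \<phi> x \<partial>A) - (\<integral>x. \<phi> x \<partial>B)"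
  have XY: "energy_on \<Omega> (X \<mu>)" "energy_on \<Omega> (Y \<mu>)" if "admissible \<Omega> \<mu>" for \<mu>
    unfolding X_def Y_def using admissible_energy_on[OF cl that] A B
    by (auto intro!: energy_on_lin[OF D cl])
  have F_eq: "F \<phi> \<Omega> \<mu> = \<Delta> \<mu> + c0" if \<mu>: "admissible \<Omega> \<mu>" for \<mu>
  proof -
    define P N where "P = pos_part \<mu>" and "N = neg_part \<mu>"
    have PN: "energy_on \<Omega> P" "energy_on \<Omega> N"
      unfolding P_def N_def by (rule admissible_energy_on[OF cl \<mu>])+
    have m: "measure P UNIV = measure N UNIV"
    proof -
      have "measure P \<Omega> - measure N \<Omega> = \<mu> \<Omega>"
        unfolding P_def N_def using \<mu> cl by (subst Jordan_decomposition) (auto simp: admissible_def borel_closed)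
      then show ?thesis
        using \<mu> measure_carried_by[OF energy_onD(1)[OF PN(1)] cl energy_onD(2)[OF PN(1)]]
          measure_carried_by[OF energy_onD(1)[OF PN(2)] cl energy_onD(2)[OF PN(2)]]
        by (simp add: admissible_def)
    qed
    have l: "ip (lin 1 M 1 M') R = ip M R + ip M' R" "ip R (lin 1 M 1 M') = ip M R + ip M' R"
      if "energy_on \<Omega> M" "energy_on \<Omega> M'" "energy_on \<Omega> R" for M M' R
      using ip_lin[OF D that, of 1 1] by (simp_all add: ip_commute[of R])
    have X: "X \<mu> = lin 1 P 1 B" and Y: "Y \<mu> = lin 1 N 1 A" by (simp_all add: X_def Y_def P_def N_def)
    note eX = XY(1)[OF \<mu>, unfolded X] and eY = XY(2)[OF \<mu>, unfolded Y]
    have "\<Delta> \<mu> = (ip P P + ip B P + (ip P B + ip B B)) - 2 * (ip N P + ip A P + (ip N B + ip A B))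
      + (ip N N + ip A N + (ip N A + ip A A))"
      unfolding \<Delta>_def X Y using PN A B eX eY ip_commute[of P A] ip_commute[of B A] ip_commute[of B N] ip_commute[of P N]
      by (simp add: l)
    then have "\<Delta> \<mu> = ip P P - 2 * ip P N + ip N N + ip A A - 2 * ip A B + ip B B
      - 2 * (ip A P - ip B P) + 2 * (ip A N - ip B N)"
      using ip_commute[of P N] ip_commute[of P B] ip_commute[of N A] ip_commute[of N B] by simp
    also have "\<dots> = ip P P - 2 * ip P N + ip N N + ip A A - 2 * ip A B + ip B B
      + (\<integral>x. \<phi> x \<partial>P) - (\<integral>x. \<phi> x \<partial>N)"
      unfolding EL[OF PN(1)] EL[OF PN(2)] m by simp
    also have "\<dots> = F \<phi> \<Omega> \<mu> + (ip A A - 2 * ip A B + ip B B)"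
      unfolding F_def I2_eq_ip[OF D cl \<mu>] signed_set_integral_carried[OF \<Omega> \<mu> c\<phi>] P_def N_def by simp
    finally have 1: "F \<phi> \<Omega> \<mu> = \<Delta> \<mu> - (ip A A - 2 * ip A B + ip B B)" by simp
    \<comment> \<open>The Euler-Lagrange equation tested with \<open>A\<close> and \<open>B\<close>
      themselves; the multiplier drops out since their masses agree. This identifies the constant as
      \<open>c0\<close>.\<close>
    have "2 * (ip A A - 2 * ip A B + ip B B) = - (\<integral>x. \<phi> x \<partial>A) + (\<integral>x. \<phi> x \<partial>B)"
      using EL[OF A] EL[OF B] mass ip_commute[of A B] by (simp add: algebra_simps)
    then show ?thesis unfolding 1 c0_def by simp
  qed
  have \<Delta>_nonneg: "0 \<le> \<Delta> \<mu>" if "admissible \<Omega> \<mu>" for \<mu>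
    unfolding \<Delta>_def integral_gauss_diff_square(2)[OF D XY[OF that], symmetric]
    by (intro integral_nonneg_AE) auto
  have emX: "measure (lin 1 M 1 N) E = measure M E + measure N E"
    if M: "energy_on \<Omega> M" and N: "energy_on \<Omega> N" and E: "E \<in> sets borel" for M N E
  proof -
    interpret M: finite_measure M using energy_onD(1)[OF M] by (rule finite_borelD)
    interpret N: finite_measure N using energy_onD(1)[OF N] by (rule finite_borelD)
    have "emeasure (lin 1 M 1 N) E = ennreal (measure M E + measure N E)"
      using E finite_borelD(1)[OF energy_onD(1)[OF M]] finite_borelD(1)[OF energy_onD(1)[OF N]]
      by (simp add: emeasure_lin M.emeasure_eq_measure N.emeasure_eq_measure)
    then have "measure (lin 1 M 1 N) E = enn2real (ennreal (measure M E + measure N E))"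
      unfolding measure_def[of "lin 1 M 1 N"] by (simp only:)
    then show ?thesis by (simp only: enn2real_ennreal measure_nonneg add_nonneg_nonneg)
  qed
  \<comment> \<open>All measures involved are finite, so sums can be rearranged by real subtraction;
    on non-Borel sets both set functions are 0 by convention.\<close>
  have zero_iff: "X \<mu> = Y \<mu> \<longleftrightarrow> \<mu> = \<mu>0" if \<mu>: "admissible \<Omega> \<mu>" for \<mu>
  proof
    note PN = admissible_energy_on[OF cl \<mu>]
    have sb: "signed_borel_measure \<mu>" using \<mu> by (simp add: admissible_def)
    {
      assume eq: "X \<mu> = Y \<mu>"
      show "\<mu> = \<mu>0"
      proof
        fix E
        show "\<mu> E = \<mu>0 E"
        proof (cases "E \<in> sets borel")
          case True
          have "measure (pos_part \<mu>) E + measure B E = measure (neg_part \<mu>) E + measure A E"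
            using arg_cong[OF eq, of "\<lambda>M. measure M E"] emX[OF PN(1) B True] emX[OF PN(2) A True]
            by (simp add: X_def Y_def)
          then show ?thesis
            using Jordan_decomposition[OF sb True] True by (simp add: \<mu>0_def signed_diff_def)
        next
          case False
          then show ?thesis using sb by (simp add: \<mu>0_def signed_diff_def signed_borel_measure_def)
        qed
      qed
    }
    assume eq: "\<mu> = \<mu>0"
    show "X \<mu> = Y \<mu>"
    proof (rule measure_eqI)
      show "sets (X \<mu>) = sets (Y \<mu>)" by (simp add: X_def Y_def)
      fix E assume "E \<in> sets (X \<mu>)"
      then have E: "E \<in> sets borel" by (simp add: X_def)
      interpret X: finite_measure "X \<mu>" using energy_onD(1)[OF XY(1)[OF \<mu>]] by (rule finite_borelD)
      interpret Y: finite_measure "Y \<mu>" using energy_onD(1)[OF XY(2)[OF \<mu>]] by (rule finite_borelD)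
      have "measure (pos_part \<mu>) E - measure (neg_part \<mu>) E = measure A E - measure B E"
        using Jordan_decomposition[OF sb E] eq E by (simp add: \<mu>0_def signed_diff_def)
      then have "measure (X \<mu>) E = measure (Y \<mu>) E"
        unfolding X_def Y_def using emX[OF PN(1) B E] emX[OF PN(2) A E] by simp
      then show "emeasure (X \<mu>) E = emeasure (Y \<mu>) E"
        by (simp add: X.emeasure_eq_measure Y.emeasure_eq_measure)
    qed
  qed
  have "\<Delta> \<mu>0 = 0" using zero_iff[OF adm0] by (simp add: \<Delta>_def)
  show ?thesis
  proof (rule ex1I)
    show "is_arg_min (F \<phi> \<Omega>) (admissible \<Omega>) \<mu>0"
      unfolding is_arg_min_def using adm0 F_eq \<Delta>_nonneg \<open>\<Delta> \<mu>0 = 0\<close> by (auto simp: not_less)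
    fix \<mu> assume min: "is_arg_min (F \<phi> \<Omega>) (admissible \<Omega>) \<mu>"
    then have \<mu>: "admissible \<Omega> \<mu>" by (simp add: is_arg_min_def)
    have "F \<phi> \<Omega> \<mu> \<le> F \<phi> \<Omega> \<mu>0" using min adm0 by (auto simp: is_arg_min_def not_less)
    then have "\<Delta> \<mu> = 0" using F_eq[OF \<mu>] F_eq[OF adm0] \<Delta>_nonneg[OF \<mu>] \<open>\<Delta> \<mu>0 = 0\<close> by linarith
    then have "X \<mu> = Y \<mu>" unfolding \<Delta>_def by (intro energy_distance_zero_imp_eq[OF D XY[OF \<mu>]])
    then show "\<mu> = \<mu>0" using zero_iff[OF \<mu>] by simp
  qed
qed

theorem theorem1p10:
  fixes \<Omega> :: "(real ^ 'n) set" and \<phi> :: "real ^ 'n \<Rightarrow> real"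
  assumes "CARD('n) \<ge> 3"
    and "smooth_compact \<Omega>"
    and "smooth_on UNIV \<phi>"
  shows "\<exists>!\<mu>. is_arg_min (F \<phi> \<Omega>) (admissible \<Omega>) \<mu>"
proof (rule unique_minimizer_compact)
  show "DIM(real ^ 'n) \<ge> 3" using assms(1) by simp
  show "compact \<Omega>" using assms(2) by (auto simp: smooth_compact_def compact_closure)
qed (rule assms(3))

end
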